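(* Consider $\mathrm{SU}(5)$ with the Joyce hypercomplex structure $(I,J,K)$ associated with the basis $e_1^1=E_2$, $e_1^2=E_1$ of $\mathfrak{b}$ (corresponding to the matrix $A=\begin{pmatrix}0&1\\ 1&0\end{pmatrix}\in\mathrm{GL}(2,\mathbb{R})$), i.e. $$\mathfrak{su}(5)=\big(\langle E_2\rangle\oplus\mathfrak{d}_1\oplus\mathfrak{f}_1\big)\oplus\big(\langle E_1\rangle\oplus\mathfrak{d}_2\oplus\mathfrak{f}_2\big),$$ where $E_1=\mathrm{diag}(3i,3i,-2i,-2i,-2i)$ and $E_2=\mathrm{diag}(0,0,i,i,-2i)$. Then the holonomy group $\mathrm{Hol}(\nabla)$ of the Obata connection $\nabla$ of $(I,J,K)$ is isomorphic to $\mathrm{GL}(6,\mathbb{H})$.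
   Context: $\mathfrak{su}(5)$ is the algebra of trace-free skew-Hermitian $5\times5$ matrices, with Joyce decomposition $\mathfrak{su}(5)=\mathfrak{b}\oplus\mathfrak{d}_1\oplus\mathfrak{d}_2\oplus\mathfrak{f}_1\oplus\mathfrak{f}_2$, where: $\mathfrak{d}_i\cong\mathfrak{su}(2)$ ($i=1,2$) consists of trace-free skew-Hermitian matrices supported in the $2\times 2$ diagonal block with rows and columns $2i-1,2i$; $\mathfrak{f}_i$ consists of the matrices whose only non-zero entries are a $2\times(5-2i)$ complex block $F_i$ in rows $2i-1,2i$ and columns $2i+1,\dots,5$, together with $-\bar F_i^{t}$ in the transposed position; $\mathfrak{b}=\langle E_1,E_2\rangle$ is the space of trace-free skew-Hermitian diagonal matrices commuting with $\mathfrak{d}_1$ and $\mathfrak{d}_2$. Given $A=\begin{pmatrix}a_1&a_3\\ a_2&a_4\end{pmatrix}\in\mathrm{GL}(2,\mathbb{R})$ put $e_1^1=a_1E_1+a_2E_2$, $e_1^2=a_3E_1+a_4E_2$, and choose for $i=1,2$ a basis $(e_2^i,e_3^i,e_4^i)$ of $\mathfrak{d}_i$ with $[e_2^i,e_3^i]=2e_4^i$, $[e_4^i,e_2^i]=2e_3^i$, $[e_3^i,e_4^i]=2e_2^i$. The Joyce hypercomplex structure corresponding to $A$ is the left-invariant hypercomplex structure $(I,J,K)$ on $\mathrm{SU}(5)$ with $Ie_1^i=e_2^i$, $Ie_3^i=e_4^i$, $Je_1^i=e_3^i$, $Je_2^i=-e_4^i$, $Ke_1^i=e_4^i$, $Ke_2^i=e_3^i$,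 and $If=[e_2^i,f]$, $Jf=[e_3^i,f]$, $Kf=[e_4^i,f]$ for $f\in\mathfrak{f}_i$. The Obata connection is the unique torsion-free connection $\nabla$ preserving $I,J,K$; its holonomy group lies in the group of automorphisms of the tangent space at the identity commuting with $I,J,K$, identified with $\mathrm{GL}(6,\mathbb{H})$. *)

theory Defs
  imports "HOL-Analysis.Analysis" "HOL-Algebra.Bij"
begin

section \<open>Quaternions\<close>

datatype quat = Quat (qre: real) (qi: real) (qj: real) (qk: real)

lemma quat_eq_iff: "x = y \<longleftrightarrow> qre x = qre y \<and> qi x = qi y \<and> qj x = qj y \<and> qk x = qk y"
  by (cases x; cases y) simp

instantiation quat :: real_algebra_1
begin

definition "0 = Quat 0 0 0 0"
definition "1 = Quat 1 0 0 0"
definition "x + y = Quat (qre x + qre y) (qi x + qi y) (qj x + qj y) (qk x + qk y)"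
definition "x - y = Quat (qre x - qre y) (qi x - qi y) (qj x - qj y) (qk x - qk y)"
definition "- x = Quat (- qre x) (- qi x) (- qj x) (- qk x)"
definition "c *\<^sub>R x = Quat (c * qre x) (c * qi x) (c * qj x) (c * qk x)"
definition "x * y = Quat
  (qre x * qre y - qi x * qi y - qj x * qj y - qk x * qk y)
  (qre x * qi y + qi x * qre y + qj x * qk y - qk x * qj y)
  (qre x * qj y - qi x * qk y + qj x * qre y + qk x * qi y)
  (qre x * qk y + qi x * qj y - qj x * qi y + qk x * qre y)"

instance
  by standard
    (simp_all add: quat_eq_iff zero_quat_def one_quat_def plus_quat_def minus_quat_def
      uminus_quat_def scaleR_quat_def times_quat_def algebra_simps)

end

definition quat_i :: quat where "quat_i = Quat 0 1 0 0"
definition quat_j :: quat where "quat_j = Quat 0 0 1 0"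
definition quat_k :: quat where "quat_k = Quat 0 0 0 1"

definition GL_quat :: "(quat^'n^'n) monoid" where
  "GL_quat = \<lparr>carrier = {M. invertible M}, mult = (**), one = mat 1\<rparr>"

section \<open>The group SU(5) and its Lie algebra\<close>

type_synonym cmat5 = "complex^5^5"

definition adj :: "cmat5 \<Rightarrow> cmat5" where
  "adj X = (\<chi> r s. cnj (X $ s $ r))"

definition SU5 :: "cmat5 set" where
  "SU5 = {g. g ** adj g = mat 1 \<and> det g = 1}"

definition su5 :: "cmat5 set" where
  "su5 = {X. adj X = - X \<and> trace X = 0}"

definition bracket :: "cmat5 \<Rightarrow> cmat5 \<Rightarrow> cmat5" where
  "bracket X Y = X ** Y - Y ** X"

definition linear_between ::
    "'a::real_vector set \<Rightarrow> 'b::real_vector set \<Rightarrow> ('a \<Rightarrow> 'b) \<Rightarrow> bool" where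
  "linear_between V W f \<longleftrightarrow> f ` V \<subseteq> W \<and>
     (\<forall>x\<in>V. \<forall>y\<in>V. f (x + y) = f x + f y) \<and> (\<forall>c. \<forall>x\<in>V. f (c *\<^sub>R x) = c *\<^sub>R f x)"

section \<open>Joyce hypercomplex structures on SU(5)\<close>

text \<open>The superscripts \<open>i = 1, 2\<close> are natural numbers. Rows and columns are indexed by the
  numeral type \<open>5\<close>, in which \<open>5 = 0\<close>.\<close>

definition block :: "nat \<Rightarrow> 5 set" where
  "block i = (if i = 1 then {1, 2} else {3, 4})"

definition beyond :: "nat \<Rightarrow> 5 set" where
  "beyond i = (if i = 1 then {3, 4, 5} else {5})"

definition d_sub :: "nat \<Rightarrow> cmat5 set" where
  "d_sub i = {X \<in> su5. \<forall>r s. X $ r $ s \<noteq> 0 \<longrightarrow> r \<in> block i \<and> s \<in> block i}"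

definition f_sub :: "nat \<Rightarrow> cmat5 set" where
  "f_sub i = {X. adj X = - X \<and> (\<forall>r s. X $ r $ s \<noteq> 0 \<longrightarrow>
      (r \<in> block i \<and> s \<in> beyond i) \<or> (r \<in> beyond i \<and> s \<in> block i))}"

definition E1 :: cmat5 where
  "E1 = (\<chi> r s. if r \<noteq> s then 0 else if r \<in> {1, 2} then 3 * \<i> else - 2 * \<i>)"

definition E2 :: cmat5 where
  "E2 = (\<chi> r s. if r \<noteq> s then 0 else if r \<in> {1, 2} then 0 else if r \<in> {3, 4} then \<i> else - 2 * \<i>)"

text \<open>\<open>e i j\<close> stands for $e_j^i$. The columns of \<open>A\<close> are the coordinates of
  $e_1^1$ and $e_1^2$ with respect to \<open>E1, E2\<close>.\<close>

definition joyce_basis :: "real^2^2 \<Rightarrow> (nat \<Rightarrow> nat \<Rightarrow> cmat5) \<Rightarrow> bool" where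
  "joyce_basis A e \<longleftrightarrow> invertible A \<and>
     e 1 1 = A $ 1 $ 1 *\<^sub>R E1 + A $ 2 $ 1 *\<^sub>R E2 \<and>
     e 2 1 = A $ 1 $ 2 *\<^sub>R E1 + A $ 2 $ 2 *\<^sub>R E2 \<and>
     (\<forall>i\<in>{1, 2}.
        inj_on (e i) {2, 3, 4} \<and> independent (e i ` {2, 3, 4}) \<and> span (e i ` {2, 3, 4}) = d_sub i \<and>
        bracket (e i 2) (e i 3) = 2 *\<^sub>R e i 4 \<and>
        bracket (e i 4) (e i 2) = 2 *\<^sub>R e i 3 \<and>
        bracket (e i 3) (e i 4) = 2 *\<^sub>R e i 2)"

text \<open>A left-invariant almost hypercomplex structure is given by its value at the identity, a triple
  of endomorphisms of \<open>su5\<close>. The formulas below determine this triple, and integrability is then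
  automatic.\<close>

definition joyce_hypercomplex ::
    "real^2^2 \<Rightarrow> (nat \<Rightarrow> nat \<Rightarrow> cmat5) \<Rightarrow>
     (cmat5 \<Rightarrow> cmat5) \<Rightarrow> (cmat5 \<Rightarrow> cmat5) \<Rightarrow> (cmat5 \<Rightarrow> cmat5) \<Rightarrow> bool" where
  "joyce_hypercomplex A e I J K \<longleftrightarrow> joyce_basis A e \<and>
     linear_between su5 su5 I \<and> linear_between su5 su5 J \<and> linear_between su5 su5 K \<and>
     (\<forall>x\<in>su5. I (I x) = - x \<and> J (J x) = - x \<and> K (K x) = - x \<and> I (J x) = K x \<and> J (I x) = - K x) \<and>
     (\<forall>i\<in>{1, 2}.
        I (e i 1) = e i 2 \<and> I (e i 3) = e i 4 \<and>
        J (e i 1) = e i 3 \<and> J (e i 2) = - e i 4 \<and>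
        K (e i 1) = e i 4 \<and> K (e i 2) = e i 3 \<and>
        (\<forall>f\<in>f_sub i. I f = bracket (e i 2) f \<and> J f = bracket (e i 3) f \<and> K f = bracket (e i 4) f))"

section \<open>Affine connections on SU(5)\<close>

text \<open>On a finite-dimensional space this is the usual notion: a map is of class $C^{k+1}$ if it is
  differentiable and all its directional derivatives are of class $C^k$.\<close>

primrec Ck_on :: "nat \<Rightarrow> ('a::real_normed_vector \<Rightarrow> 'b::real_normed_vector) \<Rightarrow> 'a set \<Rightarrow> bool" where
  "Ck_on 0 f U \<longleftrightarrow> continuous_on U f"
| "Ck_on (Suc k) f U \<longleftrightarrow>
     (\<exists>f'. (\<forall>x\<in>U. (f has_derivative f' x) (at x)) \<and> (\<forall>v. Ck_on k (\<lambda>x. f' x v) U))"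

definition smooth_near :: "'a::real_normed_vector set \<Rightarrow> ('a \<Rightarrow> 'b::real_normed_vector) \<Rightarrow> bool" where
  "smooth_near S f \<longleftrightarrow> (\<exists>U. open U \<and> S \<subseteq> U \<and> (\<forall>k. Ck_on k f U))"

definition tangent :: "cmat5 \<Rightarrow> cmat5 set" where
  "tangent g = (\<lambda>x. g ** x) ` su5"

text \<open>\<open>SU5\<close> is a closed submanifold of the space of matrices, so every smooth function or vector
  field on it is the restriction of a smooth map on a neighbourhood. Functions and vector fields are
  represented by such extensions, and only their values on \<open>SU5\<close> matter.\<close>

definition eq_on_SU5 :: "(cmat5 \<Rightarrow> 'b) \<Rightarrow> (cmat5 \<Rightarrow> 'b) \<Rightarrow> bool" where
  "eq_on_SU5 X Y \<longleftrightarrow> (\<forall>g\<in>SU5. X g = Y g)"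

definition vector_fields :: "(cmat5 \<Rightarrow> cmat5) set" where
  "vector_fields = {X. smooth_near SU5 X \<and> (\<forall>g\<in>SU5. X g \<in> tangent g)}"

definition left_invariant_field :: "cmat5 \<Rightarrow> cmat5 \<Rightarrow> cmat5" where
  "left_invariant_field x = (\<lambda>g. g ** x)"

definition lie_bracket_field :: "(cmat5 \<Rightarrow> cmat5) \<Rightarrow> (cmat5 \<Rightarrow> cmat5) \<Rightarrow> cmat5 \<Rightarrow> cmat5" where
  "lie_bracket_field X Y g = frechet_derivative Y (at g) (X g) - frechet_derivative X (at g) (Y g)"

definition affine_connection :: "((cmat5 \<Rightarrow> cmat5) \<Rightarrow> (cmat5 \<Rightarrow> cmat5) \<Rightarrow> cmat5 \<Rightarrow> cmat5) \<Rightarrow> bool" where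
  "affine_connection D \<longleftrightarrow>
     (\<forall>X\<in>vector_fields. \<forall>Y\<in>vector_fields. D X Y \<in> vector_fields) \<and>
     (\<forall>X\<in>vector_fields. \<forall>X'\<in>vector_fields. \<forall>Y\<in>vector_fields. \<forall>Y'\<in>vector_fields.
        eq_on_SU5 X X' \<longrightarrow> eq_on_SU5 Y Y' \<longrightarrow> eq_on_SU5 (D X Y) (D X' Y')) \<and>
     (\<forall>X\<in>vector_fields. \<forall>X'\<in>vector_fields. \<forall>Y\<in>vector_fields.
        eq_on_SU5 (D (\<lambda>g. X g + X' g) Y) (\<lambda>g. D X Y g + D X' Y g)) \<and>
     (\<forall>X\<in>vector_fields. \<forall>Y\<in>vector_fields. \<forall>Y'\<in>vector_fields.
        eq_on_SU5 (D X (\<lambda>g. Y g + Y' g)) (\<lambda>g. D X Y g + D X Y' g)) \<and>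
     (\<forall>X\<in>vector_fields. \<forall>Y\<in>vector_fields. \<forall>\<phi> :: cmat5 \<Rightarrow> real. smooth_near SU5 \<phi> \<longrightarrow>
        eq_on_SU5 (D (\<lambda>g. \<phi> g *\<^sub>R X g) Y) (\<lambda>g. \<phi> g *\<^sub>R D X Y g) \<and>
        eq_on_SU5 (D X (\<lambda>g. \<phi> g *\<^sub>R Y g))
          (\<lambda>g. frechet_derivative \<phi> (at g) (X g) *\<^sub>R Y g + \<phi> g *\<^sub>R D X Y g))"

definition torsion_free :: "((cmat5 \<Rightarrow> cmat5) \<Rightarrow> (cmat5 \<Rightarrow> cmat5) \<Rightarrow> cmat5 \<Rightarrow> cmat5) \<Rightarrow> bool" where
  "torsion_free D \<longleftrightarrow> (\<forall>X\<in>vector_fields. \<forall>Y\<in>vector_fields.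
     eq_on_SU5 (\<lambda>g. D X Y g - D Y X g) (lie_bracket_field X Y))"

text \<open>The left-invariant endomorphism field with value \<open>T\<close> at the identity; note that the inverse of
  an element of \<open>SU5\<close> is its adjoint.\<close>

definition left_translate :: "(cmat5 \<Rightarrow> cmat5) \<Rightarrow> cmat5 \<Rightarrow> cmat5 \<Rightarrow> cmat5" where
  "left_translate T g v = g ** T (adj g ** v)"

text \<open>The field \<open>Z\<close> below represents $TY$, so that the condition reads $D_X (TY) = T (D_X Y)$.\<close>

definition preserves ::
    "((cmat5 \<Rightarrow> cmat5) \<Rightarrow> (cmat5 \<Rightarrow> cmat5) \<Rightarrow> cmat5 \<Rightarrow> cmat5) \<Rightarrow> (cmat5 \<Rightarrow> cmat5) \<Rightarrow> bool" where
  "preserves D T \<longleftrightarrow> (\<forall>X\<in>vector_fields. \<forall>Y\<in>vector_fields. \<forall>Z\<in>vector_fields.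
     eq_on_SU5 Z (\<lambda>g. left_translate T g (Y g)) \<longrightarrow>
     eq_on_SU5 (D X Z) (\<lambda>g. left_translate T g (D X Y g)))"

definition obata_connection ::
    "(cmat5 \<Rightarrow> cmat5) \<Rightarrow> (cmat5 \<Rightarrow> cmat5) \<Rightarrow> (cmat5 \<Rightarrow> cmat5) \<Rightarrow>
     ((cmat5 \<Rightarrow> cmat5) \<Rightarrow> (cmat5 \<Rightarrow> cmat5) \<Rightarrow> cmat5 \<Rightarrow> cmat5) \<Rightarrow> bool" where
  "obata_connection I J K D \<longleftrightarrow>
     affine_connection D \<and> torsion_free D \<and> preserves D I \<and> preserves D J \<and> preserves D K"

section \<open>Holonomy\<close>

definition piecewise_smooth_path :: "(real \<Rightarrow> 'a::real_normed_vector) \<Rightarrow> bool" where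
  "piecewise_smooth_path \<gamma> \<longleftrightarrow> (\<exists>S. finite S \<and>
     (\<forall>a b. 0 \<le> a \<and> a < b \<and> b \<le> 1 \<and> {a<..<b} \<inter> S = {} \<longrightarrow>
        (\<exists>h. smooth_near {a..b} h \<and> (\<forall>t\<in>{a..b}. \<gamma> t = h t))))"

text \<open>For a field \<open>V\<close> along \<open>\<gamma>\<close> write $V(t) = \gamma(t) u(t)$, i.e. expand \<open>V\<close> in a left-invariant
  frame. With $\xi = \gamma^{-1}\gamma'$, the Leibniz rule gives
  $\frac{DV}{dt} = \gamma u' + (D_{L_\xi} L_u)(\gamma)$, where $L_x$ is the left-invariant field of $x$.\<close>

definition parallel_along ::
    "((cmat5 \<Rightarrow> cmat5) \<Rightarrow> (cmat5 \<Rightarrow> cmat5) \<Rightarrow> cmat5 \<Rightarrow> cmat5) \<Rightarrow>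
     (real \<Rightarrow> cmat5) \<Rightarrow> (real \<Rightarrow> cmat5) \<Rightarrow> bool" where
  "parallel_along D \<gamma> V \<longleftrightarrow>
     continuous_on {0..1} V \<and> (\<forall>t\<in>{0..1}. V t \<in> tangent (\<gamma> t)) \<and>
     (\<exists>S. finite S \<and> (\<forall>t\<in>{0<..<1} - S. \<exists>\<gamma>' u'.
        (\<gamma> has_vector_derivative \<gamma>') (at t) \<and>
        ((\<lambda>s. adj (\<gamma> s) ** V s) has_vector_derivative u') (at t) \<and>
        \<gamma> t ** u' + D (left_invariant_field (adj (\<gamma> t) ** \<gamma>'))
                      (left_invariant_field (adj (\<gamma> t) ** V t)) (\<gamma> t) = 0))"

text \<open>Parallel transports around loops at the identity, whose tangent space is \<open>su5\<close>, as a group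
  under composition.\<close>

definition holonomy_group ::
    "((cmat5 \<Rightarrow> cmat5) \<Rightarrow> (cmat5 \<Rightarrow> cmat5) \<Rightarrow> cmat5 \<Rightarrow> cmat5) \<Rightarrow> (cmat5 \<Rightarrow> cmat5) monoid" where
  "holonomy_group D = (BijGroup su5)
     \<lparr>carrier := {P \<in> Bij su5. \<exists>\<gamma>. piecewise_smooth_path \<gamma> \<and> \<gamma> ` {0..1} \<subseteq> SU5 \<and>
        \<gamma> 0 = mat 1 \<and> \<gamma> 1 = mat 1 \<and>
        (\<forall>x\<in>su5. \<exists>V. parallel_along D \<gamma> V \<and> V 0 = x \<and> V 1 = P x)}\<rparr>"

text \<open>An identification of the tangent space at the identity with $\mathbb{H}^6$. Column vectors carry
  the left scalar action $q \cdot v = v \bar q$, so that the endomorphisms commuting with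
  \<open>I, J, K\<close> become the maps $v \mapsto Mv$ for quaternionic matrices $M$.\<close>

definition quaternionic_frame ::
    "(cmat5 \<Rightarrow> cmat5) \<Rightarrow> (cmat5 \<Rightarrow> cmat5) \<Rightarrow> (cmat5 \<Rightarrow> cmat5) \<Rightarrow> (cmat5 \<Rightarrow> quat^6) \<Rightarrow> bool" where
  "quaternionic_frame I J K \<Phi> \<longleftrightarrow>
     linear_between su5 UNIV \<Phi> \<and> bij_betw \<Phi> su5 UNIV \<and>
     (\<forall>x\<in>su5. \<forall>n. \<Phi> (I x) $ n = \<Phi> x $ n * (- quat_i) \<and>
                  \<Phi> (J x) $ n = \<Phi> x $ n * (- quat_j) \<and>
                  \<Phi> (K x) $ n = \<Phi> x $ n * (- quat_k))"

definition matrix_action :: "(cmat5 \<Rightarrow> quat^6) \<Rightarrow> quat^6^6 \<Rightarrow> cmat5 \<Rightarrow> cmat5" where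
  "matrix_action \<Phi> M = (\<lambda>x\<in>su5. inv_into su5 \<Phi> (M *v \<Phi> x))"

end

theory Submission
  imports Defs
begin

text \<open>For left-invariant fields the Obata connection is the unique bilinear map
  $\nabla_x y$ on $\mathfrak{su}(5)$ that is quaternionic in $y$ and satisfies
  $\nabla_x y - \nabla_y x = [x,y]$. In quaternionic coordinates it is given by an explicit matrix
  \<open>obata_matrix x\<close>, and parallel transport solves $u' = - \nabla_{\xi} u$ with
  $\xi = \gamma^{-1} \gamma'$. Uniqueness for this equation shows that the holonomy consists of
  quaternionic matrices.

  Conversely, along the loop $e^{sx} e^{ty} e^{-sx} e^{-ty'}$ with $y' = \mathrm{Ad}(e^{sx}) y$ the
  transport is a product of four exponentials. Hence the velocities at the identity of curves in the
  holonomy group form a Lie algebra which is stable under $[\nabla_x, -]$ and contains the curvature.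
  Four curvature values, two of them imaginary multiples of a diagonal matrix unit, one a multiple of an
  off-diagonal one and one with non-zero real trace, already generate all of
  $\mathfrak{gl}(6,\mathbb{H})$. An open mapping argument then gives a neighbourhood
  of the identity, and Gaussian elimination the whole of $\mathrm{GL}(6,\mathbb{H})$.\<close>

section \<open>Quaternions as a Euclidean space\<close>

text \<open>The two inclusions need different tools. Arbitrary loops occur only in the upper bound,
  where uniqueness of solutions is enough. The lower bound uses only broken one-parameter paths, on
  which the transport is a product of matrix exponentials, so neither an existence theorem for
  time-dependent equations nor a general holonomy theorem enters. The curves in the holonomy group
  are continuous and are differentiated at the parameter 0 only. This weak notion survives products
  and conjugation, and since subspaces of a finite-dimensional space are closed, the derivative of a
  curve of velocities is again a velocity. Commutators have vanishing real trace, so the multiples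
  of the identity can only be reached through a curvature value of non-zero real trace. The bases of
  the two copies of su(2) are known only through their bracket relations. A block-diagonal unitary
  matrix carries them to standard ones, and conjugation preserves brackets, so one explicit
  connection matrix serves every admissible basis.\<close>

instantiation quat :: real_inner
begin

definition inner_quat :: "quat \<Rightarrow> quat \<Rightarrow> real" where
  "inner_quat x y = qre x * qre y + qi x * qi y + qj x * qj y + qk x * qk y"
definition norm_quat :: "quat \<Rightarrow> real" where "norm_quat x = sqrt (inner x x)"
definition dist_quat :: "quat \<Rightarrow> quat \<Rightarrow> real" where "dist_quat x y = norm (x - y)"
definition sgn_quat :: "quat \<Rightarrow> quat" where "sgn_quat x = x /\<^sub>R norm x"
definition uniformity_quat :: "(quat \<times> quat) filter" where
  "uniformity_quat = (INF e\<in>{0 <..}. principal {(x, y). dist x y < e})"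
definition open_quat :: "quat set \<Rightarrow> bool" where
  "open_quat U \<longleftrightarrow> (\<forall>x\<in>U. eventually (\<lambda>(x', y). x' = x \<longrightarrow> y \<in> U) uniformity)"

instance
proof
  fix x y z :: quat and r :: real and U :: "quat set"
  show "dist x y = norm (x - y)" by (rule dist_quat_def)
  show "sgn x = x /\<^sub>R norm x" by (rule sgn_quat_def)
  show "uniformity = (INF e\<in>{0 <..}. principal {(x, y). dist x (y::quat) < e})"
    by (rule uniformity_quat_def)
  show "open U \<longleftrightarrow> (\<forall>x\<in>U. eventually (\<lambda>(x', y). x' = x \<longrightarrow> y \<in> U) uniformity)"
    by (rule open_quat_def)
  show "inner x y = inner y x" by (simp add: inner_quat_def mult.commute)
  show "inner (x + y) z = inner x z + inner y z"
    by (simp add: inner_quat_def plus_quat_def algebra_simps)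
  show "inner (scaleR r x) y = r * inner x y"
    by (simp add: inner_quat_def scaleR_quat_def algebra_simps)
  show "0 \<le> inner x x" by (simp add: inner_quat_def)
  show "inner x x = 0 \<longleftrightarrow> x = 0"
    by (auto simp: inner_quat_def zero_quat_def quat_eq_iff add_nonneg_eq_0_iff)
  show "norm x = sqrt (inner x x)" by (rule norm_quat_def)
qed

end

lemma quat_sel [simp]:
  "qre 0 = 0" "qi 0 = 0" "qj 0 = 0" "qk 0 = 0"
  "qre 1 = 1" "qi 1 = 0" "qj 1 = 0" "qk 1 = 0"
  "qre (x + y) = qre x + qre y" "qi (x + y) = qi x + qi y"
  "qj (x + y) = qj x + qj y" "qk (x + y) = qk x + qk y"
  "qre (x - y) = qre x - qre y" "qi (x - y) = qi x - qi y"
  "qj (x - y) = qj x - qj y" "qk (x - y) = qk x - qk y"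
  "qre (- x) = - qre x" "qi (- x) = - qi x" "qj (- x) = - qj x" "qk (- x) = - qk x"
  "qre (c *\<^sub>R x) = c * qre x" "qi (c *\<^sub>R x) = c * qi x"
  "qj (c *\<^sub>R x) = c * qj x" "qk (c *\<^sub>R x) = c * qk x"
  "qre (x * y) = qre x * qre y - qi x * qi y - qj x * qj y - qk x * qk y"
  "qi (x * y) = qre x * qi y + qi x * qre y + qj x * qk y - qk x * qj y"
  "qj (x * y) = qre x * qj y - qi x * qk y + qj x * qre y + qk x * qi y"
  "qk (x * y) = qre x * qk y + qi x * qj y - qj x * qi y + qk x * qre y"
  "qre quat_i = 0" "qi quat_i = 1" "qj quat_i = 0" "qk quat_i = 0"
  "qre quat_j = 0" "qi quat_j = 0" "qj quat_j = 1" "qk quat_j = 0"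
  "qre quat_k = 0" "qi quat_k = 0" "qj quat_k = 0" "qk quat_k = 1"
  by (simp_all add: zero_quat_def one_quat_def plus_quat_def minus_quat_def uminus_quat_def
      scaleR_quat_def times_quat_def quat_i_def quat_j_def quat_k_def)

text \<open>This makes \<open>quat^6\<close> and \<open>quat^6^6\<close> Euclidean spaces: linear
  maps are bounded, a subspace is its own double orthogonal complement, and an open mapping theorem
  applies.\<close>

instantiation quat :: euclidean_space
begin

definition Basis_quat :: "quat set" where "Basis_quat = {1, quat_i, quat_j, quat_k}"

instance
proof
  show "(Basis :: quat set) \<noteq> {}" "finite (Basis :: quat set)"
    by (simp_all add: Basis_quat_def)
  show "inner u v = (if u = v then 1 else 0)" if "u \<in> Basis" "v \<in> Basis" for u v :: quat
    using that by (auto simp: Basis_quat_def inner_quat_def quat_eq_iff)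
  show "(\<forall>u\<in>Basis. inner x u = 0) \<longleftrightarrow> x = 0" for x :: quat
    unfolding quat_eq_iff[of x 0] by (auto simp add: Basis_quat_def inner_quat_def)
qed

end

section \<open>Matrices over a finite-dimensional real algebra\<close>

text \<open>Stated over a general algebra because the product rule is needed both for paths in
  SU(5), with complex entries, and for their transports, with quaternionic entries.\<close>

lemma bounded_bilinear_matrix_mult:
  "bounded_bilinear ((**) :: 'a::{euclidean_space,real_algebra_1}^'n^'m \<Rightarrow> 'a^'k^'n \<Rightarrow> 'a^'k^'m)"
  unfolding bilinear_conv_bounded_bilinear[symmetric] bilinear_def
  by (auto intro!: linearI simp: vec_eq_iff matrix_matrix_mult_def distrib_left distrib_right
      sum.distrib scaleR_sum_right)

lemma bounded_bilinear_matrix_vector_mult: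
  "bounded_bilinear ((*v) :: 'a::{euclidean_space,real_algebra_1}^'n^'m \<Rightarrow> 'a^'n \<Rightarrow> 'a^'m)"
  unfolding bilinear_conv_bounded_bilinear[symmetric] bilinear_def
  by (auto intro!: linearI simp: vec_eq_iff matrix_vector_mult_def distrib_left distrib_right
      sum.distrib scaleR_sum_right)

interpretation mmult: bounded_bilinear
  "(**) :: 'a::{euclidean_space,real_algebra_1}^'n^'m \<Rightarrow> 'a^'k^'n \<Rightarrow> 'a^'k^'m"
  by (rule bounded_bilinear_matrix_mult)

interpretation mvmult: bounded_bilinear
  "(*v) :: 'a::{euclidean_space,real_algebra_1}^'n^'m \<Rightarrow> 'a^'n \<Rightarrow> 'a^'m"
  by (rule bounded_bilinear_matrix_vector_mult)

section \<open>Linear differential equations\<close>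

text \<open>The solution is the exponential series of \<open>f\<close> applied to \<open>v\<close>.
  It is assembled from its real coordinates, each an everywhere convergent power series, so that
  termwise differentiation of real series applies.\<close>

lemma linear_flow_exists:
  fixes f :: "'b::euclidean_space \<Rightarrow> 'b"
  assumes lin: "linear f"
  shows "\<exists>u. u 0 = v \<and> (\<forall>t. (u has_vector_derivative f (u t)) (at t))"
proof -
  obtain K where K: "K > 0" "\<And>x. norm (f x) \<le> K * norm x"
    using linear_bounded_pos[OF lin] by (auto simp: mult.commute)
  define c where "c b n = (((f ^^ n) v) \<bullet> b) / fact n" for b n
  define s where "s b t = (\<Sum>n. c b n * t ^ n)" for b t
  define u where "u t = (\<Sum>b\<in>Basis. s b t *\<^sub>R b)" for t
  have nrm: "norm ((f ^^ n) v) \<le> K ^ n * norm v" for n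
  proof (induction n)
    case (Suc n)
    have "norm ((f ^^ Suc n) v) \<le> K * norm ((f ^^ n) v)" using K by simp
    also have "\<dots> \<le> K * (K ^ n * norm v)" using Suc K by simp
    finally show ?case by (simp add: mult.assoc)
  qed simp
  have summ: "summable (\<lambda>n. c b n * t ^ n)" if "b \<in> Basis" for b t
  proof (rule summable_comparison_test[where g = "\<lambda>n. norm v * (inverse (fact n) * (K * \<bar>t\<bar>) ^ n)"])
    have "norm (c b n * t ^ n) \<le> norm v * (inverse (fact n) * (K * \<bar>t\<bar>) ^ n)" for n
    proof -
      have "\<bar>((f ^^ n) v) \<bullet> b\<bar> \<le> K ^ n * norm v"
        using Basis_le_norm[OF that, of "(f ^^ n) v"] nrm[of n] by linarith
      then have "\<bar>((f ^^ n) v) \<bullet> b\<bar> * (\<bar>t\<bar> ^ n / fact n) \<le> K ^ n * norm v * (\<bar>t\<bar> ^ n / fact n)"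
        by (intro mult_right_mono) auto
      then show ?thesis
        by (simp add: c_def abs_mult power_abs power_mult_distrib divide_inverse mult_ac)
    qed
    then show "\<exists>N. \<forall>n\<ge>N. norm (c b n * t ^ n) \<le> norm v * (inverse (fact n) * (K * \<bar>t\<bar>) ^ n)"
      by blast
    show "summable (\<lambda>n. norm v * (inverse (fact n) * (K * \<bar>t\<bar>) ^ n))"
      by (intro summable_mult summable_exp)
  qed
  \<comment> \<open>Differentiation shifts the index and contributes a factor n + 1, which cancels
    against the factorial and leaves one extra application of \<open>f\<close>.\<close>
  have dc: "diffs (c b) n = (f ((f ^^ n) v) \<bullet> b) / fact n" for b n
    by (simp add: diffs_def c_def field_simps del: of_nat_Suc)
  have ds: "(s b has_real_derivative (f (u t) \<bullet> b)) (at t)" if b: "b \<in> Basis" for b t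
  proof -
    have "(s b has_real_derivative (\<Sum>n. diffs (c b) n * t ^ n)) (at t)"
      unfolding s_def[abs_def] by (intro termdiffs_strong_converges_everywhere summ b)
    also have "(\<lambda>n. diffs (c b) n * t ^ n) = (\<lambda>n. \<Sum>b'\<in>Basis. c b' n * t ^ n * (f b' \<bullet> b))"
    proof
      fix n
      have "f ((f ^^ n) v) = f (\<Sum>b'\<in>Basis. (((f ^^ n) v) \<bullet> b') *\<^sub>R b')"
        by (simp add: euclidean_representation)
      also have "\<dots> = (\<Sum>b'\<in>Basis. (((f ^^ n) v) \<bullet> b') *\<^sub>R f b')"
        by (simp add: linear_sum[OF lin] linear_cmul[OF lin])
      finally have "diffs (c b) n * t ^ n = ((\<Sum>b'\<in>Basis. (((f ^^ n) v) \<bullet> b') *\<^sub>R f b') \<bullet> b) / fact n * t ^ n"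
        by (simp only: dc)
      also have "\<dots> = (\<Sum>b'\<in>Basis. c b' n * t ^ n * (f b' \<bullet> b))"
        unfolding c_def inner_sum_left sum_divide_distrib sum_distrib_right
        by (intro sum.cong) auto
      finally show "diffs (c b) n * t ^ n = (\<Sum>b'\<in>Basis. c b' n * t ^ n * (f b' \<bullet> b))" .
    qed
    also have "(\<Sum>n. \<Sum>b'\<in>Basis. c b' n * t ^ n * (f b' \<bullet> b)) = (\<Sum>b'\<in>Basis. s b' t * (f b' \<bullet> b))"
      by (subst suminf_sum) (auto simp: s_def suminf_mult2 summ intro!: summable_mult2)
    also have "\<dots> = f (u t) \<bullet> b"
      by (simp add: u_def linear_sum[OF lin] linear_cmul[OF lin] inner_sum_left)
    finally show ?thesis .
  qed
  have "(u has_vector_derivative (\<Sum>b\<in>Basis. (f (u t) \<bullet> b) *\<^sub>R b)) (at t)" for t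
    unfolding u_def[abs_def]
    by (rule has_vector_derivative_sum, rule has_vector_derivative_scaleR[THEN has_vector_derivative_eq_rhs])
       (use ds in \<open>auto simp: u_def intro: derivative_eq_intros\<close>)
  moreover have "u 0 = v"
    unfolding u_def s_def powser_zero by (simp add: c_def euclidean_representation)
  ultimately show ?thesis by (auto simp: euclidean_representation)
qed

text \<open>The function exp(-2Ct) |z(t)|^2 is non-negative, non-increasing and starts at 0. The
  derivative is required only in the interior, so break points may sit at the ends of the
  interval.\<close>

lemma gronwall_zero:
  fixes z :: "real \<Rightarrow> 'b::real_inner"
  assumes "a \<le> b" and cont: "continuous_on {a..b} z" and "z a = 0"
    and der: "\<And>t. a < t \<Longrightarrow> t < b \<Longrightarrow> \<exists>z'. (z has_vector_derivative z') (at t) \<and> norm z' \<le> C * norm (z t)"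
  shows "z b = 0"
proof -
  define \<phi> where "\<phi> t = exp (- 2 * C * t) * (z t \<bullet> z t)" for t
  have "\<phi> a \<ge> \<phi> b"
  proof (rule DERIV_nonpos_imp_decreasing_open[OF \<open>a \<le> b\<close>])
    fix t assume "a < t" "t < b"
    then obtain z' where z': "(z has_vector_derivative z') (at t)" "norm z' \<le> C * norm (z t)"
      using der by blast
    have "(\<phi> has_real_derivative (exp (- 2 * C * t) * (2 * (z t \<bullet> z') - 2 * C * (z t \<bullet> z t)))) (at t)"
      unfolding \<phi>_def[abs_def] has_field_derivative_def
      by (rule has_derivative_eq_rhs, (rule derivative_intros z'(1)[unfolded has_vector_derivative_def])+)
        (auto simp: fun_eq_iff algebra_simps inner_commute)
    moreover have "z t \<bullet> z' \<le> C * (z t \<bullet> z t)"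
    proof -
      have "z t \<bullet> z' \<le> norm (z t) * norm z'" by (rule norm_cauchy_schwarz)
      also have "\<dots> \<le> norm (z t) * (C * norm (z t))" by (intro mult_left_mono z') auto
      finally show ?thesis by (simp add: power2_norm_eq_inner[symmetric] power2_eq_square mult_ac)
    qed
    then have "exp (- 2 * C * t) * (2 * (z t \<bullet> z') - 2 * C * (z t \<bullet> z t)) \<le> 0"
      by (intro mult_nonneg_nonpos) auto
    ultimately show "\<exists>y. (\<phi> has_real_derivative y) (at t) \<and> y \<le> 0" by blast
  qed (auto simp: \<phi>_def intro!: continuous_intros cont)
  then have "exp (- 2 * C * b) * (z b \<bullet> z b) \<le> 0" using \<open>z a = 0\<close> by (simp add: \<phi>_def)
  then have "z b \<bullet> z b \<le> 0" by (simp add: mult_le_0_iff)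
  then show ?thesis by (metis inner_eq_zero_iff inner_ge_zero antisym)
qed

lemma linear_flow_unique:
  fixes z :: "real \<Rightarrow> 'b::euclidean_space"
  assumes lin: "linear f" and "z 0 = 0"
    and der: "\<And>t. (z has_vector_derivative f (z t)) (at t)"
  shows "z t = 0"
proof -
  obtain K where K: "\<And>x. norm (f x) \<le> K * norm x"
    using linear_bounded_pos[OF lin] by (auto simp: mult.commute)
  have cont: "continuous_on A z" for A
    by (meson der has_vector_derivative_continuous continuous_at_imp_continuous_on)
  show ?thesis
  proof (cases "t \<ge> 0")
    case True
    then show ?thesis
      by (rule gronwall_zero[where C = K]) (use assms cont der K in auto)
  next
    case False
    \<comment> \<open>Negative times are reduced to positive ones by time reversal, which replaces
      \<open>f\<close> by its negative and keeps the norm bound.\<close>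
    have "((\<lambda>s. z (- s)) has_vector_derivative - f (z (- s))) (at s)" for s
    proof -
      have "(uminus has_vector_derivative - 1) (at s)"
        using has_vector_derivative_minus[OF has_vector_derivative_id, of "at s"] by simp
      from vector_diff_chain_at[OF this der[of "- s"]] show ?thesis by (simp add: o_def)
    qed
    note der' = this
    have "(\<lambda>s. z (- s)) (- t) = 0"
    proof (rule gronwall_zero[where a = 0 and C = K and b = "- t" and z = "\<lambda>s. z (- s)"])
      show "continuous_on {0..- t} (\<lambda>s. z (- s))"
        by (rule continuous_on_compose2[OF cont[of UNIV]]) (auto intro!: continuous_intros)
      show "\<exists>z'. ((\<lambda>s. z (- s)) has_vector_derivative z') (at s) \<and> norm z' \<le> K * norm (z (- s))" for s
        using der'[of s] K[of "z (- s)"] by (intro exI[of _ "- f (z (- s))"]) simp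
    qed (use False assms in auto)
    then show ?thesis by simp
  qed
qed

section \<open>The matrix exponential\<close>

text \<open>The matrix exponential of tX, introduced as a solution of u' = Xu with u(0) = 1. All its
  properties are then consequences of uniqueness for this equation, and no series manipulation is
  needed.\<close>

definition expm :: "real \<Rightarrow> 'a::{euclidean_space,real_algebra_1}^'n^'n \<Rightarrow> 'a^'n^'n" where
  "expm t X = (SOME u. u 0 = mat 1 \<and> (\<forall>t. (u has_vector_derivative X ** u t) (at t))) t"

lemma linear_matrix_mult_left: "linear (\<lambda>Y. X ** Y)"
  for X :: "'a::{euclidean_space,real_algebra_1}^'n^'m"
  by (rule bounded_linear.linear[OF mmult.bounded_linear_right])

lemma expm_0 [simp]: "expm 0 X = mat 1"
  and expm_deriv: "((\<lambda>t. expm t X) has_vector_derivative X ** expm t X) (at t)"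
proof -
  have "\<exists>u. u 0 = mat 1 \<and> (\<forall>t. (u has_vector_derivative X ** u t) (at t))"
    by (rule linear_flow_exists[OF linear_matrix_mult_left])
  from someI_ex[OF this]
  show "expm 0 X = mat 1" "((\<lambda>t. expm t X) has_vector_derivative X ** expm t X) (at t)"
    unfolding expm_def[abs_def] by blast+
qed

lemma matrix_mult_derivs:
  fixes A :: "real \<Rightarrow> 'a::{euclidean_space,real_algebra_1}^'n^'m"
  assumes "(A has_vector_derivative A') F"
  shows "((\<lambda>t. A t ** B) has_vector_derivative A' ** B) F"
    and "((\<lambda>t. C ** A t) has_vector_derivative C ** A') F"
  using bounded_linear.has_vector_derivative[OF mmult.bounded_linear_left assms]
    bounded_linear.has_vector_derivative[OF mmult.bounded_linear_right assms] by blast+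

lemma expm_unique:
  assumes "\<And>t. (u has_vector_derivative X ** u t) (at t)"
  shows "u t = expm t X ** u 0"
proof -
  have "(\<lambda>t. u t - expm t X ** u 0) t = 0"
  proof (rule linear_flow_unique[OF linear_matrix_mult_left[of X], of "\<lambda>t. u t - expm t X ** u 0" t])
    show "((\<lambda>t. u t - expm t X ** u 0) has_vector_derivative X ** (u t - expm t X ** u 0)) (at t)" for t
      using has_vector_derivative_diff[OF assms matrix_mult_derivs(1)[OF expm_deriv]]
      by (simp add: mmult.diff_right matrix_mul_assoc)
  qed simp
  then show ?thesis by simp
qed

lemma expm_add: "expm (s + t) X = expm s X ** expm t X"
proof -
  have "((\<lambda>s. expm (s + t) X) has_vector_derivative X ** expm (s + t) X) (at s)" for s
    using vector_diff_chain_at[of "\<lambda>s. s + t" 1 s, OF _ expm_deriv]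
      has_vector_derivative_add_const[of "\<lambda>s. s" t 1 "at s"]
    by (simp add: o_def)
  from expm_unique[of "\<lambda>s. expm (s + t) X", OF this, of s] show ?thesis by simp
qed

lemma expm_inverse: "expm (- t) X ** expm t X = mat 1" "expm t X ** expm (- t) X = mat 1"
  using expm_add[of "- t" t X] expm_add[of t "- t" X] by simp_all

lemma expm_commute: "expm t X ** X = X ** expm t X"
proof -
  have "((\<lambda>t. X ** expm t X) has_vector_derivative X ** (X ** expm t X)) (at t)" for t
    by (intro matrix_mult_derivs expm_deriv)
  from expm_unique[of "\<lambda>t. X ** expm t X", OF this, of t] show ?thesis by simp
qed

lemma expm_deriv': "((\<lambda>t. expm t X) has_vector_derivative expm t X ** X) (at t)"
  using expm_deriv by (simp add: expm_commute)

lemma expm_conj: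
  assumes "V ** U = mat 1" "U ** V = mat 1"
  shows "expm t (U ** X ** V) = U ** expm t X ** V"
proof -
  have "((\<lambda>t. U ** expm t X ** V) has_vector_derivative (U ** X ** V) ** (U ** expm t X ** V)) (at t)" for t
  proof -
    have "U ** X ** V ** (U ** expm t X ** V) = U ** X ** (V ** U) ** expm t X ** V"
      by (simp only: matrix_mul_assoc)
    also have "\<dots> = U ** (X ** expm t X) ** V"
      by (simp only: assms matrix_mul_assoc matrix_mul_rid)
    finally show ?thesis
      using matrix_mult_derivs(1)[OF matrix_mult_derivs(2)[OF expm_deriv[of X t], of U], of V] by simp
  qed
  from expm_unique[OF this, of t] show ?thesis by (simp add: assms)
qed

lemma continuous_on_expm: "continuous_on A (\<lambda>t. expm t X)"
  by (intro continuous_at_imp_continuous_on ballI has_vector_derivative_continuous[OF expm_deriv])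

lemma vector_derivative_0_imp_const:
  assumes "\<And>s. (f has_vector_derivative 0) (at s)"
  shows "f s = f (t::real)"
  by (rule has_derivative_zero_unique[of UNIV f])
    (use assms in \<open>auto simp: has_vector_derivative_def\<close>)

lemma vector_derivative_0_locally_const:
  assumes "\<forall>\<^sub>F s in at t. f s = c" "f t = c"
  shows "(f has_vector_derivative 0) (at t)"
  unfolding has_vector_derivative_def
  by (rule has_derivative_transform_eventually[where f = "\<lambda>_. c"])
    (use assms in \<open>auto elim: eventually_mono\<close>)

section \<open>The group SU(5)\<close>

lemma adj_mult: "adj (A ** B) = adj B ** adj A"
  by (simp add: adj_def matrix_matrix_mult_def vec_eq_iff mult.commute)

lemma adj_simps [simp]: "adj (adj A) = A" "adj (mat 1) = mat 1" "adj (- A) = - adj A" "adj 0 = 0"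
  "adj (A + B) = adj A + adj B" "adj (A - B) = adj A - adj B" "adj (c *\<^sub>R A) = c *\<^sub>R adj A"
  by (auto simp: adj_def vec_eq_iff mat_def)

lemma bounded_linear_adj: "bounded_linear adj"
  by (rule linear_conv_bounded_linear[THEN iffD1]) (auto intro!: linearI)

lemma det_adj: "det (adj A) = cnj (det A)"
proof -
  have "det (adj A) = det (\<chi> r s. cnj (A $ r $ s))"
    by (subst det_transpose[symmetric]) (simp add: transpose_def adj_def)
  also have "\<dots> = cnj (det A)" by (simp add: det_def)
  finally show ?thesis .
qed

lemma SU5_D:
  assumes "g \<in> SU5"
  shows "g ** adj g = mat 1" "adj g ** g = mat 1" "det g = 1"
proof -
  show "g ** adj g = mat 1" "det g = 1" using assms by (simp_all add: SU5_def)
  then show "adj g ** g = mat 1" by (simp add: matrix_left_right_inverse)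
qed

lemma SU5_simps:
  assumes "g \<in> SU5"
  shows "adj g ** (g ** X) = X" "g ** (adj g ** X) = X"
  using SU5_D[OF assms] by (simp_all add: matrix_mul_assoc)

lemma SU5_mat1 [simp]: "mat 1 \<in> SU5"
  by (simp add: SU5_def)

lemma SU5_mult: "g \<in> SU5 \<Longrightarrow> h \<in> SU5 \<Longrightarrow> g ** h \<in> SU5"
proof -
  assume gh: "g \<in> SU5" "h \<in> SU5"
  have "(g ** h) ** adj (g ** h) = g ** (h ** adj h) ** adj g"
    by (simp add: adj_mult matrix_mul_assoc)
  also have "\<dots> = mat 1" by (simp add: gh SU5_D)
  finally show ?thesis using gh by (simp add: SU5_def det_mul)
qed

lemma SU5_adj: "g \<in> SU5 \<Longrightarrow> adj g \<in> SU5"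
  using SU5_D(2,3)[of g] by (simp add: SU5_def det_adj)

lemma su5_conj: "g \<in> SU5 \<Longrightarrow> x \<in> su5 \<Longrightarrow> g ** x ** adj g \<in> su5"
proof -
  assume g: "g \<in> SU5" and x: "x \<in> su5"
  have "trace (g ** x ** adj g) = trace (adj g ** (g ** x))" by (rule trace_mul_sym)
  moreover have "adj (g ** x ** adj g) = - (g ** x ** adj g)"
    using x by (simp add: adj_mult su5_def matrix_mul_assoc mmult.minus_left mmult.minus_right)
  ultimately show ?thesis using x by (simp add: su5_def SU5_simps[OF g])
qed

text \<open>Jacobi's formula at the identity. In the Leibniz expansion a permutation other than the
  identity moves at least two indices, so after differentiating one factor an off-diagonal entry of
  the identity matrix is still present.\<close>

lemma det_deriv_at_mat1:
  fixes F :: "real \<Rightarrow> complex^'n^'n"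
  assumes F: "(F has_vector_derivative X) (at t)" and "F t = mat 1"
  shows "((\<lambda>s. det (F s)) has_vector_derivative trace X) (at t)"
proof -
  have ent: "((\<lambda>s. F s $ i $ j) has_derivative (\<lambda>h. h *\<^sub>R (X $ i $ j))) (at t)" for i j
    using bounded_linear.has_vector_derivative[OF bounded_linear_compose[OF
        bounded_linear_vec_nth[of j] bounded_linear_vec_nth[of i]] F]
    by (simp add: has_vector_derivative_def)
  have pr: "(\<Sum>i\<in>UNIV. X $ i $ p i * (\<Prod>j\<in>UNIV - {i}. F t $ j $ p j)) = (if p = id then trace X else 0)"
    if p: "p permutes (UNIV::'n set)" for p
  proof (cases "p = id")
    case True
    then show ?thesis by (simp add: \<open>F t = mat 1\<close> mat_def trace_def)
  next
    case False
    then obtain a where a: "p a \<noteq> a" by (auto simp: fun_eq_iff)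
    have "(\<Prod>j\<in>UNIV - {i}. F t $ j $ p j) = 0" for i
    proof -
      \<comment> \<open>If the removed index is itself the moved point \<open>a\<close>, its image
        \<open>p a\<close> is a second one, by injectivity of \<open>p\<close>.\<close>
      obtain b where "b \<noteq> i" "p b \<noteq> b"
      proof (cases "a = i")
        case True
        have "p (p a) \<noteq> p a" using a permutes_inj[OF p] by (metis injD)
        then show ?thesis using that[of "p a"] a True by auto
      qed (use a that in auto)
      then show ?thesis
        by (intro prod_zero) (auto simp: \<open>F t = mat 1\<close> mat_def intro!: bexI[of _ b])
    qed
    then show ?thesis using False by (simp del: prod_zero_iff)
  qed
  have 1: "((\<lambda>s. det (F s)) has_derivative
     (\<lambda>h. \<Sum>p\<in>{p. p permutes UNIV}. of_int (sign p) *
        (\<Sum>i\<in>UNIV. h *\<^sub>R (X $ i $ p i) * (\<Prod>j\<in>UNIV - {i}. F t $ j $ p j)))) (at t)"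
    unfolding det_def
    by (intro has_derivative_sum has_derivative_mult_right has_derivative_prod ent)
  have 2: "(\<lambda>h. \<Sum>p\<in>{p. p permutes UNIV}. of_int (sign p) *
        (\<Sum>i\<in>UNIV. h *\<^sub>R (X $ i $ p i) * (\<Prod>j\<in>UNIV - {i}. F t $ j $ p j))) = (\<lambda>h. h *\<^sub>R trace X)"
  proof
    fix h
    have "(\<Sum>p\<in>{p. p permutes UNIV}. of_int (sign p) *
        (\<Sum>i\<in>UNIV. h *\<^sub>R (X $ i $ p i) * (\<Prod>j\<in>UNIV - {i}. F t $ j $ p j)))
      = (\<Sum>p\<in>{p. p permutes (UNIV::'n set)}. if p = id then h *\<^sub>R trace X else 0)"
    proof (rule sum.cong[OF refl])
      fix p :: "'n \<Rightarrow> 'n" assume "p \<in> {p. p permutes UNIV}"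
      then have p: "p permutes UNIV" by simp
      have "(\<Sum>i\<in>UNIV. h *\<^sub>R (X $ i $ p i) * (\<Prod>j\<in>UNIV - {i}. F t $ j $ p j))
        = h *\<^sub>R (if p = id then trace X else 0)"
        unfolding pr[OF p, symmetric] scaleR_sum_right by (simp only: scaleR_scaleR mult_scaleR_left)
      then show "of_int (sign p) * (\<Sum>i\<in>UNIV. h *\<^sub>R (X $ i $ p i) * (\<Prod>j\<in>UNIV - {i}. F t $ j $ p j))
        = (if p = id then h *\<^sub>R trace X else 0)"
        by simp
    qed
    also have "\<dots> = h *\<^sub>R trace X"
      by (subst sum.delta) (auto simp: finite_permutations permutes_id)
    finally show "(\<Sum>p\<in>{p. p permutes UNIV}. of_int (sign p) *
        (\<Sum>i\<in>UNIV. h *\<^sub>R (X $ i $ p i) * (\<Prod>j\<in>UNIV - {i}. F t $ j $ p j))) = h *\<^sub>R trace X" .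
  qed
  show ?thesis unfolding has_vector_derivative_def by (rule has_derivative_eq_rhs[OF 1 2])
qed

text \<open>Both defining equations hold at time 0, and their left-hand sides have derivative 0. For
  the determinant, the addition law and multiplicativity move the derivative at time s to time 0,
  where Jacobi's formula gives the trace.\<close>

lemma expm_SU5:
  assumes x: "x \<in> su5"
  shows "expm t x \<in> SU5"
proof -
  have ax: "adj x = - x" and tr: "trace x = 0" using x by (auto simp: su5_def)
  have "((\<lambda>s. adj (expm s x) ** expm s x) has_vector_derivative 0) (at s)" for s
  proof -
    have "((\<lambda>s. adj (expm s x) ** expm s x) has_vector_derivative
       adj (expm s x) ** (x ** expm s x) + adj (x ** expm s x) ** expm s x) (at s)"
      by (intro mmult.has_vector_derivative expm_deriv
          bounded_linear.has_vector_derivative[OF bounded_linear_adj])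
    then show ?thesis by (simp add: adj_mult ax mmult.minus_left mmult.minus_right matrix_mul_assoc)
  qed
  then have "adj (expm t x) ** expm t x = adj (expm 0 x) ** expm 0 x"
    by (rule vector_derivative_0_imp_const)
  then have un: "expm t x ** adj (expm t x) = mat 1"
    by (simp add: matrix_left_right_inverse)
  have "((\<lambda>s. det (expm s x)) has_vector_derivative 0) (at s)" for s
  proof -
    have "((\<lambda>h. det (expm h x)) has_vector_derivative 0) (at (0::real))"
      using det_deriv_at_mat1[OF expm_deriv, of 0 x] tr by simp
    then have "((\<lambda>h. det (expm h x)) has_vector_derivative 0) (at (s - s))" by simp
    from vector_diff_chain_at[of "\<lambda>u. u - s" 1 s, OF _ this]
    have "((\<lambda>u. det (expm (u - s) x)) has_vector_derivative 0) (at s)"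
      using has_vector_derivative_diff_const[of "\<lambda>s. s" s 1 "at s"] by (simp add: o_def)
    from has_vector_derivative_mult_left[OF this, of "det (expm s x)"]
    have "((\<lambda>u. det (expm (u - s) x) * det (expm s x)) has_vector_derivative 0) (at s)" by simp
    then show ?thesis by (simp add: det_mul[symmetric] expm_add[symmetric])
  qed
  then have "det (expm t x) = det (expm 0 x)"
    by (rule vector_derivative_0_imp_const)
  then show ?thesis using un by (simp add: SU5_def)
qed

text \<open>Translating by the inverse of the value at t makes the curve pass through the identity;
  differentiating the two equations of the group there yields trace 0 and skewness. It is needed
  because coordinates are meaningful only on \<open>su5\<close>.\<close>

lemma SU5_curve_deriv:
  assumes der: "(\<gamma> has_vector_derivative \<gamma>') (at t)"
    and ev: "\<forall>\<^sub>F s in at t. \<gamma> s \<in> SU5" and t: "\<gamma> t \<in> SU5"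
  shows "adj (\<gamma> t) ** \<gamma>' \<in> su5"
proof -
  define X where "X = adj (\<gamma> t) ** \<gamma>'"
  have F: "((\<lambda>s. adj (\<gamma> t) ** \<gamma> s) has_vector_derivative X) (at t)"
    unfolding X_def by (intro matrix_mult_derivs der)
  have Ft: "adj (\<gamma> t) ** \<gamma> t = mat 1" using SU5_D[OF t] by simp
  have ev': "\<forall>\<^sub>F s in at t. adj (\<gamma> t) ** \<gamma> s \<in> SU5"
    using ev by eventually_elim (intro SU5_mult SU5_adj t)
  have "((\<lambda>s. det (adj (\<gamma> t) ** \<gamma> s)) has_vector_derivative trace X) (at t)"
    by (rule det_deriv_at_mat1[OF F Ft])
  moreover have "((\<lambda>s. det (adj (\<gamma> t) ** \<gamma> s)) has_vector_derivative 0) (at t)"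
  proof (rule vector_derivative_0_locally_const)
    show "\<forall>\<^sub>F s in at t. det (adj (\<gamma> t) ** \<gamma> s) = 1"
      using ev' by eventually_elim (simp add: SU5_D)
  qed (simp add: Ft)
  ultimately have tr: "trace X = 0" by (rule vector_derivative_unique_at)
  have "((\<lambda>s. adj (adj (\<gamma> t) ** \<gamma> s) ** (adj (\<gamma> t) ** \<gamma> s)) has_vector_derivative
      adj (adj (\<gamma> t) ** \<gamma> t) ** X + adj X ** (adj (\<gamma> t) ** \<gamma> t)) (at t)"
    by (intro mmult.has_vector_derivative F bounded_linear.has_vector_derivative[OF bounded_linear_adj])
  moreover have "((\<lambda>s. adj (adj (\<gamma> t) ** \<gamma> s) ** (adj (\<gamma> t) ** \<gamma> s)) has_vector_derivative 0) (at t)"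
  proof (rule vector_derivative_0_locally_const)
    show "\<forall>\<^sub>F s in at t. adj (adj (\<gamma> t) ** \<gamma> s) ** (adj (\<gamma> t) ** \<gamma> s) = mat 1"
      using ev' by eventually_elim (simp add: SU5_D)
  qed (simp add: Ft)
  ultimately have "adj (adj (\<gamma> t) ** \<gamma> t) ** X + adj X ** (adj (\<gamma> t) ** \<gamma> t) = 0"
    by (rule vector_derivative_unique_at)
  then have "X + adj X = 0" by (simp add: Ft)
  then show ?thesis using tr unfolding X_def[symmetric] su5_def by (simp add: eq_neg_iff_add_eq_0 add.commute)
qed

section \<open>Quaternionic coordinates on su(5)\<close>

text \<open>The type consists of the residues modulo 5, so the residue 0 is the index written 5;
  likewise for 6 below.\<close>

lemma exhaust_5: "x = 1 \<or> x = 2 \<or> x = 3 \<or> x = 4 \<or> x = 5" for x :: 5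
proof (induct x)
  case (of_int z)
  then have "z = 0 \<or> z = 1 \<or> z = 2 \<or> z = 3 \<or> z = 4" by fastforce
  then show ?case by auto
qed

lemma exhaust_6: "x = 1 \<or> x = 2 \<or> x = 3 \<or> x = 4 \<or> x = 5 \<or> x = 6" for x :: 6
proof (induct x)
  case (of_int z)
  then have "z = 0 \<or> z = 1 \<or> z = 2 \<or> z = 3 \<or> z = 4 \<or> z = 5" by fastforce
  then show ?case by auto
qed

lemma forall_5: "(\<forall>x::5. P x) \<longleftrightarrow> P 1 \<and> P 2 \<and> P 3 \<and> P 4 \<and> P 5"
  using exhaust_5 by metis

lemma forall_6: "(\<forall>x::6. P x) \<longleftrightarrow> P 1 \<and> P 2 \<and> P 3 \<and> P 4 \<and> P 5 \<and> P 6"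
  using exhaust_6 by metis

lemma UNIV_5: "(UNIV :: 5 set) = {1, 2, 3, 4, 5}"
  using exhaust_5 by auto

lemma UNIV_6: "(UNIV :: 6 set) = {1, 2, 3, 4, 5, 6}"
  using exhaust_6 by auto

lemma sum_5: "sum f (UNIV :: 5 set) = f 1 + f 2 + f 3 + f 4 + f 5"
  unfolding UNIV_5 by (simp add: ac_simps)

lemma sum_6: "sum f (UNIV :: 6 set) = f 1 + f 2 + f 3 + f 4 + f 5 + f 6"
  unfolding UNIV_6 by (simp add: ac_simps)

text \<open>Coordinates with respect to the quaternionic basis \<open>E2\<close>, \<open>E1\<close>, three elements of
  $\mathfrak{f}_1$ and one of $\mathfrak{f}_2$; each of the last four has $F_i$ with a single non-zero
  column $(1,0)^t$. As \<open>I, J, K\<close> correspond to right multiplication by \<open>- i, - j, - k\<close>, the coordinate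
  of $b + Ib + Jb + Kb$ is $1 - i - j - k$.\<close>

definition psi :: "quat^6 \<Rightarrow> cmat5" where
  "psi q = (\<chi> r s.
     if r = 1 then
       (if s = 1 then Complex 0 (3 * qre (q $ 2) - qi (q $ 1))
        else if s = 2 then Complex (- qj (q $ 1)) (- qk (q $ 1))
        else if s = 3 then Complex (qre (q $ 3)) (- qi (q $ 3))
        else if s = 4 then Complex (qre (q $ 4)) (- qi (q $ 4))
        else Complex (qre (q $ 5)) (- qi (q $ 5)))
     else if r = 2 then
       (if s = 1 then Complex (qj (q $ 1)) (- qk (q $ 1))
        else if s = 2 then Complex 0 (3 * qre (q $ 2) + qi (q $ 1))
        else if s = 3 then Complex (qj (q $ 3)) (- qk (q $ 3))
        else if s = 4 then Complex (qj (q $ 4)) (- qk (q $ 4))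
        else Complex (qj (q $ 5)) (- qk (q $ 5)))
     else if r = 3 then
       (if s = 1 then Complex (- qre (q $ 3)) (- qi (q $ 3))
        else if s = 2 then Complex (- qj (q $ 3)) (- qk (q $ 3))
        else if s = 3 then Complex 0 (qre (q $ 1) - 2 * qre (q $ 2) - qi (q $ 2))
        else if s = 4 then Complex (- qj (q $ 2)) (- qk (q $ 2))
        else Complex (qre (q $ 6)) (- qi (q $ 6)))
     else if r = 4 then
       (if s = 1 then Complex (- qre (q $ 4)) (- qi (q $ 4))
        else if s = 2 then Complex (- qj (q $ 4)) (- qk (q $ 4))
        else if s = 3 then Complex (qj (q $ 2)) (- qk (q $ 2))
        else if s = 4 then Complex 0 (qre (q $ 1) - 2 * qre (q $ 2) + qi (q $ 2))
        else Complex (qj (q $ 6)) (- qk (q $ 6)))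
     else
       (if s = 1 then Complex (- qre (q $ 5)) (- qi (q $ 5))
        else if s = 2 then Complex (- qj (q $ 5)) (- qk (q $ 5))
        else if s = 3 then Complex (- qre (q $ 6)) (- qi (q $ 6))
        else if s = 4 then Complex (- qj (q $ 6)) (- qk (q $ 6))
        else Complex 0 (- 2 * qre (q $ 1) - 2 * qre (q $ 2))))"

text \<open>Reads \<open>psi\<close> backwards. \<open>E2\<close> vanishes on the first diagonal
  block while \<open>E1\<close> has trace 6i there, whence the sixth. The trace of the second block
  is 2i times the \<open>E2\<close> coordinate minus 4i times the \<open>E1\<close> coordinate,
  whence the half and the third.\<close>

definition phi :: "cmat5 \<Rightarrow> quat^6" where
  "phi X = (\<chi> n.
     if n = 1 then Quat (Im (X $ 3 $ 3 + X $ 4 $ 4) / 2 + Im (X $ 1 $ 1 + X $ 2 $ 2) / 3)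
       (Im (X $ 2 $ 2 - X $ 1 $ 1) / 2) (- Re (X $ 1 $ 2)) (- Im (X $ 1 $ 2))
     else if n = 2 then Quat (Im (X $ 1 $ 1 + X $ 2 $ 2) / 6)
       (Im (X $ 4 $ 4 - X $ 3 $ 3) / 2) (- Re (X $ 3 $ 4)) (- Im (X $ 3 $ 4))
     else if n = 3 then Quat (Re (X $ 1 $ 3)) (- Im (X $ 1 $ 3)) (Re (X $ 2 $ 3)) (- Im (X $ 2 $ 3))
     else if n = 4 then Quat (Re (X $ 1 $ 4)) (- Im (X $ 1 $ 4)) (Re (X $ 2 $ 4)) (- Im (X $ 2 $ 4))
     else if n = 5 then Quat (Re (X $ 1 $ 5)) (- Im (X $ 1 $ 5)) (Re (X $ 2 $ 5)) (- Im (X $ 2 $ 5))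
     else Quat (Re (X $ 3 $ 5)) (- Im (X $ 3 $ 5)) (Re (X $ 4 $ 5)) (- Im (X $ 4 $ 5)))"

text \<open>The matrix of $y \mapsto \nabla_x y$, computed from
  $2\nabla_x y = [x,y] + I[Ix,y] - J[x,Jy] + K[Ix,Jy]$.\<close>

definition obata_matrix :: "quat^6 \<Rightarrow> quat^6^6" where
  "obata_matrix x = (\<chi> r c.
     if r = 1 then (if c = 1 then - x $ 1 else
       if c = 3 then Quat (qre (x $ 3) / 2 - qi (x $ 3) / 6) (- qre (x $ 3) / 6 - qi (x $ 3) / 2)
        (- qj (x $ 3) / 2 + qk (x $ 3) / 6) (- qj (x $ 3) / 6 - qk (x $ 3) / 2) else
       if c = 4 then Quat (qre (x $ 4) / 2 - qi (x $ 4) / 6) (- qre (x $ 4) / 6 - qi (x $ 4) / 2)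
        (- qj (x $ 4) / 2 + qk (x $ 4) / 6) (- qj (x $ 4) / 6 - qk (x $ 4) / 2) else
       if c = 5 then Quat (qre (x $ 5) / 2 + qi (x $ 5) / 3) (qre (x $ 5) / 3 - qi (x $ 5) / 2)
        (- qj (x $ 5) / 2 - qk (x $ 5) / 3) (qj (x $ 5) / 3 - qk (x $ 5) / 2) else
       if c = 6 then Quat (qi (x $ 6) / 2) (qre (x $ 6) / 2)
        (- qk (x $ 6) / 2) (qj (x $ 6) / 2) else
       0)
     else if r = 2 then (if c = 2 then - x $ 2 else
       if c = 3 then Quat (- qre (x $ 3) / 2 + qi (x $ 3) / 6 - qj (x $ 4)) (qre (x $ 3) / 6 + qi (x $ 3) / 2 + qk (x $ 4))
        (- qj (x $ 3) / 2 - qk (x $ 3) / 6) (qj (x $ 3) / 6 - qk (x $ 3) / 2) else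
       if c = 4 then Quat (qre (x $ 4) / 2 + qi (x $ 4) / 6) (qre (x $ 4) / 6 - qi (x $ 4) / 2)
        (qre (x $ 3) + qj (x $ 4) / 2 - qk (x $ 4) / 6) (qi (x $ 3) + qj (x $ 4) / 6 + qk (x $ 4) / 2) else
       if c = 5 then Quat (qi (x $ 5) / 6) (qre (x $ 5) / 6)
        (- qk (x $ 5) / 6) (qj (x $ 5) / 6) else
       if c = 6 then Quat (qre (x $ 6) / 2) (- qi (x $ 6) / 2)
        (- qj (x $ 6) / 2) (- qk (x $ 6) / 2) else
       0)
     else if r = 3 then (if c = 1 then - x $ 3 else
       if c = 3 then Quat (- qre (x $ 1)) (qre (x $ 1) - 5 * qre (x $ 2) - qi (x $ 2))
        0 0 else
       if c = 4 then Quat (- qj (x $ 2)) (- qk (x $ 2))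
        0 0 else
       if c = 5 then Quat (qre (x $ 6)) (- qi (x $ 6))
        0 0 else
       0)
     else if r = 4 then (if c = 1 then - x $ 4 else
       if c = 3 then Quat (qj (x $ 2)) (- qk (x $ 2))
        0 0 else
       if c = 4 then Quat (- qre (x $ 1)) (qre (x $ 1) - 5 * qre (x $ 2) + qi (x $ 2))
        0 0 else
       if c = 5 then Quat (qj (x $ 6)) (- qk (x $ 6))
        0 0 else
       0)
     else if r = 5 then (if c = 1 then - x $ 5 else
       if c = 3 then Quat (- qre (x $ 6)) (- qi (x $ 6))
        0 0 else
       if c = 4 then Quat (- qj (x $ 6)) (- qk (x $ 6))
        0 0 else
       if c = 5 then Quat (- qre (x $ 1)) (- 2 * qre (x $ 1) - 5 * qre (x $ 2))
        0 0 else
       0)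
     else (if c = 2 then - x $ 6 else
       if c = 3 then Quat 0 0
        (- qj (x $ 5)) (- qk (x $ 5)) else
       if c = 4 then Quat 0 0
        (qre (x $ 5)) (qi (x $ 5)) else
       if c = 5 then Quat (- qre (x $ 3) - qj (x $ 4)) (qi (x $ 3) + qk (x $ 4))
        0 0 else
       if c = 6 then Quat (- qre (x $ 2)) (- 3 * qre (x $ 1))
        0 0 else
       0))"

lemma psi_nth:
  "psi q $ 1 $ 1 = Complex 0 (3 * qre (q $ 2) - qi (q $ 1))"
  "psi q $ 1 $ 2 = Complex (- qj (q $ 1)) (- qk (q $ 1))"
  "psi q $ 1 $ 3 = Complex (qre (q $ 3)) (- qi (q $ 3))"
  "psi q $ 1 $ 4 = Complex (qre (q $ 4)) (- qi (q $ 4))"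
  "psi q $ 1 $ 5 = Complex (qre (q $ 5)) (- qi (q $ 5))"
  "psi q $ 2 $ 1 = Complex (qj (q $ 1)) (- qk (q $ 1))"
  "psi q $ 2 $ 2 = Complex 0 (3 * qre (q $ 2) + qi (q $ 1))"
  "psi q $ 2 $ 3 = Complex (qj (q $ 3)) (- qk (q $ 3))"
  "psi q $ 2 $ 4 = Complex (qj (q $ 4)) (- qk (q $ 4))"
  "psi q $ 2 $ 5 = Complex (qj (q $ 5)) (- qk (q $ 5))"
  "psi q $ 3 $ 1 = Complex (- qre (q $ 3)) (- qi (q $ 3))"
  "psi q $ 3 $ 2 = Complex (- qj (q $ 3)) (- qk (q $ 3))"
  "psi q $ 3 $ 3 = Complex 0 (qre (q $ 1) - 2 * qre (q $ 2) - qi (q $ 2))"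
  "psi q $ 3 $ 4 = Complex (- qj (q $ 2)) (- qk (q $ 2))"
  "psi q $ 3 $ 5 = Complex (qre (q $ 6)) (- qi (q $ 6))"
  "psi q $ 4 $ 1 = Complex (- qre (q $ 4)) (- qi (q $ 4))"
  "psi q $ 4 $ 2 = Complex (- qj (q $ 4)) (- qk (q $ 4))"
  "psi q $ 4 $ 3 = Complex (qj (q $ 2)) (- qk (q $ 2))"
  "psi q $ 4 $ 4 = Complex 0 (qre (q $ 1) - 2 * qre (q $ 2) + qi (q $ 2))"
  "psi q $ 4 $ 5 = Complex (qj (q $ 6)) (- qk (q $ 6))"
  "psi q $ 5 $ 1 = Complex (- qre (q $ 5)) (- qi (q $ 5))"
  "psi q $ 5 $ 2 = Complex (- qj (q $ 5)) (- qk (q $ 5))"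
  "psi q $ 5 $ 3 = Complex (- qre (q $ 6)) (- qi (q $ 6))"
  "psi q $ 5 $ 4 = Complex (- qj (q $ 6)) (- qk (q $ 6))"
  "psi q $ 5 $ 5 = Complex 0 (- 2 * qre (q $ 1) - 2 * qre (q $ 2))"
  by (simp_all add: psi_def)

lemma phi_nth:
  "qre (phi X $ 1) = Im (X $ 3 $ 3 + X $ 4 $ 4) / 2 + Im (X $ 1 $ 1 + X $ 2 $ 2) / 3"
  "qi (phi X $ 1) = Im (X $ 2 $ 2 - X $ 1 $ 1) / 2"
  "qj (phi X $ 1) = - Re (X $ 1 $ 2)"
  "qk (phi X $ 1) = - Im (X $ 1 $ 2)"
  "qre (phi X $ 2) = Im (X $ 1 $ 1 + X $ 2 $ 2) / 6"
  "qi (phi X $ 2) = Im (X $ 4 $ 4 - X $ 3 $ 3) / 2"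
  "qj (phi X $ 2) = - Re (X $ 3 $ 4)"
  "qk (phi X $ 2) = - Im (X $ 3 $ 4)"
  "qre (phi X $ 3) = Re (X $ 1 $ 3)"
  "qi (phi X $ 3) = - Im (X $ 1 $ 3)"
  "qj (phi X $ 3) = Re (X $ 2 $ 3)"
  "qk (phi X $ 3) = - Im (X $ 2 $ 3)"
  "qre (phi X $ 4) = Re (X $ 1 $ 4)"
  "qi (phi X $ 4) = - Im (X $ 1 $ 4)"
  "qj (phi X $ 4) = Re (X $ 2 $ 4)"
  "qk (phi X $ 4) = - Im (X $ 2 $ 4)"
  "qre (phi X $ 5) = Re (X $ 1 $ 5)"
  "qi (phi X $ 5) = - Im (X $ 1 $ 5)"
  "qj (phi X $ 5) = Re (X $ 2 $ 5)"
  "qk (phi X $ 5) = - Im (X $ 2 $ 5)"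
  "qre (phi X $ 6) = Re (X $ 3 $ 5)"
  "qi (phi X $ 6) = - Im (X $ 3 $ 5)"
  "qj (phi X $ 6) = Re (X $ 4 $ 5)"
  "qk (phi X $ 6) = - Im (X $ 4 $ 5)"
  by (simp_all add: phi_def)

lemma obata_matrix_nth:
  "obata_matrix x $ 1 $ 1 = - x $ 1"
  "obata_matrix x $ 1 $ 2 = 0"
  "obata_matrix x $ 1 $ 3 = Quat (qre (x $ 3) / 2 - qi (x $ 3) / 6) (- qre (x $ 3) / 6 - qi (x $ 3) / 2)
     (- qj (x $ 3) / 2 + qk (x $ 3) / 6) (- qj (x $ 3) / 6 - qk (x $ 3) / 2)"
  "obata_matrix x $ 1 $ 4 = Quat (qre (x $ 4) / 2 - qi (x $ 4) / 6) (- qre (x $ 4) / 6 - qi (x $ 4) / 2)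
     (- qj (x $ 4) / 2 + qk (x $ 4) / 6) (- qj (x $ 4) / 6 - qk (x $ 4) / 2)"
  "obata_matrix x $ 1 $ 5 = Quat (qre (x $ 5) / 2 + qi (x $ 5) / 3) (qre (x $ 5) / 3 - qi (x $ 5) / 2)
     (- qj (x $ 5) / 2 - qk (x $ 5) / 3) (qj (x $ 5) / 3 - qk (x $ 5) / 2)"
  "obata_matrix x $ 1 $ 6 = Quat (qi (x $ 6) / 2) (qre (x $ 6) / 2)
     (- qk (x $ 6) / 2) (qj (x $ 6) / 2)"
  "obata_matrix x $ 2 $ 1 = 0"
  "obata_matrix x $ 2 $ 2 = - x $ 2"
  "obata_matrix x $ 2 $ 3 = Quat (- qre (x $ 3) / 2 + qi (x $ 3) / 6 - qj (x $ 4)) (qre (x $ 3) / 6 + qi (x $ 3) / 2 + qk (x $ 4))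
     (- qj (x $ 3) / 2 - qk (x $ 3) / 6) (qj (x $ 3) / 6 - qk (x $ 3) / 2)"
  "obata_matrix x $ 2 $ 4 = Quat (qre (x $ 4) / 2 + qi (x $ 4) / 6) (qre (x $ 4) / 6 - qi (x $ 4) / 2)
     (qre (x $ 3) + qj (x $ 4) / 2 - qk (x $ 4) / 6) (qi (x $ 3) + qj (x $ 4) / 6 + qk (x $ 4) / 2)"
  "obata_matrix x $ 2 $ 5 = Quat (qi (x $ 5) / 6) (qre (x $ 5) / 6)
     (- qk (x $ 5) / 6) (qj (x $ 5) / 6)"
  "obata_matrix x $ 2 $ 6 = Quat (qre (x $ 6) / 2) (- qi (x $ 6) / 2)
     (- qj (x $ 6) / 2) (- qk (x $ 6) / 2)"
  "obata_matrix x $ 3 $ 1 = - x $ 3"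
  "obata_matrix x $ 3 $ 2 = 0"
  "obata_matrix x $ 3 $ 3 = Quat (- qre (x $ 1)) (qre (x $ 1) - 5 * qre (x $ 2) - qi (x $ 2))
     0 0"
  "obata_matrix x $ 3 $ 4 = Quat (- qj (x $ 2)) (- qk (x $ 2))
     0 0"
  "obata_matrix x $ 3 $ 5 = Quat (qre (x $ 6)) (- qi (x $ 6))
     0 0"
  "obata_matrix x $ 3 $ 6 = 0"
  "obata_matrix x $ 4 $ 1 = - x $ 4"
  "obata_matrix x $ 4 $ 2 = 0"
  "obata_matrix x $ 4 $ 3 = Quat (qj (x $ 2)) (- qk (x $ 2))
     0 0"
  "obata_matrix x $ 4 $ 4 = Quat (- qre (x $ 1)) (qre (x $ 1) - 5 * qre (x $ 2) + qi (x $ 2))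
     0 0"
  "obata_matrix x $ 4 $ 5 = Quat (qj (x $ 6)) (- qk (x $ 6))
     0 0"
  "obata_matrix x $ 4 $ 6 = 0"
  "obata_matrix x $ 5 $ 1 = - x $ 5"
  "obata_matrix x $ 5 $ 2 = 0"
  "obata_matrix x $ 5 $ 3 = Quat (- qre (x $ 6)) (- qi (x $ 6))
     0 0"
  "obata_matrix x $ 5 $ 4 = Quat (- qj (x $ 6)) (- qk (x $ 6))
     0 0"
  "obata_matrix x $ 5 $ 5 = Quat (- qre (x $ 1)) (- 2 * qre (x $ 1) - 5 * qre (x $ 2))
     0 0"
  "obata_matrix x $ 5 $ 6 = 0"
  "obata_matrix x $ 6 $ 1 = 0"
  "obata_matrix x $ 6 $ 2 = - x $ 6"
  "obata_matrix x $ 6 $ 3 = Quat 0 0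
     (- qj (x $ 5)) (- qk (x $ 5))"
  "obata_matrix x $ 6 $ 4 = Quat 0 0
     (qre (x $ 5)) (qi (x $ 5))"
  "obata_matrix x $ 6 $ 5 = Quat (- qre (x $ 3) - qj (x $ 4)) (qi (x $ 3) + qk (x $ 4))
     0 0"
  "obata_matrix x $ 6 $ 6 = Quat (- qre (x $ 2)) (- 3 * qre (x $ 1))
     0 0"
  by (simp_all add: obata_matrix_def)

lemma phi_psi: "phi (psi q) = q"
  unfolding vec_eq_iff forall_6 quat_eq_iff phi_nth psi_nth by (simp add: field_simps)

lemma psi_in_su5: "psi q \<in> su5"
  by (simp add: su5_def adj_def trace_def vec_eq_iff forall_5 sum_5 psi_nth complex_eq_iff)

lemma psi_phi:
  assumes "X \<in> su5"
  shows "psi (phi X) = X"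
proof -
  have 1: "Re (X $ s $ r) = - Re (X $ r $ s)" "Im (X $ s $ r) = Im (X $ r $ s)" for r s
  proof -
    have "adj X $ s $ r = (- X) $ s $ r" using assms by (simp add: su5_def)
    then show "Re (X $ s $ r) = - Re (X $ r $ s)" "Im (X $ s $ r) = Im (X $ r $ s)"
      by (simp_all add: adj_def complex_eq_iff)
  qed
  have 2: "Re (X $ r $ r) = 0" for r using 1(1)[of r r] by simp
  have 3: "Im (X $ 5 $ 5) = - Im (X $ 1 $ 1) - Im (X $ 2 $ 2) - Im (X $ 3 $ 3) - Im (X $ 4 $ 4)"
    using assms by (simp add: su5_def trace_def sum_5 complex_eq_iff)
  show ?thesis
    unfolding vec_eq_iff forall_5 complex_eq_iff psi_nth phi_nth complex.sel
    unfolding 2 3 1[of 2 1] 1[of 3 1] 1[of 4 1] 1[of 5 1] 1[of 3 2] 1[of 4 2] 1[of 5 2]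
      1[of 4 3] 1[of 5 3] 1[of 5 4]
    by (simp add: field_simps)
qed

lemma linear_psi: "linear psi"
  by (rule linearI)
    (simp_all only: vec_eq_iff forall_5 complex_eq_iff psi_nth complex.sel vector_add_component
      vector_scaleR_component plus_complex.sel scaleR_complex.sel quat_sel,
     simp_all add: algebra_simps)

lemma linear_phi: "linear phi"
  by (rule linearI)
    (simp_all only: vec_eq_iff forall_6 quat_eq_iff phi_nth vector_add_component
      vector_scaleR_component plus_complex.sel minus_complex.sel scaleR_complex.sel quat_sel,
     simp_all add: algebra_simps add_divide_distrib diff_divide_distrib)

lemma linear_obata_matrix: "linear obata_matrix"
  by (rule linearI)
    (simp_all only: vec_eq_iff forall_6 quat_eq_iff obata_matrix_nth quat.sel vector_add_component
      vector_scaleR_component vector_uminus_component quat_sel,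
     simp_all add: algebra_simps add_divide_distrib diff_divide_distrib)

text \<open>This is the vanishing of the torsion of the connection given by
  \<open>obata_matrix\<close>. Its quaternionic linearity is built in, since a matrix acting from
  the left commutes with right scalars; so this entrywise check is all that identifies the formula
  as the Obata connection.\<close>

lemma bracket_psi: "bracket (psi p) (psi q) = psi (obata_matrix p *v q - obata_matrix q *v p)"
proof -
  have *: "(X ** Y) $ r $ s = (\<Sum>k\<in>UNIV. X $ r $ k * Y $ k $ s)"
    for X Y :: cmat5 and r s
    by (simp add: matrix_matrix_mult_def)
  have **: "(M *v v) $ r = (\<Sum>k\<in>UNIV. M $ r $ k * v $ k)" for M :: "quat^6^6" and v r
    by (simp add: matrix_vector_mult_def)
  show ?thesis
    unfolding vec_eq_iff forall_5 complex_eq_iff bracket_def * sum_5 psi_nth complex.sel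
      vector_minus_component ** sum_6 obata_matrix_nth quat_sel quat.sel plus_complex.sel minus_complex.sel
      times_complex.sel vector_uminus_component
    by (intro conjI; simp add: algebra_simps)
qed

lemma quat_inverse:
  fixes q :: quat
  assumes "q \<noteq> 0"
  obtains r where "q * r = 1" "r * q = 1"
proof -
  define n where "n = qre q * qre q + qi q * qi q + qj q * qj q + qk q * qk q"
  have "n = q \<bullet> q" by (simp add: n_def inner_quat_def)
  then have n: "n \<noteq> 0" using assms by simp
  define r where "r = Quat (qre q / n) (- qi q / n) (- qj q / n) (- qk q / n)"
  have 1: "(qre q * qre q + qi q * qi q + qj q * qj q + qk q * qk q) / n = 1"
    using n by (simp add: n_def)
  have "q * r = 1" "r * q = 1"
    using 1 by (simp_all add: r_def quat_eq_iff algebra_simps add_divide_distrib)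
  then show ?thesis using that by blast
qed

section \<open>The Lie algebra generated by the curvature\<close>

definition matunit :: "'n \<Rightarrow> 'm \<Rightarrow> 'a::zero \<Rightarrow> 'a^'m^'n" where
  "matunit n m q = (\<chi> i j. if i = n \<and> j = m then q else 0)"

lemma matunit_simps:
  fixes p q :: "'a::real_algebra_1"
  shows "matunit n m 0 = (0 :: 'a^'m^'n)"
    and "matunit n m (p + q) = matunit n m p + matunit n m q"
    and "matunit n m (p - q) = matunit n m p - matunit n m q"
    and "matunit n m (- q) = - matunit n m q"
    and "matunit n m (c *\<^sub>R q) = c *\<^sub>R matunit n m q"
  by (auto simp: matunit_def vec_eq_iff)

lemma matrix_mult_matunit:
  fixes A :: "'a::real_algebra_1^'k^'n"
  shows "A ** matunit n m q = (\<Sum>i\<in>UNIV. matunit i m (A $ i $ n * q))"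
  unfolding vec_eq_iff
proof (intro allI)
  fix i j
  show "(A ** matunit n m q) $ i $ j = (\<Sum>i\<in>UNIV. matunit i m (A $ i $ n * q)) $ i $ j"
    by (cases "j = m") (simp_all add: matrix_matrix_mult_def matunit_def if_distrib[of "\<lambda>x. _ * x"] cong: if_cong)
qed

lemma matunit_mult_matrix:
  fixes A :: "'a::real_algebra_1^'k^'m"
  shows "matunit n m q ** A = (\<Sum>j\<in>UNIV. matunit n j (q * A $ m $ j))"
  unfolding vec_eq_iff
proof (intro allI)
  fix i j
  show "(matunit n m q ** A) $ i $ j = (\<Sum>j\<in>UNIV. matunit n j (q * A $ m $ j)) $ i $ j"
    by (cases "i = n") (simp_all add: matrix_matrix_mult_def matunit_def if_distrib[of "\<lambda>x. x * _"] cong: if_cong)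
qed

lemma matunit_mult_matunit:
  fixes p q :: "'a::real_algebra_1"
  shows "matunit n m p ** matunit k l q = (if m = k then matunit n l (p * q) else (0 :: 'a^'j^'i))"
  unfolding vec_eq_iff
proof (intro allI)
  fix i j
  show "(matunit n m p ** matunit k l q) $ i $ j = (if m = k then matunit n l (p * q) else (0 :: 'a^'j^'i)) $ i $ j"
    by (cases "i = n"; cases "j = l")
      (simp_all add: matrix_matrix_mult_def matunit_def if_distrib[of "\<lambda>x. x * _"] cong: if_cong)
qed

lemma matrix_eq_sum_matunit:
  "A = (\<Sum>i\<in>UNIV. \<Sum>j\<in>UNIV. matunit i j (A $ i $ j))"
  for A :: "'a::real_algebra_1^'k^'n"
proof -
  have *: "(if i = k \<and> j = l then A $ k $ l else 0) = (if l = j then if k = i then A $ k $ l else 0 else 0)" for i j k l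
    by auto
  show ?thesis by (simp add: vec_eq_iff matunit_def * cong: if_cong)
qed

text \<open>The usual [nabla_x, nabla_y] - nabla_[x,y], with the Lie bracket expressed through the
  vanishing of the torsion so that everything stays in coordinates.\<close>

definition curvature :: "quat^6 \<Rightarrow> quat^6 \<Rightarrow> quat^6^6" where
  "curvature x y = obata_matrix x ** obata_matrix y - obata_matrix y ** obata_matrix x
     - obata_matrix (obata_matrix x *v y - obata_matrix y *v x)"

lemma axis_nth_if: "axis k x $ n = (if n = k then x else 0)"
  by (simp add: axis_def)

text \<open>Chosen for sparsity: two imaginary units at position (6,6), a seed at position (1,6),
  and a matrix of real trace 4.\<close>

lemma curvature_values:
  "curvature (axis 6 quat_j) (axis 6 1) = matunit 6 6 (- quat_j)"
  "curvature (axis 6 quat_k) (axis 6 1) = matunit 6 6 (- quat_k)"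
  "curvature (axis 6 quat_i) (axis 2 1) = matunit 1 6 ((- 1 / 2) *\<^sub>R 1)"
  "curvature (axis 6 quat_i) (axis 6 1) = matunit 1 1 1 - matunit 1 2 1 + matunit 3 3 1
     + matunit 4 4 1 + matunit 5 5 1 + matunit 6 6 (2 *\<^sub>R quat_i)"
proof -
  have *: "(X ** Y) $ r $ s = (\<Sum>k\<in>UNIV. X $ r $ k * Y $ k $ s)" "(X *v v) $ r = (\<Sum>k\<in>UNIV. X $ r $ k * v $ k)"
    for X Y :: "quat^6^6" and r s v
    by (simp_all add: matrix_matrix_mult_def matrix_vector_mult_def)
  note simps = curvature_def vec_eq_iff forall_6 vector_minus_component vector_add_component * sum_6 obata_matrix_nth
    axis_nth_if matunit_def vec_lambda_beta
  show "curvature (axis 6 quat_j) (axis 6 1) = matunit 6 6 (- quat_j)"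
    unfolding simps by (simp add: quat_eq_iff)
  show "curvature (axis 6 quat_k) (axis 6 1) = matunit 6 6 (- quat_k)"
    unfolding simps by (simp add: quat_eq_iff)
  show "curvature (axis 6 quat_i) (axis 2 1) = matunit 1 6 ((- 1 / 2) *\<^sub>R 1)"
    unfolding simps by (simp add: quat_eq_iff)
  show "curvature (axis 6 quat_i) (axis 6 1) = matunit 1 1 1 - matunit 1 2 1 + matunit 3 3 1
     + matunit 4 4 1 + matunit 5 5 1 + matunit 6 6 (2 *\<^sub>R quat_i)"
    unfolding simps by (simp add: quat_eq_iff)
qed

lemma quat_basis_expand: "q = qre q *\<^sub>R 1 + qi q *\<^sub>R quat_i + qj q *\<^sub>R quat_j + qk q *\<^sub>R quat_k"
  by (simp add: quat_eq_iff)

lemma quat_unit_mult: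
  "quat_i * quat_j = quat_k" "quat_j * quat_k = quat_i" "quat_k * quat_i = quat_j"
  "quat_j * quat_i = - quat_k" "quat_k * quat_j = - quat_i" "quat_i * quat_k = - quat_j"
  "quat_i * quat_i = - 1" "quat_j * quat_j = - 1" "quat_k * quat_k = - 1"
  by (simp_all add: quat_eq_iff)

text \<open>Here \<open>full n m\<close> says that the whole quaternionic line at position (n,m)
  lies in \<open>L\<close>. Column 6 is filled from the seed (1,6). Row 6 of the connection matrices
  spreads rows 1 and 2 over further columns, and their column 1 carries row 1 to rows 3, 4 and 5.
  Once index 2 is joined to every other index in both directions, all off-diagonal positions follow;
  brackets of opposite positions and the trace give the diagonal.\<close>

lemma curvature_generates:
  fixes L :: "(quat^6^6) set"
  assumes sub: "subspace L"
    and brk: "\<And>X Y. X \<in> L \<Longrightarrow> Y \<in> L \<Longrightarrow> X ** Y - Y ** X \<in> L"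
    and adB: "\<And>x X. X \<in> L \<Longrightarrow> obata_matrix x ** X - X ** obata_matrix x \<in> L"
    and curv: "\<And>x y. curvature x y \<in> L"
  shows "X \<in> L"
proof -
  note L0 = subspace_0[OF sub]
  have Ladd: "a + b \<in> L \<longleftrightarrow> b \<in> L" "b + a \<in> L \<longleftrightarrow> b \<in> L" "a - b \<in> L \<longleftrightarrow> b \<in> L" "b - a \<in> L \<longleftrightarrow> b \<in> L"
    if a: "a \<in> L" for a b
  proof -
    show 1: "a + b \<in> L \<longleftrightarrow> b \<in> L" for b
      using subspace_add[OF sub a, of b] subspace_diff[OF sub _ a, of "a + b"] by auto
    show "b + a \<in> L \<longleftrightarrow> b \<in> L" using 1[of b] by (simp add: add.commute)
    show "b - a \<in> L \<longleftrightarrow> b \<in> L" using 1[of "b - a"] by simp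
    show "a - b \<in> L \<longleftrightarrow> b \<in> L"
      using subspace_diff[OF sub a, of b] subspace_diff[OF sub a, of "a - b"] by auto
  qed
  have Lneg: "- a \<in> L \<longleftrightarrow> a \<in> L" for a
    using subspace_neg[OF sub, of a] subspace_neg[OF sub, of "- a"] by auto
  have Lsc: "c *\<^sub>R a \<in> L \<longleftrightarrow> a \<in> L" if "c \<noteq> 0" for c a
    using subspace_scale[OF sub, of a c] subspace_scale[OF sub, of "c *\<^sub>R a" "inverse c"] that by auto
  define full where "full n m \<longleftrightarrow> (\<forall>q. matunit n m q \<in> L)" for n m
  have fullD: "matunit n m q \<in> L" if "full n m" for n m q
    using that by (simp add: full_def)
  have full_left: "full n m" if c: "c \<noteq> 0" and h: "\<And>q. matunit n m (c * q) \<in> L" for n m c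
    unfolding full_def
  proof
    fix q
    obtain r where "c * r = 1" by (rule quat_inverse[OF c])
    then show "matunit n m q \<in> L" using h[of "r * q"] by (simp add: mult.assoc[symmetric])
  qed
  have full_right: "full n m" if c: "c \<noteq> 0" and h: "\<And>q. matunit n m (q * c) \<in> L" for n m c
    unfolding full_def
  proof
    fix q
    obtain r where "r * c = 1" by (rule quat_inverse[OF c])
    then show "matunit n m q \<in> L" using h[of "q * r"] by (simp add: mult.assoc)
  qed
  have full_trans: "full a c" if ab: "full a b" and bc: "full b c" and ac: "a \<noteq> c" for a b c
    unfolding full_def
  proof
    fix q
    show "matunit a c q \<in> L"
      using brk[OF fullD[OF ab, of 1] fullD[OF bc, of q]] ac by (simp add: matunit_mult_matunit)
  qed
  \<comment> \<open>Bracketing with a connection matrix replaces the row index n according to column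
    n of that matrix, and the column index m according to its row m. Every step below picks
    \<open>x\<close> so that just one resulting position is new.\<close>
  have ad: "(\<Sum>i\<in>UNIV. matunit i m (obata_matrix x $ i $ n * q)) - (\<Sum>j\<in>UNIV. matunit n j (q * obata_matrix x $ m $ j)) \<in> L"
    if "matunit n m q \<in> L" for n m q x
    using adB[OF that, of x] by (simp add: matrix_mult_matunit matunit_mult_matrix)
  \<comment> \<open>The last four are entries of \<open>obata_matrix\<close> at coordinate vectors;
    below they occur as factors to be cancelled.\<close>
  have nz: "quat_i \<noteq> 0" "quat_j \<noteq> 0" "quat_k \<noteq> 0" "(1::quat) \<noteq> 0"
    "Quat 0 0 (- 1 / 2) (1 / 6) \<noteq> 0" "Quat 0 0 1 0 \<noteq> 0" "Quat (- 1) 0 0 0 \<noteq> 0" "Quat 0 0 (-1) 0 \<noteq> 0"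
    by (simp_all add: quat_eq_iff)
  have Q0: "Quat 0 0 0 0 = 0" by (simp add: quat_eq_iff)
  note S = sum_6 obata_matrix_nth axis_nth_if Q0 matunit_simps Ladd Lneg L0 fullD

  have u66: "matunit 6 6 quat_j \<in> L" "matunit 6 6 quat_k \<in> L"
    using curv[of "axis 6 quat_j" "axis 6 1"] curv[of "axis 6 quat_k" "axis 6 1"]
    by (simp_all add: curvature_values matunit_simps Lneg)
  then have "matunit 6 6 quat_i \<in> L"
    using brk[OF u66] by (simp add: matunit_mult_matunit quat_unit_mult matunit_simps Lsc flip: scaleR_2)
  note u66 = this u66
  \<comment> \<open>Bracketing with a unit at (6,6) multiplies an entry of column 6 from the right
    by that unit, so one non-zero entry generates its whole quaternionic line.\<close>
  have col6: "full n 6" if "n \<noteq> 6" and h: "matunit n 6 c \<in> L" and c: "c \<noteq> 0" for n c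
  proof (rule full_left[OF c])
    fix q
    have *: "matunit n 6 (c * u) \<in> L" if "matunit 6 6 u \<in> L" for u
      using brk[OF h that] \<open>n \<noteq> 6\<close> by (simp add: matunit_mult_matunit)
    have "(matunit n 6 (c * q) :: quat^6^6) = qre q *\<^sub>R matunit n 6 c + qi q *\<^sub>R matunit n 6 (c * quat_i)
       + qj q *\<^sub>R matunit n 6 (c * quat_j) + qk q *\<^sub>R matunit n 6 (c * quat_k)"
      by (subst quat_basis_expand[of q]) (simp add: distrib_left matunit_simps)
    then show "matunit n 6 (c * q) \<in> L"
      using h *[OF u66(1)] *[OF u66(2)] *[OF u66(3)]
      by (simp add: subspace_add[OF sub] subspace_scale[OF sub])
  qed
  have f16: "full 1 6"
    using curv[of "axis 6 quat_i" "axis 2 1"]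
    by (intro col6[where c = "(- 1 / 2) *\<^sub>R 1"]) (simp_all add: curvature_values)
  \<comment> \<open>The direction j in coordinate 3 is taken because row 6 of the connection matrix
    then vanishes, whereas the direction 1 would produce a term at (1,5).\<close>
  have f36: "full 3 6"
    using ad[OF fullD[OF f16], of "axis 3 quat_j"] by (intro full_left[OF nz(2)]) (simp add: S)
  have f46: "full 4 6"
    using ad[OF fullD[OF f16], of "axis 4 1"] by (intro full_left[OF nz(4)]) (simp add: S)
  have f26: "full 2 6"
    using ad[OF fullD[OF f36], of "axis 3 quat_j"] f16 by (intro full_left[OF nz(5)]) (simp add: S)
  have f56: "full 5 6"
  proof (rule col6)
    \<comment> \<open>Any non-zero coordinate 5 makes row 6 of the connection matrix non-zero, so a
      stray term at (1,4) is unavoidable. Bracketing with the unit i at (6,6) removes it and keeps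
      the term at (5,6).\<close>
    have "matunit 5 6 1 + matunit 1 4 (Quat 0 0 1 0) \<in> L"
      using subspace_neg[OF sub ad[OF fullD[OF f16, of 1], of "axis 5 1"]] by (simp add: S add.commute)
    from brk[OF this u66(1)] show "matunit 5 6 quat_i \<in> L"
      by (simp add: matunit_mult_matunit mmult.add_left mmult.add_right)
  qed (simp_all add: nz)
  have f14: "full 1 4"
    using ad[OF fullD[OF f16], of "axis 5 1"] f56 by (intro full_right[OF nz(6)]) (simp add: S)
  have f13: "full 1 3"
    using ad[OF fullD[OF f16], of "axis 5 quat_j"] f56 by (intro full_right[OF nz(8)]) (simp add: S)
  have f12: "full 1 2"
    using ad[OF fullD[OF f16], of "axis 6 1"] by (intro full_right[OF nz(4)]) (simp add: S)
  have f15: "full 1 5"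
    using ad[OF fullD[OF f16], of "axis 3 1"] f36 by (intro full_right[OF nz(7)]) (simp add: S)
  have f23: "full 2 3"
    using ad[OF fullD[OF f26], of "axis 5 quat_j"] by (intro full_right[OF nz(8)]) (simp add: S)
  have f24: "full 2 4"
    using ad[OF fullD[OF f26], of "axis 5 1"] by (intro full_right[OF nz(6)]) (simp add: S)
  have f25: "full 2 5"
    using ad[OF fullD[OF f26], of "axis 3 1"] by (intro full_right[OF nz(7)]) (simp add: S)
  have f3: "full 3 m" if "m = 2 \<or> m = 4 \<or> m = 5" for m
    using ad[OF fullD[of 1 m], of "axis 3 quat_j"] that f12 f13 f14 f15
    by (intro full_left[OF nz(2)]) (auto simp: S)
  have f4: "full 4 m" if "m = 2 \<or> m = 3 \<or> m = 5" for m
    using ad[OF fullD[of 1 m], of "axis 4 1"] that f12 f13 f14 f15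
    by (intro full_left[OF nz(4)]) (auto simp: S)
  have f5: "full 5 m" if "m = 2 \<or> m = 3 \<or> m = 4" for m
    using ad[OF fullD[of 1 m], of "axis 5 1"] that f12 f13 f14 f15
    by (intro full_left[OF nz(4)]) (auto simp: S)
  have f62: "full 6 2"
    using ad[OF fullD[OF f5[of 2]], of "axis 3 1"] f5[of 3] f5[of 4]
    by (intro full_left[OF nz(7)]) (simp add: S)
  have f21: "full 2 1"
    using ad[OF fullD[OF f23], of "axis 3 quat_j"] by (intro full_right[OF nz(2)]) (simp add: S)
  \<comment> \<open>Index 2 serves as a hub: a bracket of positions (n,2) and (2,m) reaches
    (n,m).\<close>
  have to2: "full n 2" if "n \<noteq> 2" for n
    using that exhaust_6[of n] f12 f3[of 2] f4[of 2] f5[of 2] f62 by auto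
  have from2: "full 2 n" if "n \<noteq> 2" for n
    using that exhaust_6[of n] f21 f23 f24 f25 f26 by auto
  have off: "full n m" if "n \<noteq> m" for n m
    using that to2[of n] from2[of m] full_trans[of n 2 m] by (cases "n = 2"; cases "m = 2") auto
  have dif: "matunit a a (p * q) - matunit b b (q * p) \<in> L" if "a \<noteq> b" for a b p q
    using brk[OF fullD[OF off[OF that], of p] fullD[OF off[OF that[symmetric]], of q]]
    by (simp add: matunit_mult_matunit)
  \<comment> \<open>For anticommuting \<open>p\<close> and \<open>q\<close> with product
    \<open>u\<close>, the bracket of opposite positions puts \<open>u\<close> at both (a,a) and
    (b,b); for \<open>u\<close> and 1 it gives the difference. Adding the two isolates
    (a,a).\<close>
  have im: "matunit a a u \<in> L" if "p * q = u" "q * p = - u" for a p q u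
  proof -
    obtain b where b: "a \<noteq> b" by (metis one_neq_zero)
    have "matunit a a u + matunit b b u \<in> L" "matunit a a u - matunit b b u \<in> L"
      using dif[OF b, of p q] dif[OF b, of u 1] that by (simp_all add: matunit_simps)
    from subspace_add[OF sub this] have "2 *\<^sub>R matunit a a u \<in> L" by (simp add: scaleR_2)
    then show ?thesis by (simp add: Lsc)
  qed
  \<comment> \<open>The fourth curvature value after removal of its terms at (1,2) and (6,6). The
    differences in \<open>d1\<close> have real trace 0, so they concentrate its trace 4 at the
    position (1,1).\<close>
  have tr: "matunit 1 1 1 + matunit 3 3 1 + matunit 4 4 1 + matunit 5 5 1 \<in> L"
    using curv[of "axis 6 quat_i" "axis 6 1"] u66(1) fullD[OF f12, of 1]
    unfolding curvature_values by (simp add: matunit_simps Lsc Ladd diff_add_eq)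
  have d1: "matunit 1 1 1 - matunit a a 1 \<in> L" if "a \<noteq> 1" for a
    using dif[of 1 a 1 1] that by simp
  have "(matunit 1 1 1 + matunit 3 3 1 + matunit 4 4 1 + matunit 5 5 1)
     + (matunit 1 1 1 - matunit 3 3 1) + (matunit 1 1 1 - matunit 4 4 1) + (matunit 1 1 1 - matunit 5 5 1) \<in> L"
    using subspace_add[OF sub subspace_add[OF sub subspace_add[OF sub tr d1[of 3]] d1[of 4]] d1[of 5]]
    by simp
  also have "(matunit 1 1 1 + matunit 3 3 1 + matunit 4 4 1 + matunit 5 5 1)
     + (matunit 1 1 1 - matunit 3 3 1) + (matunit 1 1 1 - matunit 4 4 1) + (matunit 1 1 1 - matunit 5 5 1)
     = 4 *\<^sub>R (matunit 1 1 (1::quat) :: quat^6^6)"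
    by (simp add: matunit_def vec_eq_iff quat_eq_iff)
  finally have "4 *\<^sub>R matunit 1 1 (1::quat) \<in> L" .
  then have one1: "matunit 1 1 1 \<in> L" by (simp add: Lsc)
  have one: "matunit a a 1 \<in> L" for a
    using dif[of 1 a 1 1] one1 by (cases "a = 1") (auto simp: Ladd)
  have "full a a" for a
    unfolding full_def
  proof
    fix q
    have "matunit a a q = qre q *\<^sub>R matunit a a 1 + qi q *\<^sub>R matunit a a quat_i
       + qj q *\<^sub>R matunit a a quat_j + qk q *\<^sub>R matunit a a quat_k"
      by (subst quat_basis_expand[of q]) (simp add: matunit_simps)
    then show "matunit a a q \<in> L"
      using one[of a] im[OF quat_unit_mult(2,5), of a] im[OF quat_unit_mult(3,6), of a]
        im[OF quat_unit_mult(1,4), of a]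
      by (simp add: subspace_add[OF sub] subspace_scale[OF sub])
  qed
  with off have "full n m" for n m by (cases "n = m") auto
  then show ?thesis
    by (subst matrix_eq_sum_matunit) (intro subspace_sum[OF sub] fullD)
qed

section \<open>Generation of the general linear group\<close>

lemma matrix_vector_axis: "(M *v axis j 1) $ i = M $ i $ j"
  for M :: "'a::real_algebra_1^'n^'m"
  by (simp add: matrix_vector_mult_def axis_def if_distrib[of "\<lambda>x. _ * x"] cong: if_cong)

text \<open>For \<open>w $ k = 0\<close> this is the unipotent matrix adding left multiples of row k
  to the other rows. One factor clears a whole column, and these \<open>w\<close> form a connected
  family.\<close>

definition transvection :: "'n \<Rightarrow> 'a::{euclidean_space,real_algebra_1}^'n \<Rightarrow> 'a^'n^'n" where
  "transvection k w = mat 1 + (\<chi> i j. if j = k then w $ i else 0)"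

definition dilation :: "'n \<Rightarrow> 'a::{euclidean_space,real_algebra_1} \<Rightarrow> 'a^'n^'n" where
  "dilation k q = mat 1 + matunit k k (q - 1)"

lemma transvection_mult:
  assumes "v $ k = 0"
  shows "transvection k w ** transvection k v = transvection k (w + v)"
proof -
  have "(\<chi> i j. if j = k then w $ i else 0) ** (\<chi> i j. if j = k then v $ i else 0) = 0"
    unfolding vec_eq_iff
  proof (intro allI)
    fix i j
    show "((\<chi> i j. if j = k then w $ i else 0) ** (\<chi> i j. if j = k then v $ i else 0)) $ i $ j = 0 $ i $ j"
      using assms by (cases "j = k") (auto simp: matrix_matrix_mult_def intro!: sum.neutral)
  qed
  moreover have "(\<chi> i j. if j = k then (w + v) $ i else 0)
    = (\<chi> i j. if j = k then w $ i else 0) + (\<chi> i j. if j = k then v $ i else 0)"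
    by (simp add: vec_eq_iff)
  ultimately show ?thesis
    unfolding transvection_def by (simp add: mmult.add_left mmult.add_right algebra_simps)
qed

lemma dilation_mult: "dilation k p ** dilation k q = dilation k (p * q)"
proof -
  have "p * q - 1 = (p - 1) * (q - 1) + (p - 1) + (q - 1)" by (simp add: algebra_simps)
  then have *: "matunit k k (p * q - 1) = matunit k k ((p - 1) * (q - 1)) + matunit k k (p - 1) + matunit k k (q - 1)"
    by (simp only: matunit_simps)
  show ?thesis
    unfolding dilation_def * by (simp add: mmult.add_left mmult.add_right matunit_mult_matunit add_ac)
qed

text \<open>A subgroup with the identity in its interior contains all elements near the identity, so
  membership is locally constant along a family whose nearby members differ by a factor close to 1.
  On a connected parameter set it is therefore constant.\<close>

lemma eventually_mem_iff:
  fixes H :: "('a::{euclidean_space,real_algebra_1}^'n^'n) set"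
    and f g :: "'c::topological_space \<Rightarrow> 'a^'n^'n"
  assumes one: "mat 1 \<in> interior H"
    and mult: "\<And>X Y. X \<in> H \<Longrightarrow> Y \<in> H \<Longrightarrow> X ** Y \<in> H"
    and inv: "\<And>X. X \<in> H \<Longrightarrow> \<exists>Y\<in>H. X ** Y = mat 1 \<and> Y ** X = mat 1"
    and cont: "continuous_on UNIV g" and gx: "g x = mat 1"
    and fg: "\<And>y. y \<in> T \<Longrightarrow> f y = f x ** g y"
  shows "\<forall>\<^sub>F y in at x within T. (f x \<in> H) = (f y \<in> H)"
proof -
  have mult_iff: "X ** Y \<in> H \<longleftrightarrow> X \<in> H" if Y: "Y \<in> H" for X Y
  proof
    assume XY: "X ** Y \<in> H"
    from inv[OF Y] obtain Z where "Z \<in> H" "Y ** Z = mat 1" by blast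
    then show "X \<in> H" using mult[OF XY, of Z] by (simp flip: matrix_mul_assoc)
  qed (use mult Y in blast)
  have "open (g -` interior H)" by (intro open_vimage open_interior cont)
  moreover have "x \<in> g -` interior H" using gx one by simp
  ultimately have "\<forall>\<^sub>F y in at x within T. y \<in> g -` interior H"
    by (auto simp: eventually_at_topological)
  moreover have "\<forall>\<^sub>F y in at x within T. y \<in> T"
    by (auto simp: eventually_at_topological)
  ultimately show ?thesis
  proof eventually_elim
    case (elim y)
    then have "g y \<in> H" using interior_subset by auto
    from mult_iff[OF this, of "f x"] show ?case by (simp add: fg elim)
  qed
qed

text \<open>Transvections are parametrised by a hyperplane and dilations by the non-zero
  quaternions, both connected sets containing a parameter of the identity matrix; hence
  \<open>H\<close> contains all of them. Gaussian elimination does the rest, without a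
  determinant.\<close>

lemma GL_quat_generated:
  fixes H :: "(quat^'n^'n) set"
  assumes one: "mat 1 \<in> interior H"
    and mult: "\<And>X Y. X \<in> H \<Longrightarrow> Y \<in> H \<Longrightarrow> X ** Y \<in> H"
    and inv: "\<And>X. X \<in> H \<Longrightarrow> \<exists>Y\<in>H. X ** Y = mat 1 \<and> Y ** X = mat 1"
    and M: "invertible M"
  shows "M \<in> H"
proof -
  have one': "mat 1 \<in> H" using one interior_subset by blast
  note locally = eventually_mem_iff[OF one mult inv]
  have T: "transvection k w \<in> H" if w: "w $ k = 0" for k w
  proof -
    define T where "T = {w :: quat^'n. w $ k = 0}"
    have "convex T" by (auto simp: T_def convex_def)
    then have "connected T" by (rule convex_connected)
    then have "(transvection k 0 \<in> H) = (transvection k w \<in> H)"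
    proof (rule connected_local_const)
      show "\<forall>x\<in>T. \<forall>\<^sub>F y in at x within T. (transvection k x \<in> H) = (transvection k y \<in> H)"
      proof
        fix x assume x: "x \<in> T"
        show "\<forall>\<^sub>F y in at x within T. (transvection k x \<in> H) = (transvection k y \<in> H)"
        proof (rule locally[where g = "\<lambda>y. transvection k (y - x)"])
          show "continuous_on UNIV (\<lambda>y. transvection k (y - x))"
            unfolding transvection_def
          proof (intro continuous_intros continuous_on_vec_lambda)
            show "continuous_on UNIV (\<lambda>y. if j = k then (y - x) $ i else 0)" for i j
              by (cases "j = k") (auto intro!: continuous_intros)
          qed
          show "transvection k (x - x) = mat 1" by (simp add: transvection_def vec_eq_iff)
          show "transvection k y = transvection k x ** transvection k (y - x)" if "y \<in> T" for y
            using x that by (subst transvection_mult) (auto simp: T_def)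
        qed
      qed
    qed (use w in \<open>auto simp: T_def\<close>)
    moreover have "transvection k (0 :: quat^'n) = mat 1" by (simp add: transvection_def vec_eq_iff)
    ultimately show ?thesis using one' by simp
  qed
  have D: "dilation k q \<in> H" if q: "q \<noteq> 0" for k q
  proof -
    have "DIM(quat) = 4" by (simp add: Basis_quat_def quat_eq_iff)
    then have "connected (- {0 :: quat})" by (intro connected_punctured_universe) simp
    then have "(dilation k 1 \<in> H) = (dilation k q \<in> H)"
    proof (rule connected_local_const)
      show "\<forall>x\<in>- {0}. \<forall>\<^sub>F y in at x within - {0}. (dilation k x \<in> H) = (dilation k y \<in> H)"
      proof
        fix x :: quat assume "x \<in> - {0}"
        then obtain r where r: "x * r = 1" "r * x = 1" by (auto elim: quat_inverse)
        have cont: "continuous_on UNIV (\<lambda>y. r * y - 1)"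
          by (intro linear_continuous_on bounded_linear.linear continuous_intros)
            (simp add: linear_conv_bounded_linear[symmetric] linearI distrib_left)
        show "\<forall>\<^sub>F y in at x within - {0}. (dilation k x \<in> H) = (dilation k y \<in> H)"
        proof (rule locally[where g = "\<lambda>y. dilation k (r * y)"])
          show "continuous_on UNIV (\<lambda>y. dilation k (r * y))"
            unfolding dilation_def matunit_def
          proof (intro continuous_intros continuous_on_vec_lambda)
            show "continuous_on UNIV (\<lambda>y. if i = k \<and> j = k then r * y - 1 else 0)" for i j
              by (cases "i = k \<and> j = k") (auto simp: cont)
          qed
          show "dilation k (r * x) = mat 1" by (simp add: dilation_def r matunit_simps)
          show "dilation k y = dilation k x ** dilation k (r * y)" for y
            by (simp add: dilation_mult r mult.assoc[symmetric])
        qed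
      qed
    qed (use q in auto)
    moreover have "dilation k (1 :: quat) = mat 1" by (simp add: dilation_def matunit_simps)
    ultimately show ?thesis using one' by simp
  qed
  \<comment> \<open>Induction on the number of columns that are not yet known to be standard basis
    vectors; \<open>S\<close> is the set of finished columns.\<close>
  have "M \<in> H" if "invertible M" "\<And>j. j \<in> S \<Longrightarrow> M *v axis j 1 = axis j 1" "card (- S) = n" for S M n
    using that
  proof (induction n arbitrary: S M)
    case 0
    then have "- S = {}" by simp
    then have "S = UNIV" by blast
    then have M1: "M *v axis j 1 = axis j 1" for j using 0 by simp
    have "M $ i $ j = mat 1 $ i $ j" for i j
    proof -
      have "M $ i $ j = axis j 1 $ i" by (simp only: M1 flip: matrix_vector_axis)
      then show ?thesis by (simp add: axis_def mat_def)
    qed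
    then have "M = mat 1" by (simp add: vec_eq_iff)
    then show ?case using one' by simp
  next
    case (Suc n)
    then have "- S \<noteq> {}" by auto
    then obtain k where k: "k \<notin> S" by auto
    from \<open>invertible M\<close> obtain M' where M': "M' ** M = mat 1" by (auto simp: invertible_def)
    have inj: "v = 0" if "M *v v = 0" for v
      using arg_cong[OF that, of "\<lambda>v. M' *v v"] by (simp add: matrix_vector_mul_assoc M')
    have col: "M $ i $ j = (if i = j then 1 else 0)" if "j \<in> S" for i j
    proof -
      have "M $ i $ j = axis j 1 $ i" by (simp only: Suc.prems(2)[OF that] flip: matrix_vector_axis)
      then show ?thesis by (simp add: axis_def)
    qed
    have "\<exists>i. i \<notin> S \<and> M $ i $ k \<noteq> 0"
    proof (rule ccontr)
      assume "\<not> ?thesis"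
      then have z: "M $ i $ k = 0" if "i \<notin> S" for i using that by blast
      \<comment> \<open>Without a pivot outside \<open>S\<close>, column k would be a right
        combination of the finished columns with coefficients \<open>M $ j $ k\<close>; this is the
        resulting kernel vector.\<close>
      define v where "v = (\<chi> j. if j = k then 1 else if j \<in> S then - (M $ j $ k) else 0)"
      have "(M *v v) $ i = 0" for i
      proof -
        have "M $ i $ j * v $ j = (if j = k then M $ i $ k else 0) + (if j = i \<and> i \<in> S then - (M $ i $ k) else 0)" for j
        proof (cases "j \<in> S")
          case True
          with k have "j \<noteq> k" by auto
          with True show ?thesis by (cases "i = j") (simp_all add: v_def col[OF True])
        next
          case False
          then show ?thesis using k by (cases "j = k") (auto simp: v_def)
        qed
        then have "(M *v v) $ i = (\<Sum>j\<in>UNIV. (if j = k then M $ i $ k else 0) + (if j = i \<and> i \<in> S then - (M $ i $ k) else 0))"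
          by (simp add: matrix_vector_mult_def)
        also have "\<dots> = M $ i $ k + (if i \<in> S then - (M $ i $ k) else 0)"
          by (cases "i \<in> S") (simp_all add: sum.distrib)
        finally show ?thesis using z[of i] by auto
      qed
      then have "M *v v = 0" by (simp add: vec_eq_iff)
      then have "v = 0" by (rule inj)
      then have "v $ k = 0" by simp
      then show False by (simp add: v_def)
    qed
    then obtain i where i: "i \<notin> S" "M $ i $ k \<noteq> 0" by blast
    have step: "N \<in> H" if N: "invertible N" "\<And>j. j \<in> S \<Longrightarrow> N *v axis j 1 = axis j 1" "N $ k $ k \<noteq> 0" for N
    proof -
      define w where "w = N *v axis k 1"
      have wk: "w $ k \<noteq> 0" using N(3) by (simp add: w_def matrix_vector_axis)
      obtain r where r: "w $ k * r = 1" "r * w $ k = 1" by (rule quat_inverse[OF wk])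
      define u where "u = (\<chi> i. if i = k then 0 else w $ i * r)"
      \<comment> \<open>\<open>C\<close> has \<open>w\<close> as column k and standard columns
        elsewhere. Its inverse therefore turns column k of \<open>N\<close> into a basis vector and
        leaves the finished columns alone.\<close>
      define C where "C = transvection k u ** dilation k (w $ k)"
      have CH: "C \<in> H" unfolding C_def by (intro mult T D wk) (simp add: u_def)
      have Dj: "dilation k q *v axis j 1 = (if j = k then axis k q else axis j 1)" for q j
        unfolding vec_eq_iff matrix_vector_axis by (auto simp: dilation_def matunit_def axis_def mat_def)
      have Tj: "transvection k u *v axis j 1 = axis j 1" if "j \<noteq> k" for j
        using that unfolding vec_eq_iff matrix_vector_axis by (auto simp: transvection_def axis_def mat_def)
      have Cj: "C *v axis j 1 = axis j 1" if "j \<noteq> k" for j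
        using that by (simp add: C_def Dj Tj flip: matrix_vector_mul_assoc)
      have "(transvection k u *v axis k q) $ i = (if i = k then q else 0) + u $ i * q" for i q
        by (simp add: matrix_vector_mult_def axis_def transvection_def mat_def if_distrib[of "\<lambda>x. _ * x"]
            distrib_right cong: if_cong)
      then have Ck: "C *v axis k 1 = w"
        by (simp add: vec_eq_iff C_def Dj u_def mult.assoc r flip: matrix_vector_mul_assoc)
      from inv[OF CH] obtain A where A: "A \<in> H" "C ** A = mat 1" "A ** C = mat 1" by blast
      have AC: "A *v (C *v v) = v" for v by (simp add: matrix_vector_mul_assoc A)
      have "A ** N \<in> H"
      proof (rule Suc.IH[of _ "insert k S"])
        show "invertible (A ** N)"
          using A N(1) by (intro invertible_mult) (auto simp: invertible_def)
        show "card (- insert k S) = n"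
          using Suc.prems(3) k by (simp add: Compl_insert)
        show "A ** N *v axis j 1 = axis j 1" if "j \<in> insert k S" for j
        proof (cases "j = k")
          case True
          then show ?thesis using AC[of "axis k 1"] Ck by (simp add: w_def flip: matrix_vector_mul_assoc)
        next
          case False
          then have "N *v axis j 1 = axis j 1" "C *v axis j 1 = axis j 1" using that N(2) Cj by auto
          then show ?thesis using AC[of "axis j 1"] by (simp flip: matrix_vector_mul_assoc)
        qed
      qed
      from mult[OF CH this] show "N \<in> H" by (simp add: matrix_mul_assoc A)
    qed
    show ?case
    proof (cases "M $ k $ k = 0")
      case False
      then show ?thesis using Suc.prems step by blast
    next
      case True
      with i have ik: "i \<noteq> k" by auto
      \<comment> \<open>\<open>P\<close> adds row i to row k, which moves the pivot to the diagonal.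
        It can alter only basis vector i, and \<open>i\<close> is not in \<open>S\<close>.\<close>
      define P where "P = transvection i (axis k (1::quat))"
      have PH: "P \<in> H" unfolding P_def by (rule T) (use ik in \<open>simp add: axis_def\<close>)
      from inv[OF PH] obtain Q where Q: "Q \<in> H" "P ** Q = mat 1" "Q ** P = mat 1" by blast
      have "P ** M \<in> H"
      proof (rule step)
        show "invertible (P ** M)"
          using Q Suc.prems(1) by (intro invertible_mult) (auto simp: invertible_def)
        have Pj: "P *v axis j 1 = axis j 1" if "j \<noteq> i" for j
          using that unfolding vec_eq_iff matrix_vector_axis by (auto simp: P_def transvection_def axis_def mat_def)
        show "P ** M *v axis j 1 = axis j 1" if "j \<in> S" for j
          using that Suc.prems(2)[OF that] Pj[of j] i by (auto simp flip: matrix_vector_mul_assoc)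
        have "(P ** M) $ k $ k = M $ k $ k + M $ i $ k"
          unfolding P_def transvection_def matrix_matrix_mult_def
          by (simp add: mat_def axis_def distrib_right sum.distrib if_distrib[of "\<lambda>x. x * _"] cong: if_cong)
        then show "(P ** M) $ k $ k \<noteq> 0" using True i by simp
      qed
      from mult[OF Q(1) this] show ?thesis by (simp add: matrix_mul_assoc Q)
    qed
  qed
  from this[OF M, of "{}"] show ?thesis by simp
qed

section \<open>The Obata connection in quaternionic coordinates\<close>

text \<open>Scalars act from the right, so they commute with matrices. In coordinates
  \<open>I\<close>, \<open>J\<close>, \<open>K\<close> are of this form, which makes them intertwine
  with every connection matrix.\<close>

definition rmul :: "quat^'n \<Rightarrow> quat \<Rightarrow> quat^'n" where
  "rmul v p = (\<chi> n. v $ n * p)"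

lemma matrix_mult_rmul: "M *v rmul v p = rmul (M *v v) p"
  by (simp add: rmul_def matrix_vector_mult_def vec_eq_iff sum_distrib_right mult.assoc)

lemma rmul_diff: "rmul (v - w) p = rmul v p - rmul w p"
  and rmul_minus: "rmul (- v) p = - rmul v p"
  by (simp_all add: rmul_def vec_eq_iff left_diff_distrib)

lemma bounded_linear_rmul: "bounded_linear (\<lambda>v. rmul v p)"
  by (rule linear_conv_bounded_linear[THEN iffD1])
    (auto intro!: linearI simp: rmul_def vec_eq_iff distrib_right)

lemma Ck_on_const: "Ck_on k (\<lambda>x. c) U"
proof (induction k arbitrary: c)
  case (Suc k)
  have "\<forall>x\<in>U. ((\<lambda>x. c) has_derivative (\<lambda>h. 0)) (at x)" by auto
  then show ?case using Suc[of 0] unfolding Ck_on.simps by (intro exI[of _ "\<lambda>x h. 0"]) auto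
qed simp

lemma Ck_on_bounded_linear:
  assumes "bounded_linear f"
  shows "Ck_on k f U"
proof (cases k)
  case 0
  then show ?thesis by (simp add: assms linear_continuous_on)
next
  case (Suc k')
  have "\<forall>x\<in>U. (f has_derivative f) (at x)"
    using bounded_linear_imp_has_derivative[OF assms] by blast
  then show ?thesis unfolding Suc Ck_on.simps
    by (intro exI[of _ "\<lambda>x. f"]) (auto intro: Ck_on_const)
qed

lemma left_invariant_field_deriv:
  "(left_invariant_field x has_derivative left_invariant_field x) (at g)"
  unfolding left_invariant_field_def
  by (rule bounded_linear_imp_has_derivative[OF mmult.bounded_linear_left])

lemma left_invariant_vector_field:
  assumes "x \<in> su5"
  shows "left_invariant_field x \<in> vector_fields"
  using assms Ck_on_bounded_linear[OF mmult.bounded_linear_left, of _ x]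
  by (auto simp: vector_fields_def smooth_near_def tangent_def left_invariant_field_def intro!: exI[of _ UNIV])

lemma lie_bracket_left_invariant:
  "lie_bracket_field (left_invariant_field x) (left_invariant_field y) g = g ** bracket x y"
  unfolding lie_bracket_field_def frechet_derivative_at[OF left_invariant_field_deriv, symmetric]
  by (simp add: left_invariant_field_def bracket_def matrix_mul_assoc mmult.diff_right)

lemma tangent_iff: "g \<in> SU5 \<Longrightarrow> v \<in> tangent g \<longleftrightarrow> adj g ** v \<in> su5"
  unfolding tangent_def by (auto simp: SU5_simps image_iff) (metis SU5_simps(2))

text \<open>The coordinates finally used depend on the chosen basis through a unitary matrix. The
  locale collects the properties of \<open>psi\<close> and \<open>phi\<close> that survive this
  conjugation, together with the action of \<open>I\<close>, \<open>J\<close>,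
  \<open>K\<close>.\<close>

locale su5_obata =
  fixes I J K :: "cmat5 \<Rightarrow> cmat5"
    and D :: "(cmat5 \<Rightarrow> cmat5) \<Rightarrow> (cmat5 \<Rightarrow> cmat5) \<Rightarrow> cmat5 \<Rightarrow> cmat5"
    and th :: "cmat5 \<Rightarrow> quat^6" and xi :: "quat^6 \<Rightarrow> cmat5"
  assumes linear_th: "linear th" and linear_xi: "linear xi"
    and xi_su5: "xi q \<in> su5" and th_xi: "th (xi q) = q" and xi_th: "x \<in> su5 \<Longrightarrow> xi (th x) = x"
    and bracket_xi: "bracket (xi p) (xi q) = xi (obata_matrix p *v q - obata_matrix q *v p)"
    and I_xi: "I (xi q) = xi (rmul q (- quat_i))"
    and J_xi: "J (xi q) = xi (rmul q (- quat_j))"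
    and K_xi: "K (xi q) = xi (rmul q (- quat_k))"
    and obata: "obata_connection I J K D"
begin

text \<open>Uniqueness of the Obata connection. The difference \<open>S\<close> of the two
  candidates is symmetric because both are torsion-free, and quaternionic in its second argument,
  hence in both.\<close>

lemma connection_left_invariant:
  assumes g: "g \<in> SU5"
  shows "D (left_invariant_field (xi p)) (left_invariant_field (xi q)) g = g ** xi (obata_matrix p *v q)"
proof -
  let ?L = "\<lambda>p. left_invariant_field (xi p)"
  have vf: "?L p \<in> vector_fields" for p by (intro left_invariant_vector_field xi_su5)
  have Dvf: "D (?L p) (?L q) \<in> vector_fields" for p q
    using obata vf by (auto simp: obata_connection_def affine_connection_def)
  define N where "N p q = th (adj g ** D (?L p) (?L q) g)" for p q
  have in_su5: "adj g ** D (?L p) (?L q) g \<in> su5" for p q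
    using Dvf[of p q] g by (auto simp: vector_fields_def tangent_iff[symmetric])
  then have DN: "D (?L p) (?L q) g = g ** xi (N p q)" for p q
    unfolding N_def by (simp add: xi_th SU5_simps[OF g])
  define S where "S p q = N p q - obata_matrix p *v q" for p q
  have sym: "S p q = S q p" for p q
  proof -
    have "D (?L p) (?L q) g - D (?L q) (?L p) g = g ** bracket (xi p) (xi q)"
      using obata vf[of p] vf[of q] g
      by (simp add: obata_connection_def torsion_free_def eq_on_SU5_def lie_bracket_left_invariant)
    then have "adj g ** (D (?L p) (?L q) g - D (?L q) (?L p) g) = bracket (xi p) (xi q)"
      by (simp add: SU5_simps[OF g])
    then have "th (xi (N p q - N q p)) = th (xi (obata_matrix p *v q - obata_matrix q *v p))"
      by (simp add: DN mmult.diff_right SU5_simps[OF g] bracket_xi linear_diff[OF linear_xi])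
    then show ?thesis by (simp add: S_def th_xi algebra_simps)
  qed
  have quat: "S p (rmul q u) = rmul (S p q) u"
    if T: "preserves D T" "\<And>q. T (xi q) = xi (rmul q u)" for p q u T
  proof -
    have "eq_on_SU5 (?L (rmul q u)) (\<lambda>g. left_translate T g (?L q g))"
      by (auto simp: eq_on_SU5_def left_translate_def left_invariant_field_def SU5_simps T(2)[symmetric])
    then have "D (?L p) (?L (rmul q u)) g = left_translate T g (D (?L p) (?L q) g)"
      using T(1) vf g unfolding preserves_def eq_on_SU5_def by blast
    then have "g ** xi (N p (rmul q u)) = g ** xi (rmul (N p q) u)"
      unfolding DN by (simp add: left_translate_def SU5_simps[OF g] T(2))
    then have "N p (rmul q u) = rmul (N p q) u"
      by (metis SU5_simps(1)[OF g] th_xi)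
    then show ?thesis by (simp add: S_def matrix_mult_rmul rmul_diff)
  qed
  have pres: "preserves D I" "preserves D J" using obata by (auto simp: obata_connection_def)
  note qi = quat[OF pres(1) I_xi] and qj = quat[OF pres(2) J_xi]
  have "S p q = 0"
  proof -
    \<comment> \<open>Moving one unit into each argument and taking them out in the opposite order
      shows that i and j act on the value as if they commuted; since they anticommute, the value is
      0.\<close>
    have "rmul (rmul (S p q) (- quat_i)) (- quat_j) = S (rmul p (- quat_i)) (rmul q (- quat_j))"
      by (metis sym qi qj)
    also have "\<dots> = rmul (rmul (S p q) (- quat_j)) (- quat_i)"
      by (metis sym qi qj)
    finally have *: "S p q $ n * quat_i * quat_j = S p q $ n * quat_j * quat_i" for n
      by (simp add: rmul_def vec_eq_iff)
    have "S p q $ n = 0" for n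
      using *[of n] by (simp add: quat_eq_iff)
    then show ?thesis by (simp add: vec_eq_iff)
  qed
  then show ?thesis by (simp add: DN S_def)
qed

subsection \<open>Parallel fields\<close>

text \<open>For V = gamma u the condition DV/dt = 0 becomes u' = -nabla_xi u with xi = gamma^{-1}
  gamma'; \<open>W\<close> is the coordinate vector of u. Finitely many break points are
  exempt.\<close>

definition transport_ode :: "(real \<Rightarrow> cmat5) \<Rightarrow> (real \<Rightarrow> quat^6) \<Rightarrow> bool" where
  "transport_ode \<gamma> W \<longleftrightarrow> continuous_on {0..1} W \<and> (\<exists>S. finite S \<and> (\<forall>t\<in>{0<..<1} - S. \<exists>\<gamma>'.
     (\<gamma> has_vector_derivative \<gamma>') (at t) \<and>
     (W has_vector_derivative - (obata_matrix (th (adj (\<gamma> t) ** \<gamma>')) *v W t)) (at t)))"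

lemma bounded_linear_th: "bounded_linear th"
  using linear_th by (simp add: linear_conv_bounded_linear)

lemma parallel_imp_transport_ode:
  assumes par: "parallel_along D \<gamma> V" and \<gamma>: "\<gamma> ` {0..1} \<subseteq> SU5"
    and cont: "continuous_on {0..1} \<gamma>"
  shows "transport_ode \<gamma> (\<lambda>t. th (adj (\<gamma> t) ** V t))"
proof -
  from par obtain S where S: "finite S" "\<And>t. t \<in> {0<..<1} - S \<Longrightarrow> \<exists>\<gamma>' u'.
        (\<gamma> has_vector_derivative \<gamma>') (at t) \<and>
        ((\<lambda>s. adj (\<gamma> s) ** V s) has_vector_derivative u') (at t) \<and>
        \<gamma> t ** u' + D (left_invariant_field (adj (\<gamma> t) ** \<gamma>'))
                      (left_invariant_field (adj (\<gamma> t) ** V t)) (\<gamma> t) = 0"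
    and tan: "\<And>t. t \<in> {0..1} \<Longrightarrow> V t \<in> tangent (\<gamma> t)" and contV: "continuous_on {0..1} V"
    unfolding parallel_along_def by blast
  have "\<exists>\<gamma>'. (\<gamma> has_vector_derivative \<gamma>') (at t) \<and> ((\<lambda>t. th (adj (\<gamma> t) ** V t)) has_vector_derivative
     - (obata_matrix (th (adj (\<gamma> t) ** \<gamma>')) *v th (adj (\<gamma> t) ** V t))) (at t)" if t: "t \<in> {0<..<1} - S" for t
  proof -
    from S(2)[OF t] obtain \<gamma>' u' where *: "(\<gamma> has_vector_derivative \<gamma>') (at t)"
      "((\<lambda>s. adj (\<gamma> s) ** V s) has_vector_derivative u') (at t)"
      "\<gamma> t ** u' + D (left_invariant_field (adj (\<gamma> t) ** \<gamma>'))
                      (left_invariant_field (adj (\<gamma> t) ** V t)) (\<gamma> t) = 0" by blast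
    have g: "\<gamma> t \<in> SU5" using \<gamma> t by auto
    have "\<forall>\<^sub>F s in at t. s \<in> {0<..<1}"
      using t by (intro eventually_at_in_open') auto
    then have "\<forall>\<^sub>F s in at t. \<gamma> s \<in> SU5"
      by eventually_elim (use \<gamma> in auto)
    from SU5_curve_deriv[OF *(1) this g] have x: "adj (\<gamma> t) ** \<gamma>' \<in> su5" .
    have u: "adj (\<gamma> t) ** V t \<in> su5" using tan[of t] t tangent_iff[OF g] by auto
    have "\<gamma> t ** u' + \<gamma> t ** xi (obata_matrix (th (adj (\<gamma> t) ** \<gamma>')) *v th (adj (\<gamma> t) ** V t)) = 0"
      using *(3) connection_left_invariant[OF g, of "th (adj (\<gamma> t) ** \<gamma>')" "th (adj (\<gamma> t) ** V t)"]
      by (simp add: xi_th[OF x] xi_th[OF u])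
    then have "adj (\<gamma> t) ** (\<gamma> t ** (u' + xi (obata_matrix (th (adj (\<gamma> t) ** \<gamma>')) *v th (adj (\<gamma> t) ** V t)))) = 0"
      by (simp add: mmult.add_right)
    then have "u' = - xi (obata_matrix (th (adj (\<gamma> t) ** \<gamma>')) *v th (adj (\<gamma> t) ** V t))"
      by (simp add: SU5_simps[OF g] eq_neg_iff_add_eq_0)
    then have "th u' = - (obata_matrix (th (adj (\<gamma> t) ** \<gamma>')) *v th (adj (\<gamma> t) ** V t))"
      by (simp add: linear_neg[OF linear_th] th_xi)
    with bounded_linear.has_vector_derivative[OF bounded_linear_th *(2)] *(1) show ?thesis by auto
  qed
  moreover have "continuous_on {0..1} (\<lambda>t. th (adj (\<gamma> t) ** V t))"
    by (intro bounded_linear.continuous_on[OF bounded_linear_th] mmult.continuous_on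
        bounded_linear.continuous_on[OF bounded_linear_adj] cont contV)
  ultimately show ?thesis using S(1) unfolding transport_ode_def by blast
qed

lemma transport_ode_diff:
  assumes "transport_ode \<gamma> V" "transport_ode \<gamma> W"
  shows "transport_ode \<gamma> (\<lambda>t. V t - W t)"
proof -
  from assms obtain S T where S: "finite S" "\<And>t. t \<in> {0<..<1} - S \<Longrightarrow> \<exists>\<gamma>'.
     (\<gamma> has_vector_derivative \<gamma>') (at t) \<and>
     (V has_vector_derivative - (obata_matrix (th (adj (\<gamma> t) ** \<gamma>')) *v V t)) (at t)"
   and T: "finite T" "\<And>t. t \<in> {0<..<1} - T \<Longrightarrow> \<exists>\<gamma>'.
     (\<gamma> has_vector_derivative \<gamma>') (at t) \<and>
     (W has_vector_derivative - (obata_matrix (th (adj (\<gamma> t) ** \<gamma>')) *v W t)) (at t)"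
    unfolding transport_ode_def by blast
  have "\<exists>\<gamma>'. (\<gamma> has_vector_derivative \<gamma>') (at t) \<and>
     ((\<lambda>t. V t - W t) has_vector_derivative - (obata_matrix (th (adj (\<gamma> t) ** \<gamma>')) *v (V t - W t))) (at t)"
    if t: "t \<in> {0<..<1} - (S \<union> T)" for t
  proof -
    from S(2)[of t] t obtain \<gamma>' where 1: "(\<gamma> has_vector_derivative \<gamma>') (at t)"
     "(V has_vector_derivative - (obata_matrix (th (adj (\<gamma> t) ** \<gamma>')) *v V t)) (at t)" by blast
    from T(2)[of t] t obtain \<delta>' where 2: "(\<gamma> has_vector_derivative \<delta>') (at t)"
     "(W has_vector_derivative - (obata_matrix (th (adj (\<gamma> t) ** \<delta>')) *v W t)) (at t)" by blast
    have "\<delta>' = \<gamma>'" using 1(1) 2(1) vector_derivative_unique_at by blast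
    with has_vector_derivative_diff[OF 1(2) 2(2)] 1(1) show ?thesis
      by (auto simp: mvmult.diff_right)
  qed
  moreover have "continuous_on {0..1} (\<lambda>t. V t - W t)"
    using assms by (intro continuous_intros) (auto simp: transport_ode_def)
  ultimately show ?thesis unfolding transport_ode_def using S(1) T(1) by (meson finite_UnI)
qed

text \<open>Right scalars commute with the connection matrices, so they map solutions to solutions.
  This is why parallel transport is quaternionic.\<close>

lemma transport_ode_rmul:
  assumes "transport_ode \<gamma> W"
  shows "transport_ode \<gamma> (\<lambda>t. rmul (W t) p)"
proof -
  from assms obtain S where S: "finite S" "\<And>t. t \<in> {0<..<1} - S \<Longrightarrow> \<exists>\<gamma>'.
     (\<gamma> has_vector_derivative \<gamma>') (at t) \<and>
     (W has_vector_derivative - (obata_matrix (th (adj (\<gamma> t) ** \<gamma>')) *v W t)) (at t)"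
    unfolding transport_ode_def by blast
  have "\<exists>\<gamma>'. (\<gamma> has_vector_derivative \<gamma>') (at t) \<and>
     ((\<lambda>t. rmul (W t) p) has_vector_derivative - (obata_matrix (th (adj (\<gamma> t) ** \<gamma>')) *v rmul (W t) p)) (at t)"
    if t: "t \<in> {0<..<1} - S" for t
  proof -
    from S(2)[OF t] obtain \<gamma>' where 1: "(\<gamma> has_vector_derivative \<gamma>') (at t)"
     "(W has_vector_derivative - (obata_matrix (th (adj (\<gamma> t) ** \<gamma>')) *v W t)) (at t)" by blast
    from bounded_linear.has_vector_derivative[OF bounded_linear_rmul 1(2)] 1(1) show ?thesis
      by (auto simp: matrix_mult_rmul rmul_minus)
  qed
  moreover have "continuous_on {0..1} (\<lambda>t. rmul (W t) p)"
    using assms by (intro bounded_linear.continuous_on[OF bounded_linear_rmul]) (auto simp: transport_ode_def)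
  ultimately show ?thesis unfolding transport_ode_def using S(1) by blast
qed

text \<open>On a closed piece the path agrees with a map that is smooth on a neighbourhood, so the
  velocity extends continuously to the end points and is bounded. The bound supplies the constant
  for the Gronwall estimate.\<close>

lemma bounded_velocity:
  assumes h: "smooth_near {a..b} h" "\<And>t. t \<in> {a..b} \<Longrightarrow> \<gamma> t = h t"
  shows "\<exists>C. \<forall>t \<gamma>'. a < t \<longrightarrow> t < b \<longrightarrow> (\<gamma> has_vector_derivative \<gamma>') (at t) \<longrightarrow> norm (th (adj (\<gamma> t) ** \<gamma>')) \<le> C"
proof -
  from h(1) obtain U where U: "open U" "{a..b} \<subseteq> U" "\<And>k. Ck_on k h U"
    unfolding smooth_near_def by blast
  from U(3)[of "Suc 0"] obtain h' where h': "\<And>x. x \<in> U \<Longrightarrow> (h has_derivative h' x) (at x)"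
    "\<And>v. continuous_on U (\<lambda>x. h' x v)" by auto
  have "continuous_on U h"
    using h'(1) by (meson continuous_at_imp_continuous_on has_derivative_continuous)
  then have "continuous_on {a..b} (\<lambda>t. norm (th (adj (h t) ** h' t 1)))"
    by (intro continuous_intros bounded_linear.continuous_on[OF bounded_linear_th] mmult.continuous_on
        bounded_linear.continuous_on[OF bounded_linear_adj])
      (use U(2) h'(2) continuous_on_subset in blast)+
  then have "bounded ((\<lambda>t. norm (th (adj (h t) ** h' t 1))) ` {a..b})"
    by (intro compact_imp_bounded compact_continuous_image) auto
  then obtain C where C: "\<And>t. t \<in> {a..b} \<Longrightarrow> norm (th (adj (h t) ** h' t 1)) \<le> C"
    unfolding bounded_real by force
  have "norm (th (adj (\<gamma> t) ** \<gamma>')) \<le> C"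
    if t: "a < t" "t < b" and d: "(\<gamma> has_vector_derivative \<gamma>') (at t)" for t \<gamma>'
  proof -
    have d': "(h has_derivative h' t) (at t)" using h'(1)[of t] U(2) t by (simp add: subset_iff)
    have "(\<lambda>x. x *\<^sub>R h' t 1) = h' t"
    proof
      show "x *\<^sub>R h' t 1 = h' t x" for x
        using linear_scale[OF has_derivative_linear[OF d'], of x 1] by simp
    qed
    then have "(h has_vector_derivative h' t 1) (at t)"
      using d' by (simp add: has_vector_derivative_def)
    moreover have "(h has_vector_derivative \<gamma>') (at t)"
      using d by (rule has_vector_derivative_transform_within_open[where S = "{a<..<b}"]) (use t h(2) in auto)
    ultimately have "\<gamma>' = h' t 1" by (metis vector_derivative_unique_at)
    then show ?thesis using C[of t] h(2)[of t] t by simp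
  qed
  then show ?thesis by blast
qed

text \<open>Between exceptional parameters the Gronwall estimate applies, and continuity carries the
  zero value across them. By linearity this is uniqueness of parallel transport.\<close>

lemma transport_ode_zero:
  assumes ode: "transport_ode \<gamma> W" and \<gamma>: "piecewise_smooth_path \<gamma>" and "W 0 = 0"
  shows "W 1 = 0"
proof -
  from ode obtain S where S: "finite S" "\<And>t. t \<in> {0<..<1} - S \<Longrightarrow> \<exists>\<gamma>'.
     (\<gamma> has_vector_derivative \<gamma>') (at t) \<and>
     (W has_vector_derivative - (obata_matrix (th (adj (\<gamma> t) ** \<gamma>')) *v W t)) (at t)"
    and cont: "continuous_on {0..1} W"
    unfolding transport_ode_def by blast
  from \<gamma> obtain T where T: "finite T" "\<And>a b. 0 \<le> a \<Longrightarrow> a < b \<Longrightarrow> b \<le> 1 \<Longrightarrow> {a<..<b} \<inter> T = {} \<Longrightarrow>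
        \<exists>h. smooth_near {a..b} h \<and> (\<forall>t\<in>{a..b}. \<gamma> t = h t)"
    unfolding piecewise_smooth_path_def by blast
  have step: "W b = 0" if ab: "0 \<le> a" "a \<le> b" "b \<le> 1" and disj: "{a<..<b} \<inter> (S \<union> T) = {}" and Wa: "W a = 0" for a b
  proof (cases "a = b")
    case True
    then show ?thesis using Wa by simp
  next
    case False
    then have "a < b" using ab by simp
    then obtain h where h: "smooth_near {a..b} h" "\<And>t. t \<in> {a..b} \<Longrightarrow> \<gamma> t = h t"
      using T(2)[of a b] ab disj by blast
    obtain C where C: "\<And>t \<gamma>'. a < t \<Longrightarrow> t < b \<Longrightarrow> (\<gamma> has_vector_derivative \<gamma>') (at t) \<Longrightarrow>
        norm (th (adj (\<gamma> t) ** \<gamma>')) \<le> C"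
      using bounded_velocity[of a b h \<gamma>, OF h] by blast
    have "bounded_bilinear (\<lambda>x v. obata_matrix x *v v)"
      using linear_obata_matrix
      by (intro bounded_bilinear.comp[OF bounded_bilinear_matrix_vector_mult _ bounded_linear_ident])
        (simp add: linear_conv_bounded_linear)
    then obtain B where B: "B > 0" "\<And>x v. norm (obata_matrix x *v v) \<le> norm x * norm v * B"
      using bounded_bilinear.pos_bounded by blast
    show ?thesis
    proof (rule gronwall_zero[of a b W "C * B"])
      show "continuous_on {a..b} W" using cont by (rule continuous_on_subset) (use ab in auto)
      fix t assume t: "a < t" "t < b"
      then have "t \<in> {0<..<1} - S" using ab disj by auto
      from S(2)[OF this] obtain \<gamma>' where *: "(\<gamma> has_vector_derivative \<gamma>') (at t)"
        "(W has_vector_derivative - (obata_matrix (th (adj (\<gamma> t) ** \<gamma>')) *v W t)) (at t)" by blast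
      have "norm (obata_matrix (th (adj (\<gamma> t) ** \<gamma>')) *v W t) \<le> norm (th (adj (\<gamma> t) ** \<gamma>')) * norm (W t) * B"
        by (rule B)
      also have "\<dots> \<le> C * norm (W t) * B"
        using C[OF t *(1)] B(1) by (intro mult_right_mono) auto
      finally show "\<exists>z'. (W has_vector_derivative z') (at t) \<and> norm z' \<le> C * B * norm (W t)"
        by (intro exI[of _ "- (obata_matrix (th (adj (\<gamma> t) ** \<gamma>')) *v W t)"] conjI *(2))
          (simp add: mult_ac)
    qed (use ab Wa in auto)
  qed
  have "(0::real) \<le> 1" by simp
  \<comment> \<open>The implication from \<open>W a = 0\<close> to \<open>W b = 0\<close> is
    transitive over adjacent intervals, so it suffices to prove it on short intervals around each
    point, where only that point can be exceptional.\<close>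
  then have "0 \<le> (0::real) \<and> (1::real) \<le> 1 \<longrightarrow> W 0 = 0 \<longrightarrow> W 1 = 0"
  proof (rule Bolzano[where P = "\<lambda>a b. 0 \<le> a \<and> b \<le> 1 \<longrightarrow> W a = 0 \<longrightarrow> W b = 0"])
    fix x :: real assume x: "0 \<le> x" "x \<le> 1"
    have "finite (S \<union> T)" using S(1) T(1) by simp
    then obtain d where d: "d > 0" "\<And>y. y \<in> S \<union> T \<Longrightarrow> y \<noteq> x \<Longrightarrow> d \<le> dist x y"
      using finite_set_avoid[of "S \<union> T" x] by blast
    have "W b = 0" if "a \<le> x" "x \<le> b" "b - a < d" "0 \<le> a" "b \<le> 1" "W a = 0" for a b
    proof -
      have "{a<..<x} \<inter> (S \<union> T) = {}" "{x<..<b} \<inter> (S \<union> T) = {}"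
        using d(2) that by (force simp: dist_real_def)+
      then show ?thesis using step[of a x] step[of x b] that x by auto
    qed
    then show "\<exists>d>0. \<forall>a b. a \<le> x \<and> x \<le> b \<and> b - a < d \<longrightarrow> 0 \<le> a \<and> b \<le> 1 \<longrightarrow> W a = 0 \<longrightarrow> W b = 0"
      using d(1) by blast
  qed auto
  then show ?thesis using \<open>W 0 = 0\<close> by simp
qed

end

lemma expm_minus: "expm t (- X) = expm (- t) X"
proof -
  have "((\<lambda>t. expm t (- X) ** expm t X) has_vector_derivative 0) (at t)" for t
    using mmult.has_vector_derivative[OF expm_deriv'[of "- X" t] expm_deriv[of X t]]
    by (simp add: mmult.minus_left mmult.minus_right matrix_mul_assoc)
  then have "expm t (- X) ** expm t X = expm 0 (- X) ** expm 0 X"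
    by (rule vector_derivative_0_imp_const)
  then have "expm t (- X) ** (expm t X ** expm (- t) X) = expm (- t) X"
    by (simp add: matrix_mul_assoc)
  then show ?thesis by (simp add: expm_inverse)
qed

lemma adj_expm: "x \<in> su5 \<Longrightarrow> adj (expm t x) = expm (- t) x"
proof -
  assume "x \<in> su5"
  then have "adj (expm t x) ** expm t x = mat 1" by (intro SU5_D expm_SU5)
  then have "adj (expm t x) ** (expm t x ** expm (- t) x) = expm (- t) x"
    by (simp add: matrix_mul_assoc)
  then show ?thesis by (simp add: expm_inverse)
qed

section \<open>The tangent Lie algebra of a matrix group\<close>

text \<open>A subspace is closed, so it contains the limits of difference quotients. The proof pairs
  with the orthogonal complement instead, where the curve becomes the constant 0.\<close>

lemma subspace_vector_derivative:
  fixes f :: "real \<Rightarrow> 'b::euclidean_space"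
  assumes L: "subspace L" and f: "\<And>s. f s \<in> L" and d: "(f has_vector_derivative X) (at t)"
  shows "X \<in> L"
proof -
  have "v \<bullet> X = 0" if v: "v \<in> L\<^sup>\<bottom>" for v
  proof -
    have "v \<bullet> f s = 0" for s
      using v f[of s] by (auto simp: orthogonal_comp_def orthogonal_def inner_commute)
    with bounded_linear.has_vector_derivative[OF bounded_linear_inner_right d, of v]
    have "((\<lambda>s. 0) has_vector_derivative v \<bullet> X) (at t)" by simp
    then show ?thesis using vector_derivative_unique_at has_vector_derivative_const by blast
  qed
  then have "X \<in> L\<^sup>\<bottom>\<^sup>\<bottom>"
    by (auto simp: orthogonal_comp_def orthogonal_def)
  then show ?thesis by (simp add: orthogonal_comp_self[OF L])
qed

text \<open>Carrying along the inverse curve \<open>d\<close> avoids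
  differentiating the matrix inverse.\<close>

definition velocities :: "('a::{euclidean_space,real_algebra_1}^'n^'n) set \<Rightarrow> ('a^'n^'n) set" where
  "velocities H = {X. \<exists>c d. (\<forall>t. c t \<in> H \<and> d t \<in> H \<and> c t ** d t = mat 1 \<and> d t ** c t = mat 1) \<and>
     continuous_on UNIV c \<and> continuous_on UNIV d \<and> c 0 = mat 1 \<and> d 0 = mat 1 \<and>
     (c has_vector_derivative X) (at (0::real)) \<and> (d has_vector_derivative - X) (at 0)}"

lemma velocitiesI:
  assumes "\<And>t. c t \<in> H" "\<And>t. d t \<in> H" "\<And>t. c t ** d t = mat 1" "\<And>t. d t ** c t = mat 1"
    "continuous_on UNIV c" "continuous_on UNIV d" "c 0 = mat 1" "d 0 = mat 1"
    "(c has_vector_derivative X) (at (0::real))" "(d has_vector_derivative - X) (at 0)"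
  shows "X \<in> velocities H"
  unfolding velocities_def using assms by blast

lemma velocitiesE:
  assumes "X \<in> velocities H"
  obtains c d where "\<And>t. c t \<in> H" "\<And>t. d t \<in> H" "\<And>t. c t ** d t = mat 1" "\<And>t. d t ** c t = mat 1"
    "continuous_on UNIV c" "continuous_on UNIV d" "c 0 = mat 1" "d 0 = mat 1"
    "(c has_vector_derivative X) (at (0::real))" "(d has_vector_derivative - X) (at 0)"
  using assms unfolding velocities_def by blast

lemma velocities_conj:
  assumes X: "X \<in> velocities H" and A: "A ** B = mat 1" "B ** A = mat 1"
    and H: "\<And>Y. Y \<in> H \<Longrightarrow> A ** Y ** B \<in> H"
  shows "A ** X ** B \<in> velocities H"
proof -
  from X obtain c d where c: "\<And>t. c t \<in> H" "\<And>t. d t \<in> H" "\<And>t. c t ** d t = mat 1" "\<And>t. d t ** c t = mat 1"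
    "continuous_on UNIV c" "continuous_on UNIV d" "c 0 = mat 1" "d 0 = mat 1"
    "(c has_vector_derivative X) (at (0::real))" "(d has_vector_derivative - X) (at 0)"
    by (rule velocitiesE) blast
  have e: "A ** Y ** B ** (A ** Z ** B) = A ** (Y ** Z) ** B" for Y Z
  proof -
    have "A ** Y ** B ** (A ** Z ** B) = A ** Y ** (B ** A) ** Z ** B" by (simp only: matrix_mul_assoc)
    then show ?thesis by (simp add: A matrix_mul_assoc)
  qed
  show ?thesis
  proof (rule velocitiesI[of "\<lambda>t. A ** c t ** B" _ "\<lambda>t. A ** d t ** B"])
    show "((\<lambda>t. A ** c t ** B) has_vector_derivative A ** X ** B) (at 0)"
      by (intro matrix_mult_derivs c)
    have "((\<lambda>t. A ** d t ** B) has_vector_derivative A ** (- X) ** B) (at 0)"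
      by (intro matrix_mult_derivs c)
    then show "((\<lambda>t. A ** d t ** B) has_vector_derivative - (A ** X ** B)) (at 0)"
      by (simp add: mmult.minus_left mmult.minus_right)
    show "continuous_on UNIV (\<lambda>t. A ** c t ** B)" "continuous_on UNIV (\<lambda>t. A ** d t ** B)"
      by (intro mmult.continuous_on continuous_on_const c)+
  qed (simp_all add: H c e A)
qed

context
  fixes H :: "('a::{euclidean_space,real_algebra_1}^'n^'n) set"
  assumes one: "mat 1 \<in> H" and mult: "\<And>X Y. X \<in> H \<Longrightarrow> Y \<in> H \<Longrightarrow> X ** Y \<in> H"
begin

text \<open>Sums come from pointwise products of curves, with the inverse curves multiplied in
  reverse order, and multiples from a change of speed.\<close>

lemma subspace_velocities: "subspace (velocities H)"
  unfolding subspace_def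
proof (intro conjI ballI allI)
  show "0 \<in> velocities H"
    by (rule velocitiesI[of "\<lambda>_. mat 1" _ "\<lambda>_. mat 1"]) (simp_all add: one)
next
  fix X Y assume X: "X \<in> velocities H" and Y: "Y \<in> velocities H"
  from X obtain c d where c: "\<And>t. c t \<in> H" "\<And>t. d t \<in> H" "\<And>t. c t ** d t = mat 1" "\<And>t. d t ** c t = mat 1"
    "continuous_on UNIV c" "continuous_on UNIV d" "c 0 = mat 1" "d 0 = mat 1"
    "(c has_vector_derivative X) (at (0::real))" "(d has_vector_derivative - X) (at 0)"
    by (rule velocitiesE) blast
  from Y obtain c' d' where c': "\<And>t. c' t \<in> H" "\<And>t. d' t \<in> H" "\<And>t. c' t ** d' t = mat 1" "\<And>t. d' t ** c' t = mat 1"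
    "continuous_on UNIV c'" "continuous_on UNIV d'" "c' 0 = mat 1" "d' 0 = mat 1"
    "(c' has_vector_derivative Y) (at (0::real))" "(d' has_vector_derivative - Y) (at 0)"
    by (rule velocitiesE) blast
  show "X + Y \<in> velocities H"
  proof (rule velocitiesI[of "\<lambda>t. c t ** c' t" _ "\<lambda>t. d' t ** d t"])
    fix t
    have "c t ** c' t ** (d' t ** d t) = c t ** (c' t ** d' t) ** d t" by (simp only: matrix_mul_assoc)
    then show "c t ** c' t ** (d' t ** d t) = mat 1" by (simp add: c c')
    have "d' t ** d t ** (c t ** c' t) = d' t ** (d t ** c t) ** c' t" by (simp only: matrix_mul_assoc)
    then show "d' t ** d t ** (c t ** c' t) = mat 1" by (simp add: c c')
  next
    show "((\<lambda>t. c t ** c' t) has_vector_derivative X + Y) (at 0)"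
      using mmult.has_vector_derivative[OF c(9) c'(9)] by (simp add: c c' add.commute)
    show "((\<lambda>t. d' t ** d t) has_vector_derivative - (X + Y)) (at 0)"
      using mmult.has_vector_derivative[OF c'(10) c(10)] by (simp add: c c' add.commute)
    show "continuous_on UNIV (\<lambda>t. c t ** c' t)" "continuous_on UNIV (\<lambda>t. d' t ** d t)"
      by (intro mmult.continuous_on c c')+
  qed (simp_all add: mult c c')
next
  fix r :: real and X assume "X \<in> velocities H"
  then obtain c d where c: "\<And>t. c t \<in> H" "\<And>t. d t \<in> H" "\<And>t. c t ** d t = mat 1" "\<And>t. d t ** c t = mat 1"
    "continuous_on UNIV c" "continuous_on UNIV d" "c 0 = mat 1" "d 0 = mat 1"
    "(c has_vector_derivative X) (at (0::real))" "(d has_vector_derivative - X) (at 0)"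
    by (rule velocitiesE) blast
  have s: "((\<lambda>t. r * t) has_vector_derivative r) (at 0)"
    using has_vector_derivative_mult_right[OF has_vector_derivative_id, of r "at 0"] by simp
  have "(c has_vector_derivative X) (at (r * 0))" "(d has_vector_derivative - X) (at (r * 0))"
    using c by simp_all
  note vector_diff_chain_at[OF s this(1)] vector_diff_chain_at[OF s this(2)]
  moreover have "continuous_on UNIV (\<lambda>t. c (r * t))" "continuous_on UNIV (\<lambda>t. d (r * t))"
    by (intro continuous_on_compose2[OF c(5)] continuous_on_compose2[OF c(6)] continuous_intros; simp)+
  ultimately show "r *\<^sub>R X \<in> velocities H"
    by (intro velocitiesI[of "\<lambda>t. c (r * t)" _ "\<lambda>t. d (r * t)"]) (simp_all add: c o_def)
qed

text \<open>The bracket is the derivative at 0 of the conjugates of \<open>Y\<close> along a curve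
  with velocity \<open>X\<close>, and this curve of conjugates stays in the subspace of
  velocities.\<close>

lemma velocities_bracket:
  assumes "X \<in> velocities H" "Y \<in> velocities H"
  shows "X ** Y - Y ** X \<in> velocities H"
proof -
  from assms(1) obtain c d where c: "\<And>t. c t \<in> H" "\<And>t. d t \<in> H" "\<And>t. c t ** d t = mat 1" "\<And>t. d t ** c t = mat 1"
    "continuous_on UNIV c" "continuous_on UNIV d" "c 0 = mat 1" "d 0 = mat 1"
    "(c has_vector_derivative X) (at (0::real))" "(d has_vector_derivative - X) (at 0)"
    by (rule velocitiesE) blast
  show ?thesis
  proof (rule subspace_vector_derivative[OF subspace_velocities])
    show "c s ** Y ** d s \<in> velocities H" for s
      by (rule velocities_conj[OF assms(2)]) (simp_all add: c mult)
    show "((\<lambda>s. c s ** Y ** d s) has_vector_derivative X ** Y - Y ** X) (at 0)"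
      using mmult.has_vector_derivative[OF matrix_mult_derivs(1)[OF c(9)] c(10), of Y]
      by (simp add: c mmult.minus_right)
  qed
qed

text \<open>Multiplying curves in all coordinate directions gives a continuous map into
  \<open>H\<close> whose derivative at 0 is the identity. It is known to be differentiable only at
  0, so the classical inverse function theorem does not apply; Sussmann's open mapping theorem asks
  for no more than this.\<close>

lemma mat1_in_interior:
  assumes "velocities H = UNIV"
  shows "mat 1 \<in> interior H"
proof -
  have "\<forall>b. \<exists>c. (\<forall>t. c t \<in> H) \<and> continuous_on UNIV c \<and> c 0 = mat 1 \<and> (c has_vector_derivative b) (at (0::real))"
  proof
    fix b
    have "b \<in> velocities H" using assms by simp
    then show "\<exists>c. (\<forall>t. c t \<in> H) \<and> continuous_on UNIV c \<and> c 0 = mat 1 \<and> (c has_vector_derivative b) (at (0::real))"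
      by (rule velocitiesE) blast
  qed
  then obtain c where c: "\<And>b t. c b t \<in> H" "\<And>b. continuous_on UNIV (c b)" "\<And>b. c b 0 = mat 1"
    "\<And>b. (c b has_vector_derivative b) (at (0::real))"
    by metis
  define f where "f l M = foldr (\<lambda>b acc. c b (M \<bullet> b) ** acc) l (mat 1)" for l M
  have fH: "f l M \<in> H" for l M
    by (induction l) (simp_all add: f_def one mult c)
  have f0: "f l 0 = mat 1" for l
    by (induction l) (simp_all add: f_def c)
  have fc: "continuous_on UNIV (f l)" for l
  proof (induction l)
    case (Cons b l)
    have "continuous_on UNIV (\<lambda>M. c b (M \<bullet> b) ** f l M)"
      by (intro mmult.continuous_on Cons.IH continuous_on_compose2[OF c(2)] continuous_intros) simp
    then show ?case by (simp add: f_def)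
  qed (simp add: f_def)
  have fd: "(f l has_derivative (\<lambda>M. \<Sum>b\<leftarrow>l. (M \<bullet> b) *\<^sub>R b)) (at 0)" for l
  proof (induction l)
    case (Cons b l)
    have "(c b has_derivative (\<lambda>x. x *\<^sub>R b)) (at (0 \<bullet> b))"
      using c(4)[of b] by (simp add: has_vector_derivative_def)
    with has_derivative_compose[of "\<lambda>M. M \<bullet> b" "\<lambda>M. M \<bullet> b" 0 UNIV "c b" "\<lambda>x. x *\<^sub>R b"]
    have "((\<lambda>M. c b (M \<bullet> b)) has_derivative (\<lambda>M. (M \<bullet> b) *\<^sub>R b)) (at 0)"
      by (simp add: bounded_linear_imp_has_derivative bounded_linear_inner_left)
    from mmult.FDERIV[OF this Cons.IH]
    have "((\<lambda>M. c b (M \<bullet> b) ** f l M) has_derivative (\<lambda>M. \<Sum>b\<leftarrow>b # l. (M \<bullet> b) *\<^sub>R b)) (at 0)"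
      by (simp add: c f0 add.commute)
    then show ?case by (simp add: f_def)
  qed (simp add: f_def)
  obtain l :: "('a^'n^'n) list" where l: "set l = Basis" "distinct l"
    using finite_distinct_list[OF finite_Basis] by blast
  have "(\<lambda>M. \<Sum>b\<leftarrow>l. (M \<bullet> b) *\<^sub>R b) \<circ> (\<lambda>M. M) = id"
    using l by (auto simp: sum_list_distinct_conv_sum_set euclidean_representation)
  then have "f l 0 \<in> interior (range (f l))"
    by (rule sussmann_open_mapping[OF open_UNIV fc UNIV_I fd bounded_linear_ident]) simp_all
  moreover have "range (f l) \<subseteq> H" using fH by blast
  ultimately show ?thesis using interior_mono f0 by (metis subsetD)
qed

end

context su5_obata
begin

text \<open>\<open>reach g M\<close>: a broken one-parameter path from \<open>mat 1\<close> to \<open>g\<close> has parallel transport \<open>M\<close>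
  in the left-invariant frame.\<close>

inductive reach :: "cmat5 \<Rightarrow> quat^6^6 \<Rightarrow> bool" where
  reach_start: "reach (mat 1) (mat 1)"
| reach_step: "reach g M \<Longrightarrow> reach (g ** expm t (xi x)) (expm (- t) (obata_matrix x) ** M)"

lemma reach_SU5: "reach g M \<Longrightarrow> g \<in> SU5"
  by (induction rule: reach.induct) (auto intro!: SU5_mult expm_SU5 xi_su5)

text \<open>Follow the path to \<open>g\<close> and then the left translate by \<open>g\<close> of
  the path to \<open>h\<close>. In the left-invariant frame the translated leg has the same
  transport \<open>N\<close>, composed after \<open>M\<close>.\<close>

lemma reach_mult: "reach h N \<Longrightarrow> reach g M \<Longrightarrow> reach (g ** h) (N ** M)"
proof (induction rule: reach.induct)
  case (reach_step h N t x)
  from reach.reach_step[OF reach_step.IH[OF reach_step.prems], of t x]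
  show ?case by (simp only: matrix_mul_assoc)
qed simp

lemma reach_expm: "reach (expm t (xi x)) (expm (- t) (obata_matrix x))"
  using reach_step[OF reach_start, of t x] by simp

lemma reach_inverse:
  assumes "reach g M"
  shows "\<exists>N. reach (adj g) N \<and> N ** M = mat 1 \<and> M ** N = mat 1"
  using assms
proof (induction rule: reach.induct)
  case reach_start
  then show ?case by (intro exI[of _ "mat 1"]) (simp add: reach.reach_start)
next
  case (reach_step g M t x)
  then obtain N where N: "reach (adj g) N" "N ** M = mat 1" "M ** N = mat 1" by blast
  have "reach (adj (g ** expm t (xi x))) (N ** expm t (obata_matrix x))"
    using reach_mult[OF N(1) reach_expm[of "- t" x]] by (simp add: adj_mult adj_expm xi_su5)
  moreover have "N ** expm t (obata_matrix x) ** (expm (- t) (obata_matrix x) ** M)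
      = N ** (expm t (obata_matrix x) ** expm (- t) (obata_matrix x)) ** M"
    "expm (- t) (obata_matrix x) ** M ** (N ** expm t (obata_matrix x))
      = expm (- t) (obata_matrix x) ** (M ** N) ** expm t (obata_matrix x)"
    by (simp_all only: matrix_mul_assoc)
  ultimately show ?case using N by (intro exI conjI) (auto simp: expm_inverse)
qed

abbreviation loops :: "(quat^6^6) set" where "loops \<equiv> {M. reach (mat 1) M}"

lemma loops_group: "mat 1 \<in> loops" "X \<in> loops \<Longrightarrow> Y \<in> loops \<Longrightarrow> X ** Y \<in> loops"
  "X \<in> loops \<Longrightarrow> \<exists>Y\<in>loops. X ** Y = mat 1 \<and> Y ** X = mat 1"
  using reach_start reach_mult[of "mat 1" X "mat 1" Y] reach_inverse[of "mat 1" X] by auto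

lemma loops_conj:
  assumes "M \<in> loops"
  shows "expm s (obata_matrix x) ** M ** expm (- s) (obata_matrix x) \<in> loops"
  using reach_mult[OF reach_expm[of "- s" x] reach_mult[OF _ reach_expm[of s x], of "mat 1" M]] assms
  by (simp add: matrix_mul_assoc expm_inverse)

text \<open>The loop $e^{sx} e^{ty} e^{-sx} e^{-ty'}$ with $y' = \mathrm{Ad}(e^{sx}) y$ is closed for all \<open>s, t\<close>.\<close>

lemma curvature_velocity: "curvature x y \<in> velocities loops"
proof -
  note sub = subspace_velocities[OF loops_group(1,2)]
  let ?B = obata_matrix
  define y' where "y' s = th (expm s (xi x) ** xi y ** expm (- s) (xi x))" for s
  have xi_y': "xi (y' s) = expm s (xi x) ** xi y ** expm (- s) (xi x)" for s
    unfolding y'_def using su5_conj[OF expm_SU5[OF xi_su5, of s x] xi_su5[of y]]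
    by (intro xi_th) (simp add: adj_expm xi_su5)
  define c where "c s t = expm t (?B (y' s)) ** expm s (?B x) ** expm (- t) (?B y) ** expm (- s) (?B x)" for s t
  define d where "d s t = expm s (?B x) ** expm t (?B y) ** expm (- s) (?B x) ** expm (- t) (?B (y' s))" for s t
  \<comment> \<open>For fixed \<open>s\<close> this is the velocity at t = 0 of the family of loops
    \<open>c s\<close>; it vanishes at s = 0.\<close>
  define f where "f s = ?B (y' s) - expm s (?B x) ** ?B y ** expm (- s) (?B x)" for s
  have cd: "c s t ** d s t = mat 1" "d s t ** c s t = mat 1" for s t
    unfolding c_def d_def matrix_mul_assoc
    by (simp_all add: expm_inverse flip: matrix_mul_assoc)
  have cH: "c s t \<in> loops" for s t
  proof -
    have "reach (expm s (xi x) ** expm t (xi y) ** expm (- s) (xi x) ** expm (- t) (xi (y' s)))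
      (expm t (?B (y' s)) ** (expm s (?B x) ** (expm (- t) (?B y) ** expm (- s) (?B x))))"
      using reach_step[OF reach_step[OF reach_step[OF reach_expm[of s x], of t y], of "- s" x], of "- t" "y' s"]
      by simp
    moreover have "expm (- t) (xi (y' s)) = expm s (xi x) ** expm (- t) (xi y) ** expm (- s) (xi x)"
      unfolding xi_y' by (rule expm_conj) (simp_all add: expm_inverse)
    moreover have "expm s (xi x) ** expm t (xi y) ** expm (- s) (xi x) ** (expm s (xi x) ** expm (- t) (xi y) ** expm (- s) (xi x))
      = expm s (xi x) ** (expm t (xi y) ** ((expm (- s) (xi x) ** expm s (xi x)) ** expm (- t) (xi y))) ** expm (- s) (xi x)"
      by (simp only: matrix_mul_assoc)
    ultimately show ?thesis by (simp add: c_def expm_inverse matrix_mul_assoc)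
  qed
  have dH: "d s t \<in> loops" for s t
  proof -
    from loops_group(3)[OF cH[of s t]] obtain Y where Y: "Y \<in> loops" "c s t ** Y = mat 1" by blast
    have "d s t = d s t ** (c s t ** Y)" by (simp add: Y)
    also have "\<dots> = Y" by (simp add: matrix_mul_assoc cd)
    finally show ?thesis using Y by simp
  qed
  have e: "((\<lambda>t. expm (- t) X) has_vector_derivative - X) (at 0)" for X :: "'q::{euclidean_space,real_algebra_1}^'m^'m"
    using expm_deriv[of "- X" 0] by (simp add: expm_minus)
  have e': "((\<lambda>t. expm t X) has_vector_derivative X) (at 0)" for X :: "'q::{euclidean_space,real_algebra_1}^'m^'m"
    using expm_deriv[of X 0] by simp
  have ec: "continuous_on UNIV (\<lambda>t. expm (- t) X)" for X :: "quat^6^6"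
    using continuous_on_expm[of UNIV "- X"] by (simp add: expm_minus)
  have "f s \<in> velocities loops" for s
  proof (rule velocitiesI[of "c s" _ "d s"])
    show "continuous_on UNIV (c s)" "continuous_on UNIV (d s)"
      unfolding c_def d_def by (intro mmult.continuous_on continuous_on_const ec continuous_on_expm)+
    show "c s 0 = mat 1" "d s 0 = mat 1"
      by (simp_all add: c_def d_def expm_inverse)
    have "((\<lambda>t. expm t (?B (y' s)) ** (expm s (?B x) ** expm (- t) (?B y) ** expm (- s) (?B x))) has_vector_derivative
      expm 0 (?B (y' s)) ** (expm s (?B x) ** (- ?B y) ** expm (- s) (?B x))
       + ?B (y' s) ** (expm s (?B x) ** expm (- 0) (?B y) ** expm (- s) (?B x))) (at 0)"
      by (intro mmult.has_vector_derivative matrix_mult_derivs e e')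
    then show "(c s has_vector_derivative f s) (at 0)"
      unfolding c_def f_def by (simp add: matrix_mul_assoc expm_inverse mmult.minus_left mmult.minus_right)
    have "((\<lambda>t. (expm s (?B x) ** expm t (?B y) ** expm (- s) (?B x)) ** expm (- t) (?B (y' s))) has_vector_derivative
      (expm s (?B x) ** expm 0 (?B y) ** expm (- s) (?B x)) ** (- ?B (y' s))
       + (expm s (?B x) ** ?B y ** expm (- s) (?B x)) ** expm (- 0) (?B (y' s))) (at 0)"
      by (intro mmult.has_vector_derivative matrix_mult_derivs e e')
    then show "(d s has_vector_derivative - f s) (at 0)"
      unfolding d_def f_def by (simp add: expm_inverse mmult.minus_left mmult.minus_right)
  qed (use cd cH dH in auto)
  \<comment> \<open>Differentiating in \<open>s\<close> sends the first term to nabla_[x,y] and the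
    second to [nabla_x, nabla_y], so minus the curvature appears as the derivative of a curve of
    velocities.\<close>
  moreover have "(f has_vector_derivative - curvature x y) (at 0)"
  proof -
    have "((\<lambda>s. expm s (xi x) ** xi y ** expm (- s) (xi x)) has_vector_derivative bracket (xi x) (xi y)) (at 0)"
      using mmult.has_vector_derivative[OF matrix_mult_derivs(1)[OF e'] e, of "xi x" "xi y" "xi x"]
      by (simp add: bracket_def mmult.minus_right)
    from bounded_linear.has_vector_derivative[OF bounded_linear_th this]
    have "(y' has_vector_derivative (?B x *v y - ?B y *v x)) (at 0)"
      by (simp add: y'_def[abs_def] bracket_xi th_xi)
    from bounded_linear.has_vector_derivative[OF linear_conv_bounded_linear[THEN iffD1, OF linear_obata_matrix] this]
    have 1: "((\<lambda>s. ?B (y' s)) has_vector_derivative ?B (?B x *v y - ?B y *v x)) (at 0)" .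
    have 2: "((\<lambda>s. expm s (?B x) ** ?B y ** expm (- s) (?B x)) has_vector_derivative (?B x ** ?B y - ?B y ** ?B x)) (at 0)"
      using mmult.has_vector_derivative[OF matrix_mult_derivs(1)[OF e'] e, of "?B x" "?B y" "?B x"]
      by (simp add: mmult.minus_right)
    from has_vector_derivative_diff[OF 1 2] show ?thesis
      by (simp add: f_def[abs_def] curvature_def)
  qed
  ultimately have "- curvature x y \<in> velocities loops"
    using subspace_vector_derivative[OF sub, of f] by blast
  from subspace_neg[OF sub this] show ?thesis by simp
qed

text \<open>Going out along exp(sx), around a loop and back conjugates the transport of the loop;
  the derivative at s = 0 gives stability under [nabla_x, -]. The connection matrix itself need not
  be a velocity, since exp(sx) is not closed in general.\<close>

lemma velocities_loops: "velocities loops = UNIV"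
proof -
  note sub = subspace_velocities[OF loops_group(1,2)]
  have "obata_matrix x ** X - X ** obata_matrix x \<in> velocities loops" if X: "X \<in> velocities loops" for x X
  proof (rule subspace_vector_derivative[OF sub])
    let ?B = "obata_matrix x"
    show "expm s ?B ** X ** expm (- s) ?B \<in> velocities loops" for s
      by (rule velocities_conj[OF X]) (simp_all add: expm_inverse loops_conj[simplified])
    have "((\<lambda>s. expm s ?B ** X ** expm s (- ?B)) has_vector_derivative
       expm 0 ?B ** X ** (- ?B ** expm 0 (- ?B)) + (?B ** expm 0 ?B) ** X ** expm 0 (- ?B)) (at 0)"
      by (intro mmult.has_vector_derivative matrix_mult_derivs expm_deriv)
    then show "((\<lambda>s. expm s ?B ** X ** expm (- s) ?B) has_vector_derivative ?B ** X - X ** ?B) (at 0)"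
      by (simp add: expm_minus mmult.minus_right)
  qed
  then show ?thesis
    using curvature_generates[OF sub velocities_bracket[OF loops_group(1,2)] _ curvature_velocity] by blast
qed

end

section \<open>Realizing transports by smooth paths\<close>

lemma Ck_on_scale:
  fixes h :: "real \<Rightarrow> 'b::real_normed_vector"
  assumes "Ck_on k h U"
  shows "Ck_on k (\<lambda>s. h (c * s)) ((\<lambda>s. c * s) -` U)"
  using assms
proof (induction k arbitrary: h)
  case 0
  have "continuous_on ((\<lambda>s. c * s) -` U) (\<lambda>s. h (c * s))"
    by (rule continuous_on_compose2[of U h]) (use 0 in \<open>auto intro!: continuous_intros\<close>)
  then show ?case by simp
next
  case (Suc k)
  then obtain h' where h': "\<And>x. x \<in> U \<Longrightarrow> (h has_derivative h' x) (at x)"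
    "\<And>v. Ck_on k (\<lambda>x. h' x v) U" by auto
  have "((\<lambda>s. h (c * s)) has_derivative (\<lambda>v. h' (c * x) (c * v))) (at x)" if "c * x \<in> U" for x
    by (rule has_derivative_compose[where g = h and f = "\<lambda>s. c * s" and f' = "\<lambda>s. c * s"])
      (auto intro!: derivative_eq_intros h' that)
  moreover have "Ck_on k (\<lambda>x. h' (c * x) (c * v)) ((\<lambda>s. c * s) -` U)" for v
    by (rule Suc.IH[of "\<lambda>x. h' x (c * v)"]) (rule h'(2))
  ultimately show ?case
    unfolding Ck_on.simps by (intro exI[of _ "\<lambda>x v. h' (c * x) (c * v)"]) auto
qed

lemma smooth_near_scale:
  fixes h :: "real \<Rightarrow> 'b::real_normed_vector"
  assumes "smooth_near S h" "\<And>s. s \<in> T \<Longrightarrow> c * s \<in> S"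
  shows "smooth_near T (\<lambda>s. h (c * s))"
proof -
  from assms(1) obtain U where U: "open U" "S \<subseteq> U" "\<And>k. Ck_on k h U"
    unfolding smooth_near_def by blast
  have "open ((\<lambda>s. c * s) -` U)" by (intro open_vimage U continuous_intros)
  then show ?thesis unfolding smooth_near_def
    using U(2) assms(2) Ck_on_scale[OF U(3), of _ c] by (intro exI[of _ "(\<lambda>s. c * s) -` U"]) auto
qed

lemma affine_expm_deriv:
  "((\<lambda>s. A ** expm (a * s + b) X ** C) has_vector_derivative A ** expm (a * s + b) X ** (a *\<^sub>R (X ** C))) (at s)"
proof -
  have "((\<lambda>s. a * s + b) has_vector_derivative a) (at s)"
    by (auto intro!: derivative_eq_intros simp: has_real_derivative_iff_has_vector_derivative[symmetric])
  from vector_diff_chain_at[OF this expm_deriv']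
  have "((\<lambda>s. expm (a * s + b) X) has_vector_derivative a *\<^sub>R (expm (a * s + b) X ** X)) (at s)"
    by (simp add: o_def)
  from matrix_mult_derivs(1)[OF matrix_mult_derivs(2)[OF this]] show ?thesis
    by (simp add: mmult.scaleR_left mmult.scaleR_right matrix_mul_assoc)
qed

text \<open>Differentiation changes only the right factor \<open>C\<close>, so the family of all
  such curves is closed under it and the induction runs over arbitrary \<open>C\<close>.\<close>

lemma Ck_on_affine_expm: "Ck_on k (\<lambda>s. A ** expm (a * s + b) X ** C) U"
proof (induction k arbitrary: C)
  case 0
  have "continuous_on U (\<lambda>s. A ** expm (a * s + b) X ** C)"
    by (intro continuous_at_imp_continuous_on ballI has_vector_derivative_continuous[OF affine_expm_deriv])
  then show ?case by simp
next
  case (Suc k)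
  have *: "(\<lambda>s. v *\<^sub>R (A ** expm (a * s + b) X ** (a *\<^sub>R (X ** C))))
     = (\<lambda>s. A ** expm (a * s + b) X ** (v *\<^sub>R a *\<^sub>R (X ** C)))" for v
    by (simp add: mmult.scaleR_right)
  show ?case unfolding Ck_on.simps
    by (intro exI[of _ "\<lambda>s v. v *\<^sub>R (A ** expm (a * s + b) X ** (a *\<^sub>R (X ** C)))"] conjI ballI allI)
      (use affine_expm_deriv[of A a b X C] in \<open>simp_all only: has_vector_derivative_def * Suc.IH\<close>)
qed

context su5_obata
begin

text \<open>A fundamental solution of the transport equation: one matrix-valued curve transports all
  initial vectors simultaneously.\<close>

definition fundamental_along :: "(real \<Rightarrow> cmat5) \<Rightarrow> (real \<Rightarrow> quat^6^6) \<Rightarrow> bool" where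
  "fundamental_along \<gamma> W \<longleftrightarrow> continuous_on {0..1} \<gamma> \<and> continuous_on {0..1} W \<and> (\<exists>S. finite S \<and>
     (\<forall>t\<in>{0<..<1} - S. \<exists>x. (\<gamma> has_vector_derivative \<gamma> t ** xi x) (at t) \<and>
        (W has_vector_derivative - (obata_matrix x ** W t)) (at t)))"

text \<open>Each exponential leg is appended by running the old path at double speed on [0, 1/2] and
  the new leg on [1/2, 1]. The exceptional parameters are halved, and 1/2 joins them.\<close>

lemma reach_path:
  assumes "reach g M"
  shows "\<exists>\<gamma> W. piecewise_smooth_path \<gamma> \<and> \<gamma> ` {0..1} \<subseteq> SU5 \<and> \<gamma> 0 = mat 1 \<and> \<gamma> 1 = g \<and>
    W 0 = mat 1 \<and> W 1 = M \<and> fundamental_along \<gamma> W"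
  using assms
proof (induction rule: reach.induct)
  case reach_start
  have "smooth_near S (\<lambda>_::real. mat 1 :: cmat5)" for S
    unfolding smooth_near_def by (intro exI[of _ UNIV]) (simp add: Ck_on_const)
  then have "piecewise_smooth_path (\<lambda>_. mat 1 :: cmat5)"
    unfolding piecewise_smooth_path_def by (intro exI[of _ "{}"]) auto
  moreover have "fundamental_along (\<lambda>_. mat 1) (\<lambda>_. mat 1)"
    unfolding fundamental_along_def
    by (auto intro!: exI[of _ "{}"] exI[of _ 0] simp: linear_0[OF linear_xi] linear_0[OF linear_obata_matrix])
  ultimately show ?case by (intro exI[of _ "\<lambda>_. mat 1"]) auto
next
  case (reach_step g M r x)
  then obtain \<gamma> W where \<gamma>: "piecewise_smooth_path \<gamma>" "\<gamma> ` {0..1} \<subseteq> SU5" "\<gamma> 0 = mat 1" "\<gamma> 1 = g"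
    and W: "W 0 = mat 1" "W 1 = M" and fund: "fundamental_along \<gamma> W" by blast
  from fund obtain S where S: "finite S" "\<And>t. t \<in> {0<..<1} - S \<Longrightarrow> \<exists>x. (\<gamma> has_vector_derivative \<gamma> t ** xi x) (at t) \<and>
        (W has_vector_derivative - (obata_matrix x ** W t)) (at t)"
    and c\<gamma>: "continuous_on {0..1} \<gamma>" and cW: "continuous_on {0..1} W"
    unfolding fundamental_along_def by blast
  from \<gamma>(1) obtain T where T: "finite T" "\<And>a b. 0 \<le> a \<Longrightarrow> a < b \<Longrightarrow> b \<le> 1 \<Longrightarrow> {a<..<b} \<inter> T = {} \<Longrightarrow>
        \<exists>h. smooth_near {a..b} h \<and> (\<forall>t\<in>{a..b}. \<gamma> t = h t)"
    unfolding piecewise_smooth_path_def by blast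
  \<comment> \<open>The exponent 2rs - r runs from 0 to r as s runs from 1/2 to 1. The factors
    \<open>mat 1\<close> bring both curves into the shape of
    \<open>affine_expm_deriv\<close>.\<close>
  define \<gamma>2 where "\<gamma>2 s = g ** expm ((2 * r) * s + (- r)) (xi x) ** mat 1" for s
  define W2 where "W2 s = mat 1 ** expm ((2 * r) * s + (- r)) (- obata_matrix x) ** M" for s
  define \<delta> where "\<delta> s = (if s \<le> 1/2 then \<gamma> (2 * s) else \<gamma>2 s)" for s
  define V where "V s = (if s \<le> 1/2 then W (2 * s) else W2 s)" for s
  have half: "\<gamma>2 (1/2) = g" "W2 (1/2) = M" by (simp_all add: \<gamma>2_def W2_def)
  have smooth2: "smooth_near {a..b} \<gamma>2" for a b
    unfolding smooth_near_def \<gamma>2_def by (intro exI[of _ UNIV] conjI allI Ck_on_affine_expm) auto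
  have "piecewise_smooth_path \<delta>"
    unfolding piecewise_smooth_path_def
  proof (intro exI[of _ "insert (1/2) ((\<lambda>s. s / 2) ` T)"] conjI allI impI)
    show "finite (insert (1/2) ((\<lambda>s. s / 2) ` T))" using T(1) by simp
    fix a b :: real
    assume ab: "0 \<le> a \<and> a < b \<and> b \<le> 1 \<and> {a<..<b} \<inter> insert (1/2) ((\<lambda>s. s / 2) ` T) = {}"
    then have "\<not> (a < 1/2 \<and> 1/2 < b)" by auto
    then consider "b \<le> 1/2" | "1/2 \<le> a" by linarith
    then show "\<exists>h. smooth_near {a..b} h \<and> (\<forall>t\<in>{a..b}. \<delta> t = h t)"
    proof cases
      case 1
      have "{2 * a<..<2 * b} \<inter> T = {}"
      proof (rule ccontr)
        assume "{2 * a<..<2 * b} \<inter> T \<noteq> {}"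
        then obtain y where y: "2 * a < y" "y < 2 * b" "y \<in> T" by auto
        then have "y / 2 \<in> {a<..<b} \<inter> insert (1/2) ((\<lambda>s. s / 2) ` T)" by auto
        with ab show False by blast
      qed
      then obtain h where h: "smooth_near {2 * a..2 * b} h" "\<And>t. t \<in> {2 * a..2 * b} \<Longrightarrow> \<gamma> t = h t"
        using T(2)[of "2 * a" "2 * b"] ab 1 by auto
      have "smooth_near {a..b} (\<lambda>s. h (2 * s))"
        by (rule smooth_near_scale[OF h(1)]) auto
      then show ?thesis using 1 h(2) by (intro exI[of _ "\<lambda>s. h (2 * s)"]) (auto simp: \<delta>_def)
    next
      case 2
      have "\<delta> t = \<gamma>2 t" if "t \<in> {a..b}" for t
      proof (cases "t = 1/2")
        case True
        show ?thesis using half(1) \<gamma>(4) unfolding \<delta>_def True by simp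
      next
        case False
        then have "\<not> t \<le> 1/2" using that 2 by auto
        then show ?thesis by (simp add: \<delta>_def)
      qed
      then show ?thesis using smooth2 by blast
    qed
  qed
  moreover have "\<delta> ` {0..1} \<subseteq> SU5"
  proof -
    have "g \<in> SU5" using reach_step.hyps by (rule reach_SU5)
    then show ?thesis using \<gamma>(2)
      by (auto simp: \<delta>_def \<gamma>2_def image_subset_iff intro!: SU5_mult expm_SU5 xi_su5)
  qed
  moreover have "\<delta> 0 = mat 1" "\<delta> 1 = g ** expm r (xi x)" "V 0 = mat 1" "V 1 = expm (- r) (obata_matrix x) ** M"
    by (simp_all add: \<delta>_def \<gamma>2_def \<gamma> V_def W2_def W expm_minus)
  moreover have "fundamental_along \<delta> V"
    unfolding fundamental_along_def
  proof (intro conjI exI[of _ "insert (1/2) ((\<lambda>s. s / 2) ` S)"] ballI)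
    have c2: "continuous_on A \<gamma>2" "continuous_on A W2" for A
      unfolding \<gamma>2_def W2_def
      by (intro continuous_at_imp_continuous_on ballI has_vector_derivative_continuous[OF affine_expm_deriv])+
    have glue: "\<gamma> (2 * s) = \<gamma>2 s" "W (2 * s) = W2 s" if "s * 2 = 1" for s
    proof -
      have s: "s = 1/2" using that by simp
      show "\<gamma> (2 * s) = \<gamma>2 s" "W (2 * s) = W2 s" unfolding s half using \<gamma>(4) W(2) by simp_all
    qed
    have split: "{0..1} = {0..1/2} \<union> {1/2..1::real}" by auto
    show "continuous_on {0..1} \<delta>" unfolding \<delta>_def split
      by (rule continuous_on_cases) 
        (auto intro!: continuous_on_compose2[OF c\<gamma>] continuous_intros c2 simp: glue)
    show "continuous_on {0..1} V" unfolding V_def split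
      by (rule continuous_on_cases) 
        (auto intro!: continuous_on_compose2[OF cW] continuous_intros c2 simp: glue)
    show "finite (insert (1/2) ((\<lambda>s. s / 2) ` S))" using S(1) by simp
    fix t assume t: "t \<in> {0<..<1} - insert (1/2) ((\<lambda>s. s / 2) ` S)"
    show "\<exists>x. (\<delta> has_vector_derivative \<delta> t ** xi x) (at t) \<and> (V has_vector_derivative - (obata_matrix x ** V t)) (at t)"
    proof (cases "t < 1/2")
      case True
      have "2 * t \<notin> S"
      proof
        assume "2 * t \<in> S"
        then have "2 * t / 2 \<in> (\<lambda>s. s / 2) ` S" by (rule imageI)
        then show False using t by simp
      qed
      then have "2 * t \<in> {0<..<1} - S" using t True by simp
      from S(2)[OF this] obtain y where y: "(\<gamma> has_vector_derivative \<gamma> (2 * t) ** xi y) (at (2 * t))"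
        "(W has_vector_derivative - (obata_matrix y ** W (2 * t))) (at (2 * t))" by blast
      have 2: "((\<lambda>s. 2 * s) has_vector_derivative 2) (at t)"
        by (auto intro!: derivative_eq_intros simp: has_real_derivative_iff_has_vector_derivative[symmetric])
      have "((\<lambda>s. \<gamma> (2 * s)) has_vector_derivative \<delta> t ** xi (2 *\<^sub>R y)) (at t)"
        using vector_diff_chain_at[OF 2 y(1)] True
        by (simp add: o_def \<delta>_def linear_scale[OF linear_xi] mmult.scaleR_right)
      then have "(\<delta> has_vector_derivative \<delta> t ** xi (2 *\<^sub>R y)) (at t)"
        by (rule has_vector_derivative_transform_within_open[where S = "{..<1/2}"]) (use True in \<open>auto simp: \<delta>_def\<close>)
      moreover have "((\<lambda>s. W (2 * s)) has_vector_derivative - (obata_matrix (2 *\<^sub>R y) ** V t)) (at t)"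
        using vector_diff_chain_at[OF 2 y(2)] True
        by (simp add: o_def V_def linear_scale[OF linear_obata_matrix] mmult.scaleR_left)
      then have "(V has_vector_derivative - (obata_matrix (2 *\<^sub>R y) ** V t)) (at t)"
        by (rule has_vector_derivative_transform_within_open[where S = "{..<1/2}"]) (use True in \<open>auto simp: V_def\<close>)
      ultimately show ?thesis by blast
    next
      case False
      then have t2: "1/2 < t" using t by auto
      have "(\<gamma>2 has_vector_derivative \<delta> t ** xi ((2 * r) *\<^sub>R x)) (at t)"
        using affine_expm_deriv[of g "2 * r" "- r" "xi x" "mat 1" t] t2
        unfolding \<gamma>2_def[abs_def] \<delta>_def
        by (simp add: linear_scale[OF linear_xi] mmult.scaleR_right matrix_mul_assoc)
      then have "(\<delta> has_vector_derivative \<delta> t ** xi ((2 * r) *\<^sub>R x)) (at t)"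
        by (rule has_vector_derivative_transform_within_open[where S = "{1/2<..}"]) (use t2 in \<open>auto simp: \<delta>_def\<close>)
      moreover have com: "expm u (- obata_matrix x) ** obata_matrix x = obata_matrix x ** expm u (- obata_matrix x)" for u
        using expm_commute[of u "- obata_matrix x"] by (simp add: mmult.minus_left mmult.minus_right)
      have "(W2 has_vector_derivative - (obata_matrix ((2 * r) *\<^sub>R x) ** V t)) (at t)"
        using affine_expm_deriv[of "mat 1" "2 * r" "- r" "- obata_matrix x" M t] t2
        unfolding W2_def[abs_def] V_def
        by (simp add: linear_scale[OF linear_obata_matrix] mmult.scaleR_right mmult.scaleR_left
            mmult.minus_left mmult.minus_right matrix_mul_assoc com)
      then have "(V has_vector_derivative - (obata_matrix ((2 * r) *\<^sub>R x) ** V t)) (at t)"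
        by (rule has_vector_derivative_transform_within_open[where S = "{1/2<..}"]) (use t2 in \<open>auto simp: V_def\<close>)
      ultimately show ?thesis by blast
    qed
  qed
  ultimately show ?case by blast
qed

lemma fundamental_imp_parallel:
  assumes fund: "fundamental_along \<gamma> W" and \<gamma>: "\<gamma> ` {0..1} \<subseteq> SU5"
  shows "parallel_along D \<gamma> (\<lambda>t. \<gamma> t ** xi (W t *v v))"
proof -
  from fund obtain S where S: "finite S" "\<And>t. t \<in> {0<..<1} - S \<Longrightarrow> \<exists>x. (\<gamma> has_vector_derivative \<gamma> t ** xi x) (at t) \<and>
        (W has_vector_derivative - (obata_matrix x ** W t)) (at t)"
    and c\<gamma>: "continuous_on {0..1} \<gamma>" and cW: "continuous_on {0..1} W"
    unfolding fundamental_along_def by blast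
  have bl: "bounded_linear xi" using linear_xi by (simp add: linear_conv_bounded_linear)
  show ?thesis
    unfolding parallel_along_def
  proof (intro conjI ballI exI[of _ S])
    show "continuous_on {0..1} (\<lambda>t. \<gamma> t ** xi (W t *v v))"
      by (intro mmult.continuous_on c\<gamma> bounded_linear.continuous_on[OF bl] mvmult.continuous_on cW continuous_on_const)
    show "\<gamma> t ** xi (W t *v v) \<in> tangent (\<gamma> t)" for t
      using xi_su5 by (auto simp: tangent_def)
    show "finite S" by (rule S)
    fix t assume t: "t \<in> {0<..<1} - S"
    from S(2)[OF this] obtain x where x: "(\<gamma> has_vector_derivative \<gamma> t ** xi x) (at t)"
        "(W has_vector_derivative - (obata_matrix x ** W t)) (at t)" by blast
    have g: "\<gamma> t \<in> SU5" using \<gamma> t by auto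
    have "((\<lambda>s. xi (W s *v v)) has_vector_derivative xi (- (obata_matrix x ** W t) *v v)) (at t)"
      by (intro bounded_linear.has_vector_derivative[OF bl]
          bounded_linear.has_vector_derivative[OF mvmult.bounded_linear_left] x)
    then have "((\<lambda>s. adj (\<gamma> s) ** (\<gamma> s ** xi (W s *v v))) has_vector_derivative xi (- (obata_matrix x ** W t) *v v)) (at t)"
    proof (rule has_vector_derivative_transform_within_open[where S = "{0<..<1}"])
      show "xi (W s *v v) = adj (\<gamma> s) ** (\<gamma> s ** xi (W s *v v))" if "s \<in> {0<..<1}" for s
        using \<gamma> that by (subst SU5_simps) auto
    qed (use t in auto)
    moreover have "\<gamma> t ** xi (- (obata_matrix x ** W t) *v v) + D (left_invariant_field (adj (\<gamma> t) ** (\<gamma> t ** xi x)))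
                      (left_invariant_field (adj (\<gamma> t) ** (\<gamma> t ** xi (W t *v v)))) (\<gamma> t) = 0"
      unfolding SU5_simps[OF g] connection_left_invariant[OF g]
      by (simp add: mvmult.minus_left matrix_vector_mul_assoc linear_neg[OF linear_xi] mmult.minus_right)
    ultimately show "\<exists>\<gamma>' u'. (\<gamma> has_vector_derivative \<gamma>') (at t) \<and>
        ((\<lambda>s. adj (\<gamma> s) ** (\<gamma> s ** xi (W s *v v))) has_vector_derivative u') (at t) \<and>
        \<gamma> t ** u' + D (left_invariant_field (adj (\<gamma> t) ** \<gamma>'))
                      (left_invariant_field (adj (\<gamma> t) ** (\<gamma> t ** xi (W t *v v)))) (\<gamma> t) = 0"
      using x(1) by blast
  qed
qed

end

text \<open>Only the open intervals avoid the break points, while the smooth representatives agree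
  with the path on the closed ones. Neighbouring pieces thus share their end point, and continuity
  holds at the breaks as well.\<close>

lemma continuous_on_piecewise_smooth:
  fixes \<gamma> :: "real \<Rightarrow> cmat5"
  assumes "piecewise_smooth_path \<gamma>"
  shows "continuous_on {0..1} \<gamma>"
proof -
  from assms obtain T where T: "finite T" "\<And>a b. 0 \<le> a \<Longrightarrow> a < b \<Longrightarrow> b \<le> 1 \<Longrightarrow> {a<..<b} \<inter> T = {} \<Longrightarrow>
        \<exists>h. smooth_near {a..b} h \<and> (\<forall>t\<in>{a..b}. \<gamma> t = h t)"
    unfolding piecewise_smooth_path_def by blast
  have piece: "continuous_on {a..b} \<gamma>" if ab: "0 \<le> a" "a \<le> b" "b \<le> 1" and disj: "{a<..<b} \<inter> T = {}" for a b
  proof (cases "a = b")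
    case False
    then have "a < b" using ab by simp
    then obtain h where h: "smooth_near {a..b} h" "\<And>t. t \<in> {a..b} \<Longrightarrow> \<gamma> t = h t"
      using T(2)[of a b] ab disj by blast
    from h(1) obtain U where "{a..b} \<subseteq> U" "\<And>k. Ck_on k h U" unfolding smooth_near_def by blast
    from this(2)[of 0] this(1) have "continuous_on {a..b} h" by (auto intro: continuous_on_subset)
    then show ?thesis using h(2) by (metis continuous_on_cong)
  qed simp
  have "(0::real) \<le> 1" by simp
  then have "0 \<le> (0::real) \<and> (1::real) \<le> 1 \<longrightarrow> continuous_on {0..1} \<gamma>"
  proof (rule Bolzano[where P = "\<lambda>a b. 0 \<le> a \<and> b \<le> 1 \<longrightarrow> continuous_on {a..b} \<gamma>"])
    fix a b c :: real
    assume *: "0 \<le> a \<and> b \<le> 1 \<longrightarrow> continuous_on {a..b} \<gamma>" "0 \<le> b \<and> c \<le> 1 \<longrightarrow> continuous_on {b..c} \<gamma>"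
      and "a \<le> b" "b \<le> c"
    then have "{a..c} = {a..b} \<union> {b..c}" by auto
    then show "0 \<le> a \<and> c \<le> 1 \<longrightarrow> continuous_on {a..c} \<gamma>"
      using * \<open>a \<le> b\<close> \<open>b \<le> c\<close> by (auto intro!: continuous_on_closed_Un)
  next
    fix x :: real assume x: "0 \<le> x" "x \<le> 1"
    obtain d where d: "d > 0" "\<And>y. y \<in> T \<Longrightarrow> y \<noteq> x \<Longrightarrow> d \<le> dist x y"
      using finite_set_avoid[OF T(1), of x] by blast
    have "continuous_on {a..b} \<gamma>" if "a \<le> x" "x \<le> b" "b - a < d" "0 \<le> a" "b \<le> 1" for a b
    proof -
      have "{a<..<x} \<inter> T = {}" "{x<..<b} \<inter> T = {}"
        using d(2) that by (force simp: dist_real_def)+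
      then have "continuous_on {a..x} \<gamma>" "continuous_on {x..b} \<gamma>"
        using piece[of a x] piece[of x b] that x by auto
      moreover have "{a..b} = {a..x} \<union> {x..b}" using that by auto
      ultimately show ?thesis by (auto intro!: continuous_on_closed_Un)
    qed
    then show "\<exists>d>0. \<forall>a b. a \<le> x \<and> x \<le> b \<and> b - a < d \<longrightarrow> 0 \<le> a \<and> b \<le> 1 \<longrightarrow> continuous_on {a..b} \<gamma>"
      using d(1) by blast
  qed
  then show ?thesis by simp
qed

section \<open>Identification of the holonomy group with the quaternionic matrix group\<close>

context su5_obata
begin

lemma inv_into_th: "inv_into su5 th q = xi q"
proof (rule inv_into_f_eq)
  show "inj_on th su5" by (metis inj_onI xi_th)
qed (simp_all add: xi_su5 th_xi)

lemma matrix_action_eq: "matrix_action th M = (\<lambda>x\<in>su5. xi (M *v th x))"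
  by (simp add: matrix_action_def inv_into_th)

lemma matrix_action_xi: "matrix_action th M (xi v) = xi (M *v v)"
  by (simp add: matrix_action_eq xi_su5 th_xi)

lemma matrix_action_Bij:
  assumes "invertible M"
  shows "matrix_action th M \<in> Bij su5"
proof -
  from assms obtain N where N: "M ** N = mat 1" "N ** M = mat 1" by (auto simp: invertible_def)
  have "bij_betw (matrix_action th M) su5 su5"
    by (rule bij_betw_byWitness[where f' = "matrix_action th N"])
      (auto simp: matrix_action_eq xi_su5 th_xi matrix_vector_mul_assoc N xi_th)
  then show ?thesis by (simp add: Bij_def matrix_action_eq)
qed

lemma holonomy_carrier:
  "P \<in> carrier (holonomy_group D) \<longleftrightarrow> P \<in> Bij su5 \<and> (\<exists>\<gamma>. piecewise_smooth_path \<gamma> \<and> \<gamma> ` {0..1} \<subseteq> SU5 \<and>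
        \<gamma> 0 = mat 1 \<and> \<gamma> 1 = mat 1 \<and>
        (\<forall>x\<in>su5. \<exists>V. parallel_along D \<gamma> V \<and> V 0 = x \<and> V 1 = P x))"
  by (simp add: holonomy_group_def)

lemma matrix_action_in_holonomy:
  assumes M: "invertible M"
  shows "matrix_action th M \<in> carrier (holonomy_group D)"
proof -
  have "M \<in> loops"
    by (rule GL_quat_generated[OF mat1_in_interior[OF loops_group(1,2) velocities_loops] loops_group(2,3) M])
  then have "reach (mat 1) M" by simp
  from reach_path[OF this] obtain \<gamma> W where \<gamma>: "piecewise_smooth_path \<gamma>" "\<gamma> ` {0..1} \<subseteq> SU5" "\<gamma> 0 = mat 1" "\<gamma> 1 = mat 1"
    and W: "W 0 = mat 1" "W 1 = M" "fundamental_along \<gamma> W" by blast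
  have "\<exists>V. parallel_along D \<gamma> V \<and> V 0 = x \<and> V 1 = matrix_action th M x" if x: "x \<in> su5" for x
    using fundamental_imp_parallel[OF W(3) \<gamma>(2), of "th x"] x
    by (intro exI[of _ "\<lambda>t. \<gamma> t ** xi (W t *v th x)"]) (simp add: \<gamma> W xi_th matrix_action_eq)
  then show ?thesis
    unfolding holonomy_carrier using matrix_action_Bij[OF M] \<gamma> by blast
qed

text \<open>A holonomy element comes with a separate parallel field for every initial vector.
  Uniqueness for the transport equation ties them together and makes the map additive and right
  quaternionic, hence a matrix; its inverse inherits both properties, so the matrix is
  invertible.\<close>

lemma holonomy_is_matrix_action:
  assumes "P \<in> carrier (holonomy_group D)"
  shows "\<exists>M. invertible M \<and> P = matrix_action th M"
proof -
  from assms obtain \<gamma> where P: "P \<in> Bij su5" and \<gamma>: "piecewise_smooth_path \<gamma>" "\<gamma> ` {0..1} \<subseteq> SU5"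
    "\<gamma> 0 = mat 1" "\<gamma> 1 = mat 1" and par: "\<And>x. x \<in> su5 \<Longrightarrow> \<exists>V. parallel_along D \<gamma> V \<and> V 0 = x \<and> V 1 = P x"
    unfolding holonomy_carrier by blast
  have bij: "bij_betw P su5 su5" and ext: "P \<in> extensional su5" using P by (auto simp: Bij_def)
  define Q where "Q v = th (P (xi v))" for v
  have cont: "continuous_on {0..1} \<gamma>" by (rule continuous_on_piecewise_smooth[OF \<gamma>(1)])
  have ode: "\<exists>W. transport_ode \<gamma> W \<and> W 0 = v \<and> W 1 = Q v" for v
  proof -
    from par[OF xi_su5[of v]] obtain V where V: "parallel_along D \<gamma> V" "V 0 = xi v" "V 1 = P (xi v)" by blast
    show ?thesis
      using parallel_imp_transport_ode[OF V(1) \<gamma>(2) cont]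
      by (intro exI[of _ "\<lambda>t. th (adj (\<gamma> t) ** V t)"]) (simp add: V \<gamma> th_xi Q_def)
  qed
  have Q_diff: "Q (v - w) = Q v - Q w" for v w
  proof -
    \<comment> \<open>The field \<open>W1 - W2 - W3\<close> solves the same equation with initial
      value 0, hence also ends at 0.\<close>
    obtain W1 W2 W3 where W: "transport_ode \<gamma> W1" "W1 0 = v" "W1 1 = Q v" "transport_ode \<gamma> W2" "W2 0 = w" "W2 1 = Q w"
      "transport_ode \<gamma> W3" "W3 0 = v - w" "W3 1 = Q (v - w)" using ode by metis
    from transport_ode_zero[OF transport_ode_diff[OF transport_ode_diff[OF W(1,4)] W(7)] \<gamma>(1)] W
    show ?thesis by simp
  qed
  have Q_rmul: "Q (rmul v p) = rmul (Q v) p" for v p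
  proof -
    obtain W1 W2 where W: "transport_ode \<gamma> W1" "W1 0 = v" "W1 1 = Q v"
      "transport_ode \<gamma> W2" "W2 0 = rmul v p" "W2 1 = Q (rmul v p)" using ode by metis
    from transport_ode_zero[OF transport_ode_diff[OF transport_ode_rmul[OF W(1)] W(4)] \<gamma>(1)] W
    show ?thesis by simp
  qed
  have Q0: "Q 0 = 0" using Q_diff[of 0 0] by simp
  have Q_add: "Q (v + w) = Q v + Q w" for v w
    using Q_diff[of v "- w"] Q_diff[of 0 w] Q0 by simp
  have matrix: "\<exists>M. \<forall>v. q v = M *v v"
    if add: "\<And>v w. q (v + w) = q v + q w" and rm: "\<And>v p. q (rmul v p) = rmul (q v) p"
      for q :: "quat^6 \<Rightarrow> quat^6"
  proof (intro exI allI)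
    fix v :: "quat^6"
    have q0: "q 0 = 0" using add[of 0 0] by simp
    have "v = (\<Sum>j\<in>UNIV. rmul (axis j 1) (v $ j))"
      by (simp add: vec_eq_iff rmul_def axis_def if_distrib[of "\<lambda>x. x * _"] cong: if_cong)
    then have "q v = (\<Sum>j\<in>UNIV. q (rmul (axis j 1) (v $ j)))"
      using sum_comp_morphism[of q "\<lambda>j. rmul (axis j 1) (v $ j)" UNIV] q0 add by (simp add: o_def)
    also have "\<dots> = (\<Sum>j\<in>UNIV. rmul (q (axis j 1)) (v $ j))" by (simp add: rm)
    also have "\<dots> = (\<chi> i j. q (axis j 1) $ i) *v v"
      by (simp add: vec_eq_iff rmul_def matrix_vector_mult_def)
    finally show "q v = (\<chi> i j. q (axis j 1) $ i) *v v" .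
  qed
  define R where "R v = th (inv_into su5 P (xi v))" for v
  have Pin: "P x \<in> su5" "inv_into su5 P x \<in> su5" if "x \<in> su5" for x
    using bij that by (auto simp: bij_betw_def intro: inv_into_into)
  have QR: "Q (R v) = v" "R (Q v) = v" for v
    using bij by (simp_all add: Q_def R_def xi_th Pin xi_su5 th_xi bij_betw_inv_into_right bij_betw_inv_into_left)
  have R_add: "R (v + w) = R v + R w" for v w
    by (metis QR Q_add)
  have R_rmul: "R (rmul v p) = rmul (R v) p" for v p
    by (metis QR Q_rmul)
  obtain M where M: "\<And>v. Q v = M *v v" using matrix[OF Q_add Q_rmul] by blast
  obtain N where N: "\<And>v. R v = N *v v" using matrix[OF R_add R_rmul] by blast
  have eqI: "A = B" if "\<And>v. A *v v = B *v v" for A B :: "quat^6^6"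
    using that by (simp add: vec_eq_iff) (metis matrix_vector_axis)
  have "M ** N = mat 1" "N ** M = mat 1"
    by (rule eqI; simp add: QR flip: matrix_vector_mul_assoc M N)+
  then have "invertible M" by (auto simp: invertible_def)
  moreover have "P = matrix_action th M"
  proof (rule extensionalityI[OF ext])
    show "matrix_action th M \<in> extensional su5" by (simp add: matrix_action_eq)
    show "P x = matrix_action th M x" if "x \<in> su5" for x
      using that by (simp add: matrix_action_eq Q_def xi_th Pin flip: M)
  qed
  ultimately show ?thesis by blast
qed

theorem matrix_action_iso: "matrix_action th \<in> iso GL_quat (holonomy_group D)"
proof -
  have GL: "carrier GL_quat = {M :: quat^6^6. invertible M}" "mult GL_quat = (**)"
    by (simp_all add: GL_quat_def)
  have "matrix_action th (M ** N) = matrix_action th M \<otimes>\<^bsub>holonomy_group D\<^esub> matrix_action th N"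
    if "invertible M" "invertible N" for M N
  proof -
    have "matrix_action th M \<otimes>\<^bsub>holonomy_group D\<^esub> matrix_action th N
      = compose su5 (matrix_action th M) (matrix_action th N)"
      using that by (simp add: holonomy_group_def BijGroup_def matrix_action_Bij)
    also have "\<dots> = matrix_action th (M ** N)"
      by (auto simp: compose_def matrix_action_eq fun_eq_iff xi_su5 th_xi matrix_vector_mul_assoc)
    finally show ?thesis by simp
  qed
  then have "matrix_action th \<in> hom GL_quat (holonomy_group D)"
    using matrix_action_in_holonomy by (auto simp: hom_def GL)
  moreover have "bij_betw (matrix_action th) (carrier GL_quat) (carrier (holonomy_group D))"
    unfolding bij_betw_def
  proof
    show "inj_on (matrix_action th) (carrier GL_quat)"
    proof (rule inj_onI)
      fix M N assume eq: "matrix_action th M = matrix_action th N"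
      have "M *v v = N *v v" for v
        using fun_cong[OF eq, of "xi v"] by (metis matrix_action_xi th_xi)
      then show "M = N" by (simp add: vec_eq_iff) (metis matrix_vector_axis)
    qed
    show "matrix_action th ` carrier GL_quat = carrier (holonomy_group D)"
      using matrix_action_in_holonomy holonomy_is_matrix_action by (auto simp: GL)
  qed
  ultimately show ?thesis by (simp add: iso_def)
qed

end

section \<open>Normal form of the bases of the diagonal blocks\<close>

definition dblock :: "5 \<Rightarrow> 5 \<Rightarrow> real \<Rightarrow> complex \<Rightarrow> cmat5" where
  "dblock m n a b = (\<chi> r s.
     if r = m then (if s = m then \<i> * a else if s = n then b else 0)
     else if r = n then (if s = m then - cnj b else if s = n then - (\<i> * a) else 0) else 0)"

lemma d_sub_dblock:
  "X \<in> d_sub 1 \<Longrightarrow> X = dblock 1 2 (Im (X $ 1 $ 1)) (X $ 1 $ 2)"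
  "X \<in> d_sub 2 \<Longrightarrow> X = dblock 3 4 (Im (X $ 3 $ 3)) (X $ 3 $ 4)"
proof -
  have anti: "X $ s $ r = - cnj (X $ r $ s)" if "X \<in> su5" for X r s
  proof -
    have "adj X $ r $ s = (- X) $ r $ s" using that by (simp add: su5_def)
    then show ?thesis by (simp add: adj_def) (metis complex_cnj_cnj complex_cnj_minus minus_equation_iff)
  qed
  have diag: "X $ r $ r = \<i> * Im (X $ r $ r)" if "X \<in> su5" for X r
    using anti[OF that, of r r] by (simp add: complex_eq_iff)
  {
    assume X: "X \<in> d_sub 1"
    then have z: "X $ r $ s = 0" if "\<not> (r \<in> {1, 2} \<and> s \<in> {1, 2})" for r s
      using that by (auto simp: d_sub_def block_def)
    have su: "X \<in> su5" using X by (simp add: d_sub_def)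
    have "X $ 2 $ 2 = - (X $ 1 $ 1)"
      using su z[of 3 3] z[of 4 4] z[of 5 5] by (simp add: su5_def trace_def sum_5 add_eq_0_iff)
    then show "X = dblock 1 2 (Im (X $ 1 $ 1)) (X $ 1 $ 2)"
      unfolding vec_eq_iff forall_5
      using anti[OF su, of 1 2] diag[OF su, of 1] by (simp add: dblock_def z)
  }
  {
    assume X: "X \<in> d_sub 2"
    then have z: "X $ r $ s = 0" if "\<not> (r \<in> {3, 4} \<and> s \<in> {3, 4})" for r s
      using that by (auto simp: d_sub_def block_def)
    have su: "X \<in> su5" using X by (simp add: d_sub_def)
    have "X $ 4 $ 4 = - (X $ 3 $ 3)"
      using su z[of 1 1] z[of 2 2] z[of 5 5] by (simp add: su5_def trace_def sum_5 add_eq_0_iff)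
    then show "X = dblock 3 4 (Im (X $ 3 $ 3)) (X $ 3 $ 4)"
      unfolding vec_eq_iff forall_5
      using anti[OF su, of 3 4] diag[OF su, of 3] by (simp add: dblock_def z)
  }
qed

text \<open>With (a, Re b, Im b) as coordinates on su(2), the bracket is twice the cross product of
  three-dimensional space.\<close>

lemma bracket_dblock:
  assumes "m = 1 \<and> n = 2 \<or> m = 3 \<and> n = 4"
  shows "bracket (dblock m n a b) (dblock m n c d) = 2 *\<^sub>R dblock m n (Im (d * cnj b)) (\<i> * (a * d - c * b))"
  using assms unfolding vec_eq_iff forall_5 complex_eq_iff
  by (elim disjE conjE; simp add: bracket_def matrix_matrix_mult_def sum_5 dblock_def; simp add: algebra_simps)

lemma dblock_eq_iff:
  "m \<noteq> n \<Longrightarrow> dblock m n a b = dblock m n c d \<longleftrightarrow> a = c \<and> b = d"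
  by (auto simp: dblock_def vec_eq_iff dest: spec[of _ m] spec[of _ n])

text \<open>Read as vectors, the hypotheses say v4 = v2 x v3, v3 = v4 x v2 and v2 = v3 x v4. Cross
  products are orthogonal to their factors, and the resulting equations between the squared lengths
  force these to be 1 as soon as v2 is non-zero.\<close>

lemma su2_cross_relations:
  fixes a2 a3 a4 :: real and b2 b3 b4 :: complex
  assumes r4: "a4 = Im (b3 * cnj b2)" "b4 = \<i> * (a2 * b3 - a3 * b2)"
    and r3: "a3 = Im (b2 * cnj b4)" "b3 = \<i> * (a4 * b2 - a2 * b4)"
    and r2: "a2 = Im (b4 * cnj b3)" "b2 = \<i> * (a3 * b4 - a4 * b3)"
    and nz: "a2 \<noteq> 0 \<or> b2 \<noteq> 0"
  shows "a2\<^sup>2 + (cmod b2)\<^sup>2 = 1" "a3\<^sup>2 + (cmod b3)\<^sup>2 = 1" "a2 * a3 + Re (b2 * cnj b3) = 0"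
proof -
  define N2 N3 N4 where N: "N2 = a2\<^sup>2 + (cmod b2)\<^sup>2" "N3 = a3\<^sup>2 + (cmod b3)\<^sup>2" "N4 = a4\<^sup>2 + (cmod b4)\<^sup>2"
  show o23: "a2 * a3 + Re (b2 * cnj b3) = 0"
    unfolding r2 by (simp add: algebra_simps)
  have o24: "a2 * a4 + Re (b2 * cnj b4) = 0"
    unfolding r4 by (simp add: algebra_simps)
  have o34: "a3 * a4 + Re (b3 * cnj b4) = 0"
    unfolding r4 by (simp add: algebra_simps)
  \<comment> \<open>Lagrange's identity for the squared length of a cross product.\<close>
  have cross: "(Im (y * cnj x))\<^sup>2 + (cmod (\<i> * (a * y - c * x)))\<^sup>2
      = (a\<^sup>2 + (cmod x)\<^sup>2) * (c\<^sup>2 + (cmod y)\<^sup>2) - (a * c + Re (x * cnj y))\<^sup>2" for a c :: real and x y :: complex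
    unfolding cmod_power2 by (simp add: power2_eq_square algebra_simps)
  have N4: "N4 = N2 * N3"
    using cross[of b3 b2 a2 a3, folded r4] o23 by (simp add: N)
  have N3: "N3 = N4 * N2"
    using cross[of b2 b4 a4 a2, folded r3] o24 by (simp add: N ac_simps)
  have N2: "N2 = N3 * N4"
    using cross[of b4 b3 a3 a4, folded r2] o34 by (simp add: N)
  have pos: "N2 > 0" using nz by (auto simp: N add_nonneg_pos add_pos_nonneg)
  have nn: "N3 \<ge> 0" "N4 \<ge> 0" by (simp_all add: N)
  have "N2 * (N4 * N4) = N2 * 1" using N2 N3 by (simp add: ac_simps)
  then have "N4 * N4 = 1" using pos by simp
  then have "N4 = 1" using nn by (metis abs_of_nonneg abs_square_eq_1 power2_eq_square)
  then have "N3 = N2" using N3 by simp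
  moreover have "N2 * N2 = 1" using N4 \<open>N4 = 1\<close> \<open>N3 = N2\<close> by simp
  moreover from this have "N2 = 1" using pos by (metis abs_of_pos abs_square_eq_1 power2_eq_square)
  ultimately show "a2\<^sup>2 + (cmod b2)\<^sup>2 = 1" "a3\<^sup>2 + (cmod b3)\<^sup>2 = 1" unfolding N by simp_all
qed

text \<open>A unit eigenvector for the eigenvalue i of the matrix X with rows (ia, b) and (-cnj b,
  -ia). The listed products are entries of the orthogonal projection (1 - iX)/2 onto its
  eigenspace.\<close>

lemma su2_eigenvector:
  fixes a :: real and b :: complex
  assumes ab: "a\<^sup>2 + (cmod b)\<^sup>2 = 1"
  obtains p q where "p * cnj p = (1 + a) / 2" "q * cnj q = (1 - a) / 2" "q * cnj p = \<i> * cnj b / 2"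
    "\<i> * a * p + b * q = \<i> * p" "- cnj b * p - \<i> * a * q = \<i> * q"
proof (cases "a = - 1")
  case True
  with ab have "b = 0" by simp
  with True show ?thesis by (intro that[of 0 1]) simp_all
next
  case False
  have "a\<^sup>2 \<le> 1" using ab by (metis le_add_same_cancel1 zero_le_power2)
  then have a: "1 + a > 0" using False by (simp add: abs_square_le_1 abs_le_iff)
  \<comment> \<open>The phase is fixed by taking \<open>p\<close> real and positive; the second
    eigenvector equation then dictates \<open>q\<close>. The case a = -1 is separate because there
    \<open>p\<close> must vanish.\<close>
  define p where "p = sqrt ((1 + a) / 2)"
  have pp: "p * p = (1 + a) / 2" using a by (simp add: p_def)
  define q where "q = \<i> * cnj b * (p / (1 + a))"
  have bb: "b * cnj b = of_real ((1 - a) * (1 + a))"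
    using ab[unfolded cmod_power2] by (simp add: complex_eq_iff power2_eq_square algebra_simps)
  have q1: "q * (1 + a) = \<i> * cnj b * p"
  proof -
    have "p / (1 + a) * (1 + a) = p" using a by simp
    from arg_cong[OF this, of complex_of_real]
    have "complex_of_real (p / (1 + a)) * (1 + a) = p"
      by (simp only: of_real_mult of_real_add of_real_1)
    then show ?thesis by (simp only: q_def mult.assoc)
  qed
  have ca: "(1 + a :: complex) \<noteq> 0" using a by (metis of_real_1 of_real_add of_real_eq_0_iff less_irrefl)
  have e1: "b * q = \<i> * (1 - a) * p"
  proof -
    have "(1 + a) * (b * q) = b * (q * (1 + a))" by (simp only: mult_ac)
    also have "\<dots> = \<i> * (b * cnj b) * p" by (simp only: q1 mult_ac)
    also have "\<dots> = (1 + a) * (\<i> * (1 - a) * p)" unfolding bb by (simp add: algebra_simps)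
    finally show ?thesis using ca by (metis mult_left_cancel)
  qed
  have qp: "q * p = \<i> * cnj b / 2"
  proof -
    have "(1 + a) * (q * p) = (q * (1 + a)) * p" by (simp only: mult_ac)
    also have "\<dots> = \<i> * cnj b * of_real (p * p)" by (simp only: q1 of_real_mult mult_ac)
    also have "\<dots> = (1 + a) * (\<i> * cnj b / 2)" unfolding pp by (simp add: algebra_simps)
    finally show ?thesis using ca by (metis mult_left_cancel)
  qed
  have qq: "q * cnj q = (1 - a) / 2"
  proof -
    define c :: complex where "c = of_real (1 + a)"
    have c: "c \<noteq> 0" "cnj c = c" using a by (simp_all only: c_def of_real_eq_0_iff complex_cnj_complex_of_real)
    have qc: "q * c = \<i> * cnj b * p" using q1 by (simp only: c_def of_real_add of_real_1)
    have "c * c * (q * cnj q) = (q * c) * cnj (q * c)" by (simp only: c complex_cnj_mult mult_ac)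
    also have "\<dots> = (b * cnj b) * of_real (p * p)" unfolding qc by (simp add: algebra_simps)
    also have "\<dots> = of_real ((1 - a) * (1 + a) * ((1 + a) / 2))" unfolding bb pp by simp
    also have "(1 - a) * (1 + a) * ((1 + a) / 2) = (1 + a) * (1 + a) * ((1 - a) / 2)" by simp
    finally have "c * c * (q * cnj q) = c * c * of_real ((1 - a) / 2)"
      by (simp only: c_def of_real_mult)
    then show ?thesis using c(1) by (simp add: ac_simps)
  qed
  show ?thesis
  proof (rule that[of p q])
    show "p * cnj p = (1 + a) / 2" 
      unfolding complex_cnj_complex_of_real of_real_mult[symmetric] pp by simp
    show "\<i> * a * p + b * q = \<i> * p" unfolding e1 by (simp add: algebra_simps)
    show "- cnj b * p - \<i> * a * q = \<i> * q"
    proof -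
      have "\<i> * (q * (1 + a)) = \<i> * (\<i> * cnj b * p)" by (simp only: q1)
      then show ?thesis by (simp add: algebra_simps)
    qed
  qed (use qq qp in simp_all)
qed

text \<open>The vectors (p,q) and (r,s) form an orthonormal basis of the plane in which e2, e3, e4
  become the standard matrices diag(i,-i), (0,1;-1,0) and (0,i;i,0).\<close>

lemma su2_frame:
  fixes a2 a3 a4 :: real and b2 b3 b4 :: complex
  assumes r4: "a4 = Im (b3 * cnj b2)" "b4 = \<i> * (a2 * b3 - a3 * b2)"
    and r3: "a3 = Im (b2 * cnj b4)" "b3 = \<i> * (a4 * b2 - a2 * b4)"
    and r2: "a2 = Im (b4 * cnj b3)" "b2 = \<i> * (a3 * b4 - a4 * b3)"
    and nz: "a2 \<noteq> 0 \<or> b2 \<noteq> 0"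
  obtains p q r s :: complex where
    "cnj p * p + cnj q * q = 1" "cnj r * r + cnj s * s = 1" "cnj p * r + cnj q * s = 0"
    "\<i> * a2 * p + b2 * q = \<i> * p" "- cnj b2 * p - \<i> * a2 * q = \<i> * q"
    "\<i> * a2 * r + b2 * s = - (\<i> * r)" "- cnj b2 * r - \<i> * a2 * s = - (\<i> * s)"
    "\<i> * a3 * p + b3 * q = - r" "- cnj b3 * p - \<i> * a3 * q = - s"
    "\<i> * a3 * r + b3 * s = p" "- cnj b3 * r - \<i> * a3 * s = q"
    "\<i> * a4 * p + b4 * q = \<i> * r" "- cnj b4 * p - \<i> * a4 * q = \<i> * s"
    "\<i> * a4 * r + b4 * s = \<i> * p" "- cnj b4 * r - \<i> * a4 * s = \<i> * q"
proof -
  note norm = su2_cross_relations[OF assms]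
  obtain p q where pq: "p * cnj p = (1 + a2) / 2" "q * cnj q = (1 - a2) / 2" "q * cnj p = \<i> * cnj b2 / 2"
    and e2: "\<i> * a2 * p + b2 * q = \<i> * p" "- cnj b2 * p - \<i> * a2 * q = \<i> * q"
    by (rule su2_eigenvector[OF norm(1)])
  \<comment> \<open>The second basis vector is -e3(p,q). Since e2 and e3 anticommute, it is an
    eigenvector of e2 for -i.\<close>
  define r where "r = - (\<i> * a3 * p + b3 * q)"
  define s where "s = cnj b3 * p + \<i> * a3 * q"
  have bb3: "b3 * cnj b3 = 1 - of_real (a3 * a3)"
    using norm(2)[unfolded cmod_power2] by (simp add: complex_eq_iff power2_eq_square algebra_simps)
  have p23: "- (a2 * a3) - b2 * cnj b3 = \<i> * a4"
    using norm(3) r4(1) by (simp add: complex_eq_iff)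
  have p23': "- (a2 * a3) - cnj b2 * b3 = - (\<i> * a4)"
    using arg_cong[OF p23, of cnj] by simp
  have b4: "\<i> * a2 * b3 - \<i> * a3 * b2 = b4" using r4(2) by (simp add: algebra_simps)
  have b4': "- (\<i> * a2 * cnj b3) + \<i> * a3 * cnj b2 = cnj b4"
    using arg_cong[OF b4, of cnj] by simp
  have "\<i> * a3 * r + b3 * s = (a3 * a3 + b3 * cnj b3) * p"
    by (simp add: r_def s_def algebra_simps)
  then have e3a: "\<i> * a3 * r + b3 * s = p" by (simp add: bb3)
  have "- cnj b3 * r - \<i> * a3 * s = (a3 * a3 + b3 * cnj b3) * q"
    by (simp add: r_def s_def algebra_simps)
  then have e3b: "- cnj b3 * r - \<i> * a3 * s = q" by (simp add: bb3)
  text \<open>The products \<open>e2 e3 = e4 = - e3 e2\<close>, applied to \<open>(x, y)\<close>.\<close>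
  have m1: "\<i> * a2 * (\<i> * a3 * x + b3 * y) + b2 * (- cnj b3 * x - \<i> * a3 * y) = \<i> * a4 * x + b4 * y"
    and m2: "- cnj b2 * (\<i> * a3 * x + b3 * y) - \<i> * a2 * (- cnj b3 * x - \<i> * a3 * y) = - cnj b4 * x - \<i> * a4 * y"
    and m3: "\<i> * a3 * (\<i> * a2 * x + b2 * y) + b3 * (- cnj b2 * x - \<i> * a2 * y) = - (\<i> * a4 * x + b4 * y)"
    and m4: "- cnj b3 * (\<i> * a2 * x + b2 * y) - \<i> * a3 * (- cnj b2 * x - \<i> * a2 * y) = - (- cnj b4 * x - \<i> * a4 * y)"
    for x y
  proof -
    have "\<i> * a2 * (\<i> * a3 * x + b3 * y) + b2 * (- cnj b3 * x - \<i> * a3 * y)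
      = (- (a2 * a3) - b2 * cnj b3) * x + (\<i> * a2 * b3 - \<i> * a3 * b2) * y" by (simp add: algebra_simps)
    then show "\<i> * a2 * (\<i> * a3 * x + b3 * y) + b2 * (- cnj b3 * x - \<i> * a3 * y) = \<i> * a4 * x + b4 * y"
      by (simp only: p23 b4)
    have "- cnj b2 * (\<i> * a3 * x + b3 * y) - \<i> * a2 * (- cnj b3 * x - \<i> * a3 * y)
      = (- (a2 * a3) - cnj b2 * b3) * y - (- (\<i> * a2 * cnj b3) + \<i> * a3 * cnj b2) * x" by (simp add: algebra_simps)
    then show "- cnj b2 * (\<i> * a3 * x + b3 * y) - \<i> * a2 * (- cnj b3 * x - \<i> * a3 * y) = - cnj b4 * x - \<i> * a4 * y"
      by (simp only: p23' b4') (simp add: algebra_simps)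
    have "\<i> * a3 * (\<i> * a2 * x + b2 * y) + b3 * (- cnj b2 * x - \<i> * a2 * y)
      = (- (a2 * a3) - cnj b2 * b3) * x - (\<i> * a2 * b3 - \<i> * a3 * b2) * y" by (simp add: algebra_simps)
    then show "\<i> * a3 * (\<i> * a2 * x + b2 * y) + b3 * (- cnj b2 * x - \<i> * a2 * y) = - (\<i> * a4 * x + b4 * y)"
      by (simp only: p23' b4) (simp add: algebra_simps)
    have "- cnj b3 * (\<i> * a2 * x + b2 * y) - \<i> * a3 * (- cnj b2 * x - \<i> * a2 * y)
      = (- (a2 * a3) - b2 * cnj b3) * y + (- (\<i> * a2 * cnj b3) + \<i> * a3 * cnj b2) * x" by (simp add: algebra_simps)
    then show "- cnj b3 * (\<i> * a2 * x + b2 * y) - \<i> * a3 * (- cnj b2 * x - \<i> * a2 * y) = - (- cnj b4 * x - \<i> * a4 * y)"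
      by (simp only: p23 b4') (simp add: algebra_simps)
  qed
  have r': "\<i> * a3 * p + b3 * q = - r" and s': "- cnj b3 * p - \<i> * a3 * q = - s"
    by (simp_all add: r_def s_def)
  have e4p: "\<i> * a4 * p + b4 * q = \<i> * r"
    using m3[of p q] unfolding e2 by (simp add: r_def algebra_simps)
  have e4q: "- cnj b4 * p - \<i> * a4 * q = \<i> * s"
    using m4[of p q] unfolding e2 by (simp add: s_def algebra_simps)
  have "- (\<i> * a2 * r + b2 * s) = \<i> * r"
    using m1[of p q] unfolding r' s' e4p by (simp add: algebra_simps)
  then have e2r: "\<i> * a2 * r + b2 * s = - (\<i> * r)"
    by (metis minus_minus)
  have e2s: "- cnj b2 * r - \<i> * a2 * s = - (\<i> * s)"
    using m2[of p q] unfolding r' s' e4q by (simp add: algebra_simps)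
  have e4r: "\<i> * a4 * r + b4 * s = \<i> * p"
    using m1[of r s] unfolding e3a e3b e2 by simp
  have e4s: "- cnj b4 * r - \<i> * a4 * s = \<i> * q"
    using m2[of r s] unfolding e3a e3b e2 by simp
  have n1: "cnj p * p + cnj q * q = 1"
    using pq(1,2) by (simp add: mult.commute add_divide_distrib diff_divide_distrib)
  have "cnj r * r + cnj s * s = (a3 * a3 + b3 * cnj b3) * (cnj p * p + cnj q * q)"
    by (simp add: r_def s_def algebra_simps)
  then have n2: "cnj r * r + cnj s * s = 1" by (simp add: n1 bb3)
  have pq': "p * cnj q = - (\<i> * b2 / 2)" using arg_cong[OF pq(3), of cnj] by (simp add: mult.commute)
  have "cnj p * r + cnj q * s = - (\<i> * a3 * (p * cnj p)) + \<i> * a3 * (q * cnj q) - b3 * (q * cnj p) + cnj b3 * (p * cnj q)"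
    by (simp add: r_def s_def algebra_simps)
  also have "\<dots> = - (\<i> * (a2 * a3 + (b3 * cnj b2 + cnj b3 * b2) / 2))"
    unfolding pq pq' by (simp add: field_simps)
  also have "\<dots> = 0"
    using norm(3) by (simp add: complex_eq_iff)
  finally have n3: "cnj p * r + cnj q * s = 0" .
  show ?thesis
    by (rule that[OF n1 n2 n3 e2 e2r e2s r' s' e3a e3b e4p e4q e4r e4s])
qed

text \<open>The columns of the diagonal blocks are the two frames. The determinant is not
  normalised: conjugation by any unitary matrix already preserves \<open>su5\<close>.\<close>

definition block_frame ::
    "complex \<Rightarrow> complex \<Rightarrow> complex \<Rightarrow> complex \<Rightarrow> complex \<Rightarrow> complex \<Rightarrow> complex \<Rightarrow> complex \<Rightarrow> cmat5" where
  "block_frame p q r s p' q' r' s' = (\<chi> i j.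
     if i = 1 then (if j = 1 then p else if j = 2 then r else 0)
     else if i = 2 then (if j = 1 then q else if j = 2 then s else 0)
     else if i = 3 then (if j = 3 then p' else if j = 4 then r' else 0)
     else if i = 4 then (if j = 3 then q' else if j = 4 then s' else 0)
     else (if j = 5 then 1 else 0))"

lemma block_frame_nth:
  "block_frame p q r s p' q' r' s' $ 1 $ 1 = p"
  "block_frame p q r s p' q' r' s' $ 1 $ 2 = r"
  "block_frame p q r s p' q' r' s' $ 1 $ 3 = 0"
  "block_frame p q r s p' q' r' s' $ 1 $ 4 = 0"
  "block_frame p q r s p' q' r' s' $ 1 $ 5 = 0"
  "block_frame p q r s p' q' r' s' $ 2 $ 1 = q"
  "block_frame p q r s p' q' r' s' $ 2 $ 2 = s"
  "block_frame p q r s p' q' r' s' $ 2 $ 3 = 0"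
  "block_frame p q r s p' q' r' s' $ 2 $ 4 = 0"
  "block_frame p q r s p' q' r' s' $ 2 $ 5 = 0"
  "block_frame p q r s p' q' r' s' $ 3 $ 1 = 0"
  "block_frame p q r s p' q' r' s' $ 3 $ 2 = 0"
  "block_frame p q r s p' q' r' s' $ 3 $ 3 = p'"
  "block_frame p q r s p' q' r' s' $ 3 $ 4 = r'"
  "block_frame p q r s p' q' r' s' $ 3 $ 5 = 0"
  "block_frame p q r s p' q' r' s' $ 4 $ 1 = 0"
  "block_frame p q r s p' q' r' s' $ 4 $ 2 = 0"
  "block_frame p q r s p' q' r' s' $ 4 $ 3 = q'"
  "block_frame p q r s p' q' r' s' $ 4 $ 4 = s'"
  "block_frame p q r s p' q' r' s' $ 4 $ 5 = 0"
  "block_frame p q r s p' q' r' s' $ 5 $ 1 = 0"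
  "block_frame p q r s p' q' r' s' $ 5 $ 2 = 0"
  "block_frame p q r s p' q' r' s' $ 5 $ 3 = 0"
  "block_frame p q r s p' q' r' s' $ 5 $ 4 = 0"
  "block_frame p q r s p' q' r' s' $ 5 $ 5 = 1"
  by (simp_all add: block_frame_def)

lemma adj_block_frame_nth:
  "adj (block_frame p q r s p' q' r' s') $ 1 $ 1 = cnj p"
  "adj (block_frame p q r s p' q' r' s') $ 1 $ 2 = cnj q"
  "adj (block_frame p q r s p' q' r' s') $ 1 $ 3 = 0"
  "adj (block_frame p q r s p' q' r' s') $ 1 $ 4 = 0"
  "adj (block_frame p q r s p' q' r' s') $ 1 $ 5 = 0"
  "adj (block_frame p q r s p' q' r' s') $ 2 $ 1 = cnj r"
  "adj (block_frame p q r s p' q' r' s') $ 2 $ 2 = cnj s"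
  "adj (block_frame p q r s p' q' r' s') $ 2 $ 3 = 0"
  "adj (block_frame p q r s p' q' r' s') $ 2 $ 4 = 0"
  "adj (block_frame p q r s p' q' r' s') $ 2 $ 5 = 0"
  "adj (block_frame p q r s p' q' r' s') $ 3 $ 1 = 0"
  "adj (block_frame p q r s p' q' r' s') $ 3 $ 2 = 0"
  "adj (block_frame p q r s p' q' r' s') $ 3 $ 3 = cnj p'"
  "adj (block_frame p q r s p' q' r' s') $ 3 $ 4 = cnj q'"
  "adj (block_frame p q r s p' q' r' s') $ 3 $ 5 = 0"
  "adj (block_frame p q r s p' q' r' s') $ 4 $ 1 = 0"
  "adj (block_frame p q r s p' q' r' s') $ 4 $ 2 = 0"
  "adj (block_frame p q r s p' q' r' s') $ 4 $ 3 = cnj r'"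
  "adj (block_frame p q r s p' q' r' s') $ 4 $ 4 = cnj s'"
  "adj (block_frame p q r s p' q' r' s') $ 4 $ 5 = 0"
  "adj (block_frame p q r s p' q' r' s') $ 5 $ 1 = 0"
  "adj (block_frame p q r s p' q' r' s') $ 5 $ 2 = 0"
  "adj (block_frame p q r s p' q' r' s') $ 5 $ 3 = 0"
  "adj (block_frame p q r s p' q' r' s') $ 5 $ 4 = 0"
  "adj (block_frame p q r s p' q' r' s') $ 5 $ 5 = 1"
  by (simp_all add: adj_def block_frame_nth)

lemma dblock_frame:
  assumes mn: "m = 1 \<and> n = 2 \<or> m = 3 \<and> n = 4"
    and X: "X2 = dblock m n a2 b2" "X3 = dblock m n a3 b3" "X4 = dblock m n a4 b4" and nz: "X2 \<noteq> 0"
    and br: "bracket X2 X3 = 2 *\<^sub>R X4" "bracket X4 X2 = 2 *\<^sub>R X3" "bracket X3 X4 = 2 *\<^sub>R X2"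
  obtains p q r s :: complex where
    "cnj p * p + cnj q * q = 1" "cnj r * r + cnj s * s = 1" "cnj p * r + cnj q * s = 0"
    "\<i> * a2 * p + b2 * q = \<i> * p" "- cnj b2 * p - \<i> * a2 * q = \<i> * q"
    "\<i> * a2 * r + b2 * s = - (\<i> * r)" "- cnj b2 * r - \<i> * a2 * s = - (\<i> * s)"
    "\<i> * a3 * p + b3 * q = - r" "- cnj b3 * p - \<i> * a3 * q = - s"
    "\<i> * a3 * r + b3 * s = p" "- cnj b3 * r - \<i> * a3 * s = q"
    "\<i> * a4 * p + b4 * q = \<i> * r" "- cnj b4 * p - \<i> * a4 * q = \<i> * s"
    "\<i> * a4 * r + b4 * s = \<i> * p" "- cnj b4 * r - \<i> * a4 * s = \<i> * q"
proof -
  have ne: "m \<noteq> n" using mn by auto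
  have nz': "a2 \<noteq> 0 \<or> b2 \<noteq> 0"
    using nz unfolding X by (auto simp: dblock_def vec_eq_iff split: if_splits)
  have "Im (b3 * cnj b2) = a4 \<and> \<i> * (a2 * b3 - a3 * b2) = b4"
    "Im (b2 * cnj b4) = a3 \<and> \<i> * (a4 * b2 - a2 * b4) = b3"
    "Im (b4 * cnj b3) = a2 \<and> \<i> * (a3 * b4 - a4 * b3) = b2"
    using br unfolding X bracket_dblock[OF mn] by (simp_all add: dblock_eq_iff[OF ne])
  then have rel: "a4 = Im (b3 * cnj b2)" "b4 = \<i> * (a2 * b3 - a3 * b2)"
    "a3 = Im (b2 * cnj b4)" "b3 = \<i> * (a4 * b2 - a2 * b4)"
    "a2 = Im (b4 * cnj b3)" "b2 = \<i> * (a3 * b4 - a4 * b3)"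
    by metis+
  show ?thesis by (rule su2_frame[OF rel nz']) (rule that)
qed

section \<open>Matching the hypercomplex structure with right multiplication by quaternions\<close>

lemma axis_simps:
  fixes p q :: "'a::real_algebra_1"
  shows "axis n (- q) = - axis n q" "axis n (c *\<^sub>R q) = c *\<^sub>R axis n q" "axis n (p + q) = axis n p + axis n q"
  by (simp_all add: axis_def vec_eq_iff)

lemma rmul_axis: "rmul (axis n c) u = axis n (c * u)"
  by (simp add: rmul_def axis_def vec_eq_iff)

text \<open>Brackets with the imaginary part of the first and second quaternionic coordinate act on
  $\mathfrak{f}_1$ and $\mathfrak{f}_2$ as scalar multiplications.\<close>

lemma obata_matrix_f_sub:
  assumes "qre w = 0"
  shows "f $ 1 = 0 \<Longrightarrow> f $ 2 = 0 \<Longrightarrow> f $ 6 = 0 \<Longrightarrow>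
      obata_matrix (axis 1 w) *v f - obata_matrix f *v axis 1 w = rmul f w"
    and "f $ 1 = 0 \<Longrightarrow> f $ 2 = 0 \<Longrightarrow> f $ 3 = 0 \<Longrightarrow> f $ 4 = 0 \<Longrightarrow> f $ 5 = 0 \<Longrightarrow>
      obata_matrix (axis 2 w) *v f - obata_matrix f *v axis 2 w = rmul f w"
proof -
  have Q0: "Quat 0 0 0 0 = 0" by (simp add: quat_eq_iff)
  have *: "(M *v v) $ r = (\<Sum>k\<in>UNIV. M $ r $ k * v $ k)" for M :: "quat^6^6" and v r
    by (simp add: matrix_vector_mult_def)
  show "f $ 1 = 0 \<Longrightarrow> f $ 2 = 0 \<Longrightarrow> f $ 6 = 0 \<Longrightarrow>
      obata_matrix (axis 1 w) *v f - obata_matrix f *v axis 1 w = rmul f w"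
    unfolding vec_eq_iff forall_6 vector_minus_component * sum_6 obata_matrix_nth
    using assms by (simp add: axis_nth_if rmul_def Q0)
  show "f $ 1 = 0 \<Longrightarrow> f $ 2 = 0 \<Longrightarrow> f $ 3 = 0 \<Longrightarrow> f $ 4 = 0 \<Longrightarrow> f $ 5 = 0 \<Longrightarrow>
      obata_matrix (axis 2 w) *v f - obata_matrix f *v axis 2 w = rmul f w"
    unfolding vec_eq_iff forall_6 vector_minus_component * sum_6 obata_matrix_nth
    using assms by (simp add: axis_nth_if rmul_def Q0)
qed

lemma psi_axis:
  "psi (axis 1 1) = E2" "psi (axis 2 1) = E1"
  "psi (axis 1 (- quat_i)) = dblock 1 2 1 0" "psi (axis 1 (- quat_j)) = dblock 1 2 0 1"
  "psi (axis 1 (- quat_k)) = dblock 1 2 0 \<i>"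
  "psi (axis 2 (- quat_i)) = dblock 3 4 1 0" "psi (axis 2 (- quat_j)) = dblock 3 4 0 1"
  "psi (axis 2 (- quat_k)) = dblock 3 4 0 \<i>"
  unfolding vec_eq_iff forall_5 psi_nth
  by (simp_all add: axis_nth_if dblock_def E1_def E2_def complex_eq_iff)

text \<open>Conjugation by a block-diagonal matrix permits mixing only inside the blocks, so it
  keeps the off-diagonal supports that define f_1 and f_2.\<close>

lemma block_frame_f_sub:
  fixes p q r s p' q' r' s' f
  defines "X \<equiv> block_frame p q r s p' q' r' s' ** psi f ** adj (block_frame p q r s p' q' r' s')"
  assumes X: "X \<in> su5"
  shows "f $ 1 = 0 \<Longrightarrow> f $ 2 = 0 \<Longrightarrow> f $ 6 = 0 \<Longrightarrow> X \<in> f_sub 1"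
    and "f $ 1 = 0 \<Longrightarrow> f $ 2 = 0 \<Longrightarrow> f $ 3 = 0 \<Longrightarrow> f $ 4 = 0 \<Longrightarrow> f $ 5 = 0 \<Longrightarrow> X \<in> f_sub 2"
proof -
  have aX: "adj X = - X" using X by (simp add: su5_def)
  have *: "(A ** B) $ i $ j = (\<Sum>k\<in>UNIV. A $ i $ k * B $ k $ j)" for A B :: cmat5 and i j
    by (simp add: matrix_matrix_mult_def)
  have C0: "Complex 0 0 = 0" by (simp add: complex_eq_iff)
  show "X \<in> f_sub 1" if "f $ 1 = 0" "f $ 2 = 0" "f $ 6 = 0"
    unfolding f_sub_def block_def beyond_def mem_Collect_eq forall_5
    using aX by (simp add: X_def * sum_5 block_frame_nth adj_block_frame_nth psi_nth that C0)
  show "X \<in> f_sub 2" if "f $ 1 = 0" "f $ 2 = 0" "f $ 3 = 0" "f $ 4 = 0" "f $ 5 = 0"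
    unfolding f_sub_def block_def beyond_def mem_Collect_eq forall_5
    using aX by (simp add: X_def * sum_5 block_frame_nth adj_block_frame_nth psi_nth that C0)
qed

text \<open>The structure is prescribed by values on the e_k^i and by brackets on f_1 and f_2. These
  span the algebra, so a linear map agreeing with a right multiplication there agrees with it
  everywhere.\<close>

lemma quaternionic_structure_unique:
  fixes q :: "quat^6"
  assumes T: "linear_between su5 su5 T" and lin: "linear xi" and su: "\<And>q. xi q \<in> su5"
    and ax: "\<And>n c. n = 1 \<or> n = 2 \<Longrightarrow> c = 1 \<or> c = quat_i \<or> c = quat_j \<or> c = quat_k \<Longrightarrow>
      T (xi (axis n c)) = xi (rmul (axis n c) u)"
    and f1: "\<And>f. f $ 1 = 0 \<Longrightarrow> f $ 2 = 0 \<Longrightarrow> f $ 6 = 0 \<Longrightarrow> T (xi f) = xi (rmul f u)"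
    and f2: "\<And>f. f $ 1 = 0 \<Longrightarrow> f $ 2 = 0 \<Longrightarrow> f $ 3 = 0 \<Longrightarrow> f $ 4 = 0 \<Longrightarrow> f $ 5 = 0 \<Longrightarrow> T (xi f) = xi (rmul f u)"
  shows "T (xi q) = xi (rmul q u)"
proof -
  define S where "S = {q :: quat^6. T (xi q) = xi (rmul q u)}"
  have Tadd: "T (x + y) = T x + T y" and Tsc: "T (c *\<^sub>R x) = c *\<^sub>R T x" if "x \<in> su5" "y \<in> su5" for x y c
    using T that by (auto simp: linear_between_def)
  have rm: "rmul (v + w) u = rmul v u + rmul w u" "rmul (c *\<^sub>R v) u = c *\<^sub>R rmul v u" for v w :: "quat^6" and c
    by (simp_all add: rmul_def vec_eq_iff distrib_right)
  have S_add: "v + w \<in> S" if "v \<in> S" "w \<in> S" for v w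
    using that by (simp add: S_def linear_add[OF lin] rm Tadd su)
  have S_sc: "c *\<^sub>R v \<in> S" if "v \<in> S" for c v
    using that by (simp add: S_def linear_scale[OF lin] rm Tsc[OF su su])
  have S_axis: "axis n c \<in> S" if n: "n = 1 \<or> n = 2" for n c
  proof -
    have "axis n 1 \<in> S" "axis n quat_i \<in> S" "axis n quat_j \<in> S" "axis n quat_k \<in> S"
      unfolding S_def using ax[OF n] by simp_all
    then have "qre c *\<^sub>R axis n 1 + qi c *\<^sub>R axis n quat_i + qj c *\<^sub>R axis n quat_j + qk c *\<^sub>R axis n quat_k \<in> S"
      by (intro S_add S_sc)
    then show ?thesis by (simp only: axis_simps[symmetric] quat_basis_expand[symmetric])
  qed
  \<comment> \<open>Coordinates 3, 4, 5 make up f_1 and coordinate 6 makes up f_2.\<close>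
  define g :: "quat^6" where "g = (\<chi> n. if n = 3 \<or> n = 4 \<or> n = 5 then q $ n else 0)"
  have "g \<in> S" unfolding S_def by (simp add: f1 g_def)
  moreover have "axis 6 (q $ 6) \<in> S" unfolding S_def by (simp add: f2 axis_nth_if)
  moreover have "axis 1 (q $ 1) \<in> S" "axis 2 (q $ 2) \<in> S" using S_axis by auto
  ultimately have "axis 1 (q $ 1) + axis 2 (q $ 2) + g + axis 6 (q $ 6) \<in> S"
    by (intro S_add)
  also have "axis 1 (q $ 1) + axis 2 (q $ 2) + g + axis 6 (q $ 6) = q"
    by (simp add: vec_eq_iff forall_6 axis_nth_if g_def)
  finally show ?thesis by (simp add: S_def)
qed

theorem theorem4p10:
  fixes I J K :: "cmat5 \<Rightarrow> cmat5"
    and e :: "nat \<Rightarrow> nat \<Rightarrow> cmat5"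
    and D :: "(cmat5 \<Rightarrow> cmat5) \<Rightarrow> (cmat5 \<Rightarrow> cmat5) \<Rightarrow> cmat5 \<Rightarrow> cmat5"
  assumes "joyce_hypercomplex (vector [vector [0, 1], vector [1, 0]]) e I J K"
    and "obata_connection I J K D"
  shows "\<exists>\<Phi>. quaternionic_frame I J K \<Phi> \<and> matrix_action \<Phi> \<in> iso GL_quat (holonomy_group D)"
proof -
  have e11: "e 1 1 = E2" and e21: "e 2 1 = E1"
    using assms(1) by (simp_all add: joyce_hypercomplex_def joyce_basis_def)
  have basis: "independent (e i ` {2, 3, 4})" "span (e i ` {2, 3, 4}) = d_sub i"
    "bracket (e i 2) (e i 3) = 2 *\<^sub>R e i 4" "bracket (e i 4) (e i 2) = 2 *\<^sub>R e i 3"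
    "bracket (e i 3) (e i 4) = 2 *\<^sub>R e i 2" if "i \<in> {1, 2}" for i
    using assms(1) that unfolding joyce_hypercomplex_def joyce_basis_def by blast+
  have IJK: "linear_between su5 su5 I" "linear_between su5 su5 J" "linear_between su5 su5 K"
    "\<And>x. x \<in> su5 \<Longrightarrow> I (I x) = - x" "\<And>x. x \<in> su5 \<Longrightarrow> J (J x) = - x" "\<And>x. x \<in> su5 \<Longrightarrow> K (K x) = - x"
    using assms(1) unfolding joyce_hypercomplex_def by blast+
  have str: "I (e i 1) = e i 2" "I (e i 3) = e i 4" "J (e i 1) = e i 3" "J (e i 2) = - e i 4"
    "K (e i 1) = e i 4" "K (e i 2) = e i 3"
    "\<And>f. f \<in> f_sub i \<Longrightarrow> I f = bracket (e i 2) f \<and> J f = bracket (e i 3) f \<and> K f = bracket (e i 4) f"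
    if "i \<in> {1, 2}" for i
    using assms(1) that unfolding joyce_hypercomplex_def by blast+
  have in_d: "e i k \<in> d_sub i" if "i \<in> {1, 2}" "k \<in> {2, 3, 4}" for i k
    using basis(2)[OF that(1)] that(2) span_base[of "e i k" "e i ` {2, 3, 4}"] by blast
  have nz: "e i 2 \<noteq> 0" if "i \<in> {1, 2}" for i
    using basis(1)[OF that] dependent_zero[of "e i ` {2, 3, 4}"] by force
  define a where "a i k = (if i = 1 then Im (e i k $ 1 $ 1) else Im (e i k $ 3 $ 3))" for i k :: nat
  define b where "b i k = (if i = 1 then e i k $ 1 $ 2 else e i k $ 3 $ 4)" for i k :: nat
  have form1: "e 1 k = dblock 1 2 (a 1 k) (b 1 k)" and form2: "e 2 k = dblock 3 4 (a 2 k) (b 2 k)"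
    if "k \<in> {2, 3, 4}" for k
    using d_sub_dblock(1)[of "e 1 k"] d_sub_dblock(2)[of "e 2 k"] in_d[of 1 k] in_d[of 2 k] that
    by (simp_all add: a_def b_def)
  have k: "(2::nat) \<in> {2, 3, 4}" "(3::nat) \<in> {2, 3, 4}" "(4::nat) \<in> {2, 3, 4}"
    and i: "(1::nat) \<in> {1, 2}" "(2::nat) \<in> {1, 2}"
    and mn: "(1::5) = 1 \<and> (2::5) = 2 \<or> (1::5) = 3 \<and> (2::5) = 4" "(3::5) = 1 \<and> (4::5) = 2 \<or> (3::5) = 3 \<and> (4::5) = 4"
    by simp_all
  obtain p q r s where block1: "cnj p * p + cnj q * q = 1" "cnj r * r + cnj s * s = 1" "cnj p * r + cnj q * s = 0"
    "\<i> * a 1 2 * p + b 1 2 * q = \<i> * p" "- cnj (b 1 2) * p - \<i> * a 1 2 * q = \<i> * q"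
    "\<i> * a 1 2 * r + b 1 2 * s = - (\<i> * r)" "- cnj (b 1 2) * r - \<i> * a 1 2 * s = - (\<i> * s)"
    "\<i> * a 1 3 * p + b 1 3 * q = - r" "- cnj (b 1 3) * p - \<i> * a 1 3 * q = - s"
    "\<i> * a 1 3 * r + b 1 3 * s = p" "- cnj (b 1 3) * r - \<i> * a 1 3 * s = q"
    "\<i> * a 1 4 * p + b 1 4 * q = \<i> * r" "- cnj (b 1 4) * p - \<i> * a 1 4 * q = \<i> * s"
    "\<i> * a 1 4 * r + b 1 4 * s = \<i> * p" "- cnj (b 1 4) * r - \<i> * a 1 4 * s = \<i> * q"
    by (rule dblock_frame[OF mn(1) form1[OF k(1)] form1[OF k(2)] form1[OF k(3)] nz[OF i(1)] basis(3-5)[OF i(1)]])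
  obtain p' q' r' s' where block2: "cnj p' * p' + cnj q' * q' = 1" "cnj r' * r' + cnj s' * s' = 1" "cnj p' * r' + cnj q' * s' = 0"
    "\<i> * a 2 2 * p' + b 2 2 * q' = \<i> * p'" "- cnj (b 2 2) * p' - \<i> * a 2 2 * q' = \<i> * q'"
    "\<i> * a 2 2 * r' + b 2 2 * s' = - (\<i> * r')" "- cnj (b 2 2) * r' - \<i> * a 2 2 * s' = - (\<i> * s')"
    "\<i> * a 2 3 * p' + b 2 3 * q' = - r'" "- cnj (b 2 3) * p' - \<i> * a 2 3 * q' = - s'"
    "\<i> * a 2 3 * r' + b 2 3 * s' = p'" "- cnj (b 2 3) * r' - \<i> * a 2 3 * s' = q'"
    "\<i> * a 2 4 * p' + b 2 4 * q' = \<i> * r'" "- cnj (b 2 4) * p' - \<i> * a 2 4 * q' = \<i> * s'"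
    "\<i> * a 2 4 * r' + b 2 4 * s' = \<i> * p'" "- cnj (b 2 4) * r' - \<i> * a 2 4 * s' = \<i> * q'"
    by (rule dblock_frame[OF mn(2) form2[OF k(1)] form2[OF k(2)] form2[OF k(3)] nz[OF i(2)] basis(3-5)[OF i(2)]])
  \<comment> \<open>Conjugation by \<open>U\<close> takes the standard elements
    \<open>psi (axis 1 c)\<close> and \<open>psi (axis 2 c)\<close> to the given basis. It fixes
    \<open>E1\<close> and \<open>E2\<close>, which are scalar on each block.\<close>
  define U where "U = block_frame p q r s p' q' r' s'"
  have ent: "(A ** B) $ i $ j = (\<Sum>k\<in>UNIV. A $ i $ k * B $ k $ j)" for A B :: cmat5 and i j
    by (simp add: matrix_matrix_mult_def)
  note U_simps = ent sum_5 block_frame_nth adj_block_frame_nth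
  have "cnj r * p + cnj s * q = 0" "cnj r' * p' + cnj s' * q' = 0"
    using arg_cong[OF block1(3), of cnj] arg_cong[OF block2(3), of cnj] by (simp_all add: mult.commute)
  then have U1: "adj U ** U = mat 1"
    unfolding U_def vec_eq_iff forall_5 U_simps using block1(1-3) block2(1-3) by (simp add: mat_def)
  then have U2: "U ** adj U = mat 1" by (simp add: matrix_left_right_inverse)
  define xi where "xi q = U ** psi q ** adj U" for q
  define th where "th x = phi (adj U ** x ** U)" for x
  have xi_su5: "xi q \<in> su5" for q
  proof -
    have "psi q \<in> su5" by (rule psi_in_su5)
    moreover have "trace (U ** psi q ** adj U) = trace (adj U ** (U ** psi q))" by (rule trace_mul_sym)
    ultimately show ?thesis
      by (simp add: xi_def su5_def adj_mult matrix_mul_assoc U1 mmult.minus_left mmult.minus_right)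
  qed
  have UU: "adj U ** (U ** X ** adj U) ** U = X" for X
  proof -
    have "adj U ** (U ** X ** adj U) ** U = (adj U ** U) ** X ** (adj U ** U)" by (simp only: matrix_mul_assoc)
    then show ?thesis by (simp add: U1)
  qed
  have xi_th: "xi (th x) = x" if x: "x \<in> su5" for x
  proof -
    have "trace (adj U ** x ** U) = trace (U ** (adj U ** x))" by (rule trace_mul_sym)
    then have "adj U ** x ** U \<in> su5"
      using x by (simp add: su5_def adj_mult matrix_mul_assoc U2 mmult.minus_left mmult.minus_right)
    then have "xi (th x) = U ** (adj U ** x ** U) ** adj U" by (simp add: xi_def th_def psi_phi)
    also have "\<dots> = (U ** adj U) ** x ** (U ** adj U)" by (simp only: matrix_mul_assoc)
    finally show ?thesis by (simp add: U2)
  qed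
  have th_xi: "th (xi q) = q" for q by (simp add: th_def xi_def UU phi_psi)
  have lin_xi: "linear xi"
    unfolding xi_def[abs_def]
    by (intro linearI) (simp_all add: linear_add[OF linear_psi] linear_scale[OF linear_psi] mmult.add_left mmult.add_right
        mmult.scaleR_left mmult.scaleR_right)
  have lin_th: "linear th"
    unfolding th_def[abs_def]
    by (intro linearI) (simp_all add: mmult.add_left mmult.add_right mmult.scaleR_left mmult.scaleR_right
        linear_add[OF linear_phi] linear_scale[OF linear_phi])
  have bracket_xi: "bracket (xi v) (xi w) = xi (obata_matrix v *v w - obata_matrix w *v v)" for v w
  proof -
    have m: "xi v ** xi w = U ** (psi v ** psi w) ** adj U" for v w
    proof -
      have "xi v ** xi w = U ** psi v ** (adj U ** U) ** psi w ** adj U" by (simp only: xi_def matrix_mul_assoc)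
      then show ?thesis by (simp add: U1 matrix_mul_assoc)
    qed
    show ?thesis
      unfolding xi_def[of "obata_matrix v *v w - obata_matrix w *v v"] bracket_psi[symmetric]
      by (simp add: bracket_def m mmult.diff_left mmult.diff_right)
  qed
  \<comment> \<open>In this intertwining form the entries to be compared are exactly the vector
    relations of \<open>block1\<close> and \<open>block2\<close>.\<close>
  have xi_eq: "xi v = X" if "X ** U = U ** psi v" for v X
  proof -
    have "X ** (U ** adj U) = xi v" using that by (simp add: xi_def matrix_mul_assoc)
    then show ?thesis by (simp add: U2)
  qed
  have xi1: "xi (axis 1 1) = e 1 1" "xi (axis 1 (- quat_i)) = e 1 2" "xi (axis 1 (- quat_j)) = e 1 3"
    "xi (axis 1 (- quat_k)) = e 1 4"
  proof -
    show "xi (axis 1 1) = e 1 1"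
      unfolding e11 by (rule xi_eq)
        (unfold psi_axis U_def vec_eq_iff forall_5 U_simps, simp add: E2_def)
    show "xi (axis 1 (- quat_i)) = e 1 2"
      by (rule xi_eq) (unfold psi_axis U_def vec_eq_iff forall_5 U_simps form1[OF k(1)],
          use block1 in \<open>simp add: dblock_def mult.commute\<close>)
    show "xi (axis 1 (- quat_j)) = e 1 3"
      by (rule xi_eq) (unfold psi_axis U_def vec_eq_iff forall_5 U_simps form1[OF k(2)],
          use block1 in \<open>simp add: dblock_def mult.commute\<close>)
    show "xi (axis 1 (- quat_k)) = e 1 4"
      by (rule xi_eq) (unfold psi_axis U_def vec_eq_iff forall_5 U_simps form1[OF k(3)],
          use block1 in \<open>simp add: dblock_def mult.commute\<close>)
  qed
  have xi2: "xi (axis 2 1) = e 2 1" "xi (axis 2 (- quat_i)) = e 2 2" "xi (axis 2 (- quat_j)) = e 2 3"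
    "xi (axis 2 (- quat_k)) = e 2 4"
  proof -
    show "xi (axis 2 1) = e 2 1"
      unfolding e21 by (rule xi_eq)
        (unfold psi_axis U_def vec_eq_iff forall_5 U_simps, simp add: E1_def)
    show "xi (axis 2 (- quat_i)) = e 2 2"
      by (rule xi_eq) (unfold psi_axis U_def vec_eq_iff forall_5 U_simps form2[OF k(1)],
          use block2 in \<open>simp add: dblock_def mult.commute\<close>)
    show "xi (axis 2 (- quat_j)) = e 2 3"
      by (rule xi_eq) (unfold psi_axis U_def vec_eq_iff forall_5 U_simps form2[OF k(2)],
          use block2 in \<open>simp add: dblock_def mult.commute\<close>)
    show "xi (axis 2 (- quat_k)) = e 2 4"
      by (rule xi_eq) (unfold psi_axis U_def vec_eq_iff forall_5 U_simps form2[OF k(3)],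
          use block2 in \<open>simp add: dblock_def mult.commute\<close>)
  qed
  \<comment> \<open>Only n = 1 and n = 2 matter; the default 2 keeps the value in the admissible
    range for every n.\<close>
  define idx :: "6 \<Rightarrow> nat" where "idx n = (if n = 1 then 1 else 2)" for n
  have xi_axis: "xi (axis n 1) = e (idx n) 1" "xi (axis n quat_i) = - e (idx n) 2"
    "xi (axis n quat_j) = - e (idx n) 3" "xi (axis n quat_k) = - e (idx n) 4" if "n = 1 \<or> n = 2" for n
    using that xi1 xi2 by (auto simp: idx_def axis_simps linear_neg[OF lin_xi] minus_equation_iff[of _ "e _ _"])
  have idx: "idx n \<in> {1, 2}" for n by (simp add: idx_def)
  have e_su5: "e (idx n) k \<in> su5" if "n = 1 \<or> n = 2" "k \<in> {1, 2, 3, 4}" for n k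
  proof (cases "k = 1")
    case True
    then show ?thesis using xi_su5[of "axis n 1"] xi_axis(1)[OF that(1)] by simp
  next
    case False
    then show ?thesis using in_d[OF idx[of n], of k] that(2) by (auto simp: d_sub_def)
  qed
  have T_neg: "T (- x) = - T x" if "linear_between su5 su5 T" "x \<in> su5" for T x
  proof -
    have "T ((- 1) *\<^sub>R x) = (- 1) *\<^sub>R T x" using that unfolding linear_between_def by blast
    then show ?thesis by simp
  qed
  have f1: "xi f \<in> f_sub 1" if "f $ 1 = 0" "f $ 2 = 0" "f $ 6 = 0" for f
    using block_frame_f_sub(1)[of p q r s p' q' r' s' f] xi_su5[of f] that by (simp add: xi_def U_def)
  have f2: "xi f \<in> f_sub 2" if "f $ 1 = 0" "f $ 2 = 0" "f $ 3 = 0" "f $ 4 = 0" "f $ 5 = 0" for f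
    using block_frame_f_sub(2)[of p q r s p' q' r' s' f] xi_su5[of f] that by (simp add: xi_def U_def)
  have I_xi: "I (xi v) = xi (rmul v (- quat_i))" for v
  proof (rule quaternionic_structure_unique[OF IJK(1) lin_xi xi_su5])
    fix n :: 6 and c assume n: "n = 1 \<or> n = 2" and c: "c = 1 \<or> c = quat_i \<or> c = quat_j \<or> c = quat_k"
    \<comment> \<open>The values of \<open>I\<close> are prescribed on e_1 and e_3 only; I^2 = -1
      supplies the other two. The same completion is used for \<open>J\<close> and
      \<open>K\<close>.\<close>
    have "I (e (idx n) 2) = - e (idx n) 1" "I (e (idx n) 4) = - e (idx n) 3"
      using IJK(4)[OF e_su5[OF n, of 1]] IJK(4)[OF e_su5[OF n, of 3]] str(1,2)[OF idx[of n]] by simp_all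
    then show "I (xi (axis n c)) = xi (rmul (axis n c) (- quat_i))"
      using c by (elim disjE) (simp_all add: rmul_axis quat_unit_mult axis_simps linear_neg[OF lin_xi]
          xi_axis[OF n] T_neg[OF IJK(1) e_su5[OF n]] str(1,2)[OF idx[of n]] del: One_nat_def)
  next
    fix f :: "quat^6"
    show "I (xi f) = xi (rmul f (- quat_i))" if "f $ 1 = 0" "f $ 2 = 0" "f $ 6 = 0"
      using str(7)[of 1 "xi f", OF _ f1[OF that]] obata_matrix_f_sub(1)[of "- quat_i" f] that
      by (simp add: xi1(2)[symmetric] bracket_xi del: One_nat_def)
    show "I (xi f) = xi (rmul f (- quat_i))" if "f $ 1 = 0" "f $ 2 = 0" "f $ 3 = 0" "f $ 4 = 0" "f $ 5 = 0"
      using str(7)[of 2 "xi f", OF _ f2[OF that]] obata_matrix_f_sub(2)[of "- quat_i" f] that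
      by (simp add: xi2(2)[symmetric] bracket_xi del: One_nat_def)
  qed
  have J_xi: "J (xi v) = xi (rmul v (- quat_j))" for v
  proof (rule quaternionic_structure_unique[OF IJK(2) lin_xi xi_su5])
    fix n :: 6 and c assume n: "n = 1 \<or> n = 2" and c: "c = 1 \<or> c = quat_i \<or> c = quat_j \<or> c = quat_k"
    have "J (e (idx n) 3) = - e (idx n) 1" "J (e (idx n) 4) = e (idx n) 2"
      using IJK(5)[OF e_su5[OF n, of 1]] IJK(5)[OF e_su5[OF n, of 2]] str(3,4)[OF idx[of n]]
        T_neg[OF IJK(2) e_su5[OF n, of 4]] by simp_all
    then show "J (xi (axis n c)) = xi (rmul (axis n c) (- quat_j))"
      using c by (elim disjE) (simp_all add: rmul_axis quat_unit_mult axis_simps linear_neg[OF lin_xi]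
          xi_axis[OF n] T_neg[OF IJK(2) e_su5[OF n]] str(3,4)[OF idx[of n]] del: One_nat_def)
  next
    fix f :: "quat^6"
    show "J (xi f) = xi (rmul f (- quat_j))" if "f $ 1 = 0" "f $ 2 = 0" "f $ 6 = 0"
      using str(7)[of 1 "xi f", OF _ f1[OF that]] obata_matrix_f_sub(1)[of "- quat_j" f] that
      by (simp add: xi1(3)[symmetric] bracket_xi del: One_nat_def)
    show "J (xi f) = xi (rmul f (- quat_j))" if "f $ 1 = 0" "f $ 2 = 0" "f $ 3 = 0" "f $ 4 = 0" "f $ 5 = 0"
      using str(7)[of 2 "xi f", OF _ f2[OF that]] obata_matrix_f_sub(2)[of "- quat_j" f] that
      by (simp add: xi2(3)[symmetric] bracket_xi del: One_nat_def)
  qed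
  have K_xi: "K (xi v) = xi (rmul v (- quat_k))" for v
  proof (rule quaternionic_structure_unique[OF IJK(3) lin_xi xi_su5])
    fix n :: 6 and c assume n: "n = 1 \<or> n = 2" and c: "c = 1 \<or> c = quat_i \<or> c = quat_j \<or> c = quat_k"
    have "K (e (idx n) 4) = - e (idx n) 1" "K (e (idx n) 3) = - e (idx n) 2"
      using IJK(6)[OF e_su5[OF n, of 1]] IJK(6)[OF e_su5[OF n, of 2]] str(5,6)[OF idx[of n]] by simp_all
    then show "K (xi (axis n c)) = xi (rmul (axis n c) (- quat_k))"
      using c by (elim disjE) (simp_all add: rmul_axis quat_unit_mult axis_simps linear_neg[OF lin_xi]
          xi_axis[OF n] T_neg[OF IJK(3) e_su5[OF n]] str(5,6)[OF idx[of n]] del: One_nat_def)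
  next
    fix f :: "quat^6"
    show "K (xi f) = xi (rmul f (- quat_k))" if "f $ 1 = 0" "f $ 2 = 0" "f $ 6 = 0"
      using str(7)[of 1 "xi f", OF _ f1[OF that]] obata_matrix_f_sub(1)[of "- quat_k" f] that
      by (simp add: xi1(4)[symmetric] bracket_xi del: One_nat_def)
    show "K (xi f) = xi (rmul f (- quat_k))" if "f $ 1 = 0" "f $ 2 = 0" "f $ 3 = 0" "f $ 4 = 0" "f $ 5 = 0"
      using str(7)[of 2 "xi f", OF _ f2[OF that]] obata_matrix_f_sub(2)[of "- quat_k" f] that
      by (simp add: xi2(4)[symmetric] bracket_xi del: One_nat_def)
  qed
  interpret su5_obata I J K D th xi
    by (intro su5_obata.intro lin_th lin_xi xi_su5 th_xi xi_th bracket_xi I_xi J_xi K_xi assms(2))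
  have "quaternionic_frame I J K th"
    unfolding quaternionic_frame_def
  proof (intro conjI ballI allI)
    show "linear_between su5 UNIV th"
      by (simp add: linear_between_def linear_add[OF lin_th] linear_scale[OF lin_th])
    show "bij_betw th su5 UNIV"
      by (rule bij_betw_byWitness[where f' = xi]) (auto simp: xi_th th_xi xi_su5)
    fix x n assume "x \<in> su5"
    then have x: "x = xi (th x)" by (simp add: xi_th)
    show "th (I x) $ n = th x $ n * - quat_i" "th (J x) $ n = th x $ n * - quat_j"
      "th (K x) $ n = th x $ n * - quat_k"
      by (subst x, simp add: I_xi J_xi K_xi th_xi rmul_def)+
  qed
  then show ?thesis using matrix_action_iso by blast
qed

end
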